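(* If $\Omega\subset\mathbb{R}^2$ is non-empty, open and simply connected with finite measure, then $$F(\Omega)<1-\frac{3^4}{12801\cdot 2^{31}\Big(1+\frac{\pi+\pi^2}{16}\Big)^4},\qquad\text{where}\qquad F(\Omega)=\frac{T(\Omega)\,\lambda(\Omega)}{|\Omega|}.$$
   Context: For a non-empty open set $\Omega\subset\mathbb{R}^2$ of finite Lebesgue measure $|\Omega|$: $\lambda(\Omega)$ is the first eigenvalue of the Dirichlet Laplacian acting in $L^2(\Omega)$, i.e. $$\lambda(\Omega)=\inf\Big\{\frac{\int_\Omega|\nabla u|^2}{\int_\Omega u^2}: u\in H^1_0(\Omega),\ u\not\equiv 0\Big\};$$ $w_\Omega$ is the torsion function, i.e. the unique weak solution of $-\Delta w=1$, $w\in H^1_0(\Omega)$; and $T(\Omega)=\|w_\Omega\|_1=\int_\Omega w_\Omega$ is the torsional rigidity of $\Omega$. *)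

theory Defs
  imports "HOL-Analysis.Analysis"
begin

text \<open>Real Lebesgue space \<open>L\<^sup>2(\<Omega>)\<close> of scalar or vector valued functions. Elements are functions rather
  than equivalence classes, and their values outside \<open>\<Omega>\<close> are irrelevant.\<close>

definition L2 :: "'a::euclidean_space set \<Rightarrow> ('a \<Rightarrow> 'b::euclidean_space) set" where
  "L2 \<Omega> = {u \<in> borel_measurable (lebesgue_on \<Omega>). integrable (lebesgue_on \<Omega>) (\<lambda>x. (norm (u x))\<^sup>2)}"

text \<open>Continuous differentiability up to order \<open>k\<close> on the whole space, by recursion on directional
  derivatives.\<close>

primrec Ck :: "nat \<Rightarrow> ('a::euclidean_space \<Rightarrow> real) \<Rightarrow> bool" where
  "Ck 0 f \<longleftrightarrow> continuous_on UNIV f"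
| "Ck (Suc k) f \<longleftrightarrow> f differentiable_on UNIV \<and> (\<forall>v. Ck k (\<lambda>x. frechet_derivative f (at x) v))"

definition test_function :: "'a::euclidean_space set \<Rightarrow> ('a \<Rightarrow> real) \<Rightarrow> bool" where
  "test_function \<Omega> \<phi> \<longleftrightarrow>
    (\<forall>k. Ck k \<phi>) \<and> compact (closure {x. \<phi> x \<noteq> 0}) \<and> closure {x. \<phi> x \<noteq> 0} \<subseteq> \<Omega>"

definition grad :: "('a::euclidean_space \<Rightarrow> real) \<Rightarrow> 'a \<Rightarrow> 'a" where
  "grad \<phi> x = (\<Sum>b\<in>Basis. frechet_derivative \<phi> (at x) b *\<^sub>R b)"

text \<open>The integration by parts formula is an identity between vectors, that is, one scalar identity
  for each partial derivative.\<close>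

definition has_weak_gradient ::
    "'a::euclidean_space set \<Rightarrow> ('a \<Rightarrow> real) \<Rightarrow> ('a \<Rightarrow> 'a) \<Rightarrow> bool" where
  "has_weak_gradient \<Omega> u g \<longleftrightarrow>
    (\<forall>\<phi>. test_function \<Omega> \<phi> \<longrightarrow>
      (LINT x|lebesgue_on \<Omega>. u x *\<^sub>R grad \<phi> x) = - (LINT x|lebesgue_on \<Omega>. \<phi> x *\<^sub>R g x))"

definition H1 :: "'a::euclidean_space set \<Rightarrow> ('a \<Rightarrow> real) set" where
  "H1 \<Omega> = {u \<in> L2 \<Omega>. \<exists>g\<in>L2 \<Omega>. has_weak_gradient \<Omega> u g}"

text \<open>A representative of the weak gradient, which is unique up to null sets; only meaningful for
  \<open>u \<in> H1 \<Omega>\<close>.\<close>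

definition weak_grad :: "'a::euclidean_space set \<Rightarrow> ('a \<Rightarrow> real) \<Rightarrow> 'a \<Rightarrow> 'a" where
  "weak_grad \<Omega> u = (SOME g. g \<in> L2 \<Omega> \<and> has_weak_gradient \<Omega> u g)"

text \<open>\<open>H\<^sup>1\<^sub>0(\<Omega>)\<close> is the closure of the test functions in the \<open>H\<^sup>1\<close> norm.\<close>

definition H10 :: "'a::euclidean_space set \<Rightarrow> ('a \<Rightarrow> real) set" where
  "H10 \<Omega> = {u \<in> H1 \<Omega>. \<exists>\<phi>. (\<forall>n. test_function \<Omega> (\<phi> n)) \<and>
     (\<lambda>n::nat. (LINT x|lebesgue_on \<Omega>. (\<phi> n x - u x)\<^sup>2)
             + (LINT x|lebesgue_on \<Omega>. (norm (grad (\<phi> n) x - weak_grad \<Omega> u x))\<^sup>2)) \<longlonglongrightarrow> 0}"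

definition first_eigenvalue :: "'a::euclidean_space set \<Rightarrow> real" where
  "first_eigenvalue \<Omega> =
    Inf {(LINT x|lebesgue_on \<Omega>. (norm (weak_grad \<Omega> u x))\<^sup>2) / (LINT x|lebesgue_on \<Omega>. (u x)\<^sup>2) | u.
           u \<in> H10 \<Omega> \<and> \<not> (AE x in lebesgue_on \<Omega>. u x = 0)}"

text \<open>Weak solutions of \<open>- \<Delta>w = 1\<close> in \<open>\<Omega>\<close> with zero boundary values.\<close>

definition torsion_solution :: "'a::euclidean_space set \<Rightarrow> ('a \<Rightarrow> real) \<Rightarrow> bool" where
  "torsion_solution \<Omega> w \<longleftrightarrow> w \<in> H10 \<Omega> \<and>
    (\<forall>v\<in>H10 \<Omega>. (LINT x|lebesgue_on \<Omega>. weak_grad \<Omega> w x \<bullet> weak_grad \<Omega> v x) = (LINT x|lebesgue_on \<Omega>. v x))"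

text \<open>The solution is unique only up to null sets, hence \<open>SOME\<close> rather than \<open>THE\<close>.\<close>

definition torsion_function :: "'a::euclidean_space set \<Rightarrow> 'a \<Rightarrow> real" where
  "torsion_function \<Omega> = (SOME w. torsion_solution \<Omega> w)"

definition torsional_rigidity :: "'a::euclidean_space set \<Rightarrow> real" where
  "torsional_rigidity \<Omega> = (LINT x|lebesgue_on \<Omega>. torsion_function \<Omega> x)"

definition polya_functional :: "'a::euclidean_space set \<Rightarrow> real" where
  "polya_functional \<Omega> = torsional_rigidity \<Omega> * first_eigenvalue \<Omega> / measure lebesgue \<Omega>"

end

theory Submission
  imports Defs "HOL-Complex_Analysis.Cauchy_Integral_Formula"
begin

text \<open>Let \<open>w\<close> be the torsion function and \<open>m\<close> its mean. Since \<open>\<integral>|\<nabla>w|\<^sup>2 = \<integral>w\<close>, the Rayleigh quotient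
  of \<open>w\<close> gives \<open>F \<le> m\<^sup>2|\<Omega>| / \<integral>w\<^sup>2\<close>, so it suffices to bound \<open>V = \<integral>(w - m)\<^sup>2\<close> below by a multiple of
  \<open>m\<^sup>2|\<Omega>|\<close>. Cut the plane into squares of side \<open>s\<close> with \<open>s\<^sup>2 = m/1250\<close>. In a simply connected domain
  every circle around a point outside \<open>\<Omega>\<close> leaves \<open>\<Omega>\<close>, so a one-dimensional Poincare inequality on
  circles bounds the integral of \<open>w\<^sup>2\<close> over the squares that are not contained in \<open>\<Omega>\<close> by
  \<open>O(s\<^sup>2) \<integral>|\<nabla>w|\<^sup>2\<close>; hence if \<open>w\<close> is close to \<open>m\<close>, these squares cover at most about half of \<open>\<Omega>\<close>.
  On a square contained in \<open>\<Omega>\<close>, testing \<open>- \<Delta>w = 1\<close> with a bump function shows that \<open>w\<close> differs from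
  every constant by at least a multiple of \<open>s\<^sup>6\<close> in the square of the \<open>L\<^sup>2\<close> norm.\<close>

section \<open>Smooth functions\<close>

text \<open>Nothing is known about the boundary of \<open>\<Omega>\<close>, and zero boundary values
  enter only through \<open>H10\<close>. All estimates are therefore quadratic: they are proved for
  test functions and passed to the limit. In the plane a removed point has zero capacity, so a
  missing point in a square constrains \<open>w\<close> only because the complement has no isolated
  points; this is where simple connectivity enters. Scaling dictates the size of the squares:
  \<open>w\<close> has the dimension of a squared length, so s^2 must be proportional to m for
  (number of squares) * s^6 to be comparable with m^2 |\<open>\<Omega>\<close>|. The factor 1250
  makes the squares outside contribute at most a quarter of m^2 |\<open>\<Omega>\<close>|. Since
  \<open>torsion_function\<close> and \<open>weak_grad\<close> are choices, existence of a weak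
  solution and uniqueness of weak gradients are established beforehand; the Poincare inequality
  behind existence is the same estimate on a very coarse grid. The stated constant enters only
  numerically: it lies below 4/10^13, while the argument gains nearly 9/10^13.\<close>

definition smooth :: "('a::euclidean_space \<Rightarrow> real) \<Rightarrow> bool" where
  "smooth f \<longleftrightarrow> (\<forall>k. Ck k f)"

lemma Ck_imp_continuous: "Ck k f \<Longrightarrow> continuous_on UNIV f"
  by (cases k) (auto intro: differentiable_imp_continuous_on)

text \<open>The product and chain rules leave one factor undifferentiated, which has to be used at
  the lower order.\<close>

lemma Ck_SucD: "Ck (Suc k) f \<Longrightarrow> Ck k f"
  by (induction k arbitrary: f) (auto intro: differentiable_imp_continuous_on)

text \<open>Any exhibited derivative may stand in for \<open>frechet_derivative\<close>, so the
  inductions below can work with explicit formulas.\<close>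

lemma Ck_Suc_iff_deriv:
  assumes "\<And>x. (f has_derivative f' x) (at x)"
  shows "Ck (Suc k) f \<longleftrightarrow> (\<forall>v. Ck k (\<lambda>x. f' x v))"
proof -
  have "frechet_derivative f (at x) = f' x" for x
    using frechet_derivative_at[OF assms] by simp
  moreover have "f differentiable_on UNIV"
    using assms by (auto simp: differentiable_on_def differentiable_def)
  ultimately show ?thesis by simp
qed

lemma Ck_Suc_has_derivative:
  "Ck (Suc k) f \<Longrightarrow> (f has_derivative frechet_derivative f (at x)) (at x)"
  using frechet_derivative_works by (auto simp: differentiable_on_def)

lemma Ck_const: "Ck k (\<lambda>x::'a::euclidean_space. c)"
proof (induction k arbitrary: c)
  case (Suc k)
  show ?case
    by (subst Ck_Suc_iff_deriv[where f'="\<lambda>x v. 0"]) (auto intro: Suc)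
qed auto

lemma Ck_bounded_linear: "bounded_linear f \<Longrightarrow> Ck k f"
proof (cases k)
  case (Suc m)
  assume "bounded_linear f"
  then show ?thesis unfolding Suc
    by (subst Ck_Suc_iff_deriv[where f'="\<lambda>x. f"])
       (auto intro: bounded_linear_imp_has_derivative Ck_const)
qed (auto intro: linear_continuous_on)

lemma Ck_add: "Ck k f \<Longrightarrow> Ck k g \<Longrightarrow> Ck k (\<lambda>x. f x + g x)"
proof (induction k arbitrary: f g)
  case (Suc k)
  show ?case
    by (subst Ck_Suc_iff_deriv[OF has_derivative_add[OF Ck_Suc_has_derivative Ck_Suc_has_derivative],
          OF Suc.prems])
       (use Suc in auto)
qed (auto intro: continuous_intros)

lemma Ck_mult: "Ck k f \<Longrightarrow> Ck k g \<Longrightarrow> Ck k (\<lambda>x. f x * g x)"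
proof (induction k arbitrary: f g)
  case (Suc k)
  show ?case
    by (subst Ck_Suc_iff_deriv[OF has_derivative_mult[OF Ck_Suc_has_derivative Ck_Suc_has_derivative],
          OF Suc.prems])
       (intro allI Ck_add Suc.IH; use Suc.prems Ck_SucD in auto)
qed (auto intro: continuous_intros)

lemma Ck_diff: "Ck k f \<Longrightarrow> Ck k g \<Longrightarrow> Ck k (\<lambda>x. f x - g x)"
  using Ck_add[of k f "\<lambda>x. -1 * g x"] Ck_mult[OF Ck_const, of k g "-1"] by simp

lemma Ck_sum: "(\<And>i. i \<in> I \<Longrightarrow> Ck k (f i)) \<Longrightarrow> Ck k (\<lambda>x. \<Sum>i\<in>I. f i x)"
  by (induction I rule: infinite_finite_induct) (auto intro: Ck_const Ck_add)

lemma Ck_prod: "(\<And>i. i \<in> I \<Longrightarrow> Ck k (f i)) \<Longrightarrow> Ck k (\<lambda>x. \<Prod>i\<in>I. f i x)"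
  by (induction I rule: infinite_finite_induct) (auto intro: Ck_const Ck_mult)

lemma Ck_inner: "Ck k (\<lambda>x::'a::euclidean_space. x \<bullet> b)"
  by (rule Ck_bounded_linear) (rule bounded_linear_inner_left)

lemma smooth_const: "smooth (\<lambda>x. c)" and smooth_inner: "smooth (\<lambda>x. x \<bullet> b)"
  and smooth_add: "smooth f \<Longrightarrow> smooth g \<Longrightarrow> smooth (\<lambda>x. f x + g x)"
  and smooth_diff: "smooth f \<Longrightarrow> smooth g \<Longrightarrow> smooth (\<lambda>x. f x - g x)"
  and smooth_mult: "smooth f \<Longrightarrow> smooth g \<Longrightarrow> smooth (\<lambda>x. f x * g x)"
  and smooth_sum: "(\<And>i. i \<in> I \<Longrightarrow> smooth (h i)) \<Longrightarrow> smooth (\<lambda>x. \<Sum>i\<in>I. h i x)"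
  and smooth_prod: "(\<And>i. i \<in> I \<Longrightarrow> smooth (h i)) \<Longrightarrow> smooth (\<lambda>x. \<Prod>i\<in>I. h i x)"
  by (simp_all add: smooth_def Ck_const Ck_inner Ck_add Ck_diff Ck_mult Ck_sum Ck_prod)

lemma smooth_continuous_on: "smooth f \<Longrightarrow> continuous_on S f"
  by (meson Ck_imp_continuous continuous_on_subset smooth_def subset_UNIV)

lemma smooth_has_derivative: "smooth f \<Longrightarrow> (f has_derivative frechet_derivative f (at x)) (at x)"
  using Ck_Suc_has_derivative unfolding smooth_def by blast

lemma smooth_frechet_derivative: "smooth f \<Longrightarrow> smooth (\<lambda>x. frechet_derivative f (at x) v)"
  unfolding smooth_def by (metis Ck.simps(2))

text \<open>Functions of the form \<open>q(t) t\<^sup>-\<^sup>n e\<^sup>-\<^sup>e\<^sup>/\<^sup>t\<close> on the positive half-line are closed under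
  differentiation, which makes them smooth in one stroke.\<close>

definition flat :: "real \<Rightarrow> nat \<Rightarrow> real poly \<Rightarrow> real \<Rightarrow> real" where
  "flat e n q t = (if t > 0 then poly q t / t ^ n * exp (- e / t) else 0)"

text \<open>The numerator t^2 q' - n t q + e q that appears when the derivative of q(t) t^-n
  exp(-e/t) is written over t^(n+2).\<close>

definition flat_deriv_poly :: "real \<Rightarrow> nat \<Rightarrow> real poly \<Rightarrow> real poly" where
  "flat_deriv_poly e n q = monom 1 2 * pderiv q - smult (real n) (monom 1 1 * q) + smult e q"

text \<open>With u = e/t the expression is e^-n u^n / exp u, and u tends to infinity as t decreases
  to 0.\<close>

lemma tendsto_inverse_power_exp:
  assumes "e > 0"
  shows "((\<lambda>t::real. exp (- e / t) / t ^ n) \<longlongrightarrow> 0) (at_right 0)"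
proof -
  have *: "filterlim (\<lambda>t::real. e * inverse t) at_top (at_right 0)"
    using assms filterlim_inverse_at_top_right
    by (intro filterlim_tendsto_pos_mult_at_top[OF tendsto_const]) auto
  have "((\<lambda>t::real. (1/e^n) * ((e * inverse t) ^ n / exp (e * inverse t))) \<longlongrightarrow> (1/e^n) * 0) (at_right 0)"
    by (intro tendsto_mult tendsto_const filterlim_compose[OF tendsto_power_div_exp_0 *])
  moreover have "eventually (\<lambda>t::real. (1/e^n) * ((e * inverse t) ^ n / exp (e * inverse t)) = exp (- e / t) / t ^ n) (at_right 0)"
    using assms by (intro eventually_at_rightI[of 0 1])
      (auto simp: field_simps power_mult_distrib exp_minus power_inverse)
  ultimately show ?thesis
    by (simp add: tendsto_cong)
qed

text \<open>Away from 0 this is calculus on an open half-line. At 0 the left difference quotient is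
  zero and the right one is \<open>poly q t * (exp (- e / t) / t ^ Suc n)\<close>: one more power in
  the denominator, still beaten by the exponential.\<close>

lemma flat_has_real_derivative:
  assumes e: "e > 0"
  shows "(flat e n q has_real_derivative flat e (n + 2) (flat_deriv_poly e n q) t) (at t)"
proof -
  consider "t > 0" | "t < 0" | "t = 0" by linarith
  then show ?thesis
  proof cases
    case 1
    have "((\<lambda>t. poly q t / t ^ n * exp (- e / t)) has_real_derivative
        flat e (n + 2) (flat_deriv_poly e n q) t) (at t)"
      apply (rule derivative_eq_intros poly_DERIV refl | use 1 in simp; fail)+
      using 1 apply (cases n)
       apply (simp_all add: flat_def flat_deriv_poly_def poly_monom field_simps power2_eq_square power_add)
      done
    then show ?thesis
      by (rule has_field_derivative_transform_within_open[of _ _ _ "{0<..}"])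
         (use 1 in \<open>auto simp: flat_def\<close>)
  next
    case 2
    have "((\<lambda>t. 0) has_real_derivative flat e (n + 2) (flat_deriv_poly e n q) t) (at t)"
      using 2 by (simp add: flat_def)
    then show ?thesis
      by (rule has_field_derivative_transform_within_open[of _ _ _ "{..<0}"])
         (use 2 in \<open>auto simp: flat_def\<close>)
  next
    case 3
    have "((\<lambda>t. poly q t * (exp (- e / t) / t ^ Suc n)) \<longlongrightarrow> poly q 0 * 0) (at_right 0)"
      by (intro tendsto_intros tendsto_inverse_power_exp e)
    moreover have "eventually (\<lambda>t. poly q t * (exp (- e / t) / t ^ Suc n) = (flat e n q (0 + t) - flat e n q 0) / t) (at_right 0)"
      by (intro eventually_at_rightI[of 0 1]) (auto simp: flat_def)
    ultimately have r: "((\<lambda>t. (flat e n q (0 + t) - flat e n q 0) / t) \<longlongrightarrow> 0) (at_right 0)"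
      by (simp add: tendsto_cong)
    have "eventually (\<lambda>t. 0 = (flat e n q (0 + t) - flat e n q 0) / t) (at_left 0)"
      by (intro eventually_at_leftI[of "-1" 0]) (auto simp: flat_def)
    then have l: "((\<lambda>t. (flat e n q (0 + t) - flat e n q 0) / t) \<longlongrightarrow> 0) (at_left 0)"
      by (simp add: tendsto_eventually eventually_mono)
    from l r have "((\<lambda>t. (flat e n q (0 + t) - flat e n q 0) / t) \<longlongrightarrow> 0) (at 0)"
      by (simp add: filterlim_split_at)
    then show ?thesis using 3 by (simp add: DERIV_def flat_def)
  qed
qed

text \<open>The induction ranges over all \<open>n\<close> and \<open>q\<close>, because the chain
  rule turns the outer function into another \<open>flat\<close> with a higher power and a new
  polynomial.\<close>

lemma Ck_flat_compose: "e > 0 \<Longrightarrow> Ck k \<rho> \<Longrightarrow> Ck k (\<lambda>x. flat e n q (\<rho> x))"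
proof (induction k arbitrary: n q)
  case 0
  have "continuous_on UNIV (flat e n q)"
    by (meson 0 DERIV_continuous continuous_at_imp_continuous_on flat_has_real_derivative)
  with 0 show ?case
    using continuous_on_compose2[of UNIV "flat e n q" UNIV \<rho>] by auto
next
  case (Suc k)
  have "((\<lambda>x. flat e n q (\<rho> x)) has_derivative
      (\<lambda>v. frechet_derivative \<rho> (at x) v * flat e (n + 2) (flat_deriv_poly e n q) (\<rho> x))) (at x)" for x
  proof -
    have "((flat e n q) has_derivative (\<lambda>v. v * flat e (n + 2) (flat_deriv_poly e n q) (\<rho> x))) (at (\<rho> x))"
      using flat_has_real_derivative[OF Suc.prems(1), of n q "\<rho> x"]
      by (simp add: has_field_derivative_def mult.commute[of _ "flat _ _ _ _"])
    from diff_chain_at[OF Ck_Suc_has_derivative[OF Suc.prems(2)] this]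
    show ?thesis by (simp add: o_def)
  qed
  moreover have "Ck k (\<lambda>x. frechet_derivative \<rho> (at x) v)" for v
    using Suc.prems by simp
  ultimately show ?case
    by (subst Ck_Suc_iff_deriv) (auto intro!: Ck_mult Suc.IH Suc.prems(1) Ck_SucD[OF Suc.prems(2)])
qed

lemma smooth_flat_compose: "e > 0 \<Longrightarrow> smooth \<rho> \<Longrightarrow> smooth (\<lambda>x. flat e n q (\<rho> x))"
  unfolding smooth_def by (auto intro: Ck_flat_compose)

section \<open>Test functions and integration by parts\<close>

lemma test_functionI:
  assumes "smooth \<phi>" "compact K" "K \<subseteq> \<Omega>" "\<And>x. x \<notin> K \<Longrightarrow> \<phi> x = 0"
  shows "test_function \<Omega> \<phi>"
proof -
  have "closure {x. \<phi> x \<noteq> 0} \<subseteq> K"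
    by (rule closure_minimal) (use assms compact_imp_closed in auto)
  moreover from this have "compact (closure {x. \<phi> x \<noteq> 0})"
    by (metis assms(2) closed_closure compact_Int_closed inf.absorb2)
  ultimately show ?thesis using assms by (auto simp: test_function_def smooth_def)
qed

lemma test_functionE:
  assumes "test_function \<Omega> \<phi>"
  obtains K where "smooth \<phi>" "compact K" "K \<subseteq> \<Omega>" "\<And>x. x \<notin> K \<Longrightarrow> \<phi> x = 0"
proof
  show "x \<notin> closure {x. \<phi> x \<noteq> 0} \<Longrightarrow> \<phi> x = 0" for x
    using closure_subset[of "{x. \<phi> x \<noteq> 0}"] by blast
qed (use assms in \<open>auto simp: test_function_def smooth_def\<close>)

lemma test_function_smooth: "test_function \<Omega> \<phi> \<Longrightarrow> smooth \<phi>"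
  by (auto simp: test_function_def smooth_def)

lemma test_function_outside: "test_function \<Omega> \<phi> \<Longrightarrow> x \<notin> \<Omega> \<Longrightarrow> \<phi> x = 0"
  by (elim test_functionE) auto

lemma frechet_derivative_eq_0_outside:
  assumes "closed K" "\<And>x. x \<notin> K \<Longrightarrow> \<phi> x = (0::real)" "x \<notin> K"
  shows "frechet_derivative \<phi> (at x) = (\<lambda>v. 0)"
proof -
  have "((\<lambda>x. 0) has_derivative (\<lambda>v. 0)) (at x)" by simp
  then have "(\<phi> has_derivative (\<lambda>v. 0)) (at x)"
    by (rule has_derivative_transform_within_open[of _ _ _ _ "- K"]) (use assms in auto)
  then show ?thesis using frechet_derivative_at by metis
qed

lemma test_function_frechet_derivative:
  assumes "test_function \<Omega> \<phi>"
  shows "test_function \<Omega> (\<lambda>x. frechet_derivative \<phi> (at x) v)"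
proof -
  obtain K where K: "smooth \<phi>" "compact K" "K \<subseteq> \<Omega>" "\<And>x. x \<notin> K \<Longrightarrow> \<phi> x = 0"
    using test_functionE[OF assms] by blast
  show ?thesis
    by (rule test_functionI[OF smooth_frechet_derivative K(2,3)])
      (use K(1,4) frechet_derivative_eq_0_outside[of K \<phi>] compact_imp_closed[OF K(2)] in auto)
qed

lemma test_function_add: "test_function \<Omega> \<phi> \<Longrightarrow> test_function \<Omega> \<psi> \<Longrightarrow> test_function \<Omega> (\<lambda>x. \<phi> x + \<psi> x)"
proof (elim test_functionE)
  fix K L assume "smooth \<phi>" "compact K" "K \<subseteq> \<Omega>" "\<And>x. x \<notin> K \<Longrightarrow> \<phi> x = 0"
    "smooth \<psi>" "compact L" "L \<subseteq> \<Omega>" "\<And>x. x \<notin> L \<Longrightarrow> \<psi> x = 0"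
  then show ?thesis by (intro test_functionI[where K="K \<union> L"] smooth_add compact_Un) auto
qed

lemma test_function_cmult: "test_function \<Omega> \<phi> \<Longrightarrow> test_function \<Omega> (\<lambda>x. c * \<phi> x)"
  by (elim test_functionE, rule test_functionI[OF smooth_mult[OF smooth_const]]) auto

section \<open>Gradients of smooth functions\<close>

lemma grad_inner:
  assumes "\<phi> differentiable at x"
  shows "grad \<phi> x \<bullet> v = frechet_derivative \<phi> (at x) v"
proof -
  interpret bounded_linear "frechet_derivative \<phi> (at x)"
    using assms frechet_derivative_works has_derivative_bounded_linear by blast
  have "frechet_derivative \<phi> (at x) v = frechet_derivative \<phi> (at x) (\<Sum>b\<in>Basis. (v \<bullet> b) *\<^sub>R b)"
    by (simp add: euclidean_representation)
  also have "\<dots> = (\<Sum>b\<in>Basis. (v \<bullet> b) * frechet_derivative \<phi> (at x) b)"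
    by (simp add: sum scaleR)
  finally show ?thesis
    by (simp add: grad_def inner_sum_left inner_commute[of v] mult.commute)
qed

lemma smooth_differentiable: "smooth \<phi> \<Longrightarrow> \<phi> differentiable at x"
  using smooth_has_derivative by (auto simp: differentiable_def)

lemma grad_inner_smooth: "smooth \<phi> \<Longrightarrow> grad \<phi> x \<bullet> v = frechet_derivative \<phi> (at x) v"
  by (simp add: grad_inner smooth_differentiable)

lemma grad_eqI: "(\<phi> has_derivative (\<lambda>v. g \<bullet> v)) (at x) \<Longrightarrow> grad \<phi> x = g"
  by (metis (no_types, lifting) differentiableI euclidean_eqI frechet_derivative_at grad_inner)

lemma smooth_has_derivative_grad: "smooth \<phi> \<Longrightarrow> (\<phi> has_derivative (\<lambda>v. grad \<phi> x \<bullet> v)) (at x)"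
  using smooth_has_derivative by (simp add: grad_inner_smooth)

lemma grad_add: "smooth \<phi> \<Longrightarrow> smooth \<psi> \<Longrightarrow> grad (\<lambda>x. \<phi> x + \<psi> x) x = grad \<phi> x + grad \<psi> x"
  by (rule grad_eqI)
     (auto intro!: derivative_eq_intros smooth_has_derivative_grad simp: inner_add_left)

lemma grad_cmult: "smooth \<phi> \<Longrightarrow> grad (\<lambda>x. c * \<phi> x) x = c *\<^sub>R grad \<phi> x"
  by (rule grad_eqI)
     (auto intro!: derivative_eq_intros smooth_has_derivative_grad)

lemma continuous_grad: "smooth \<phi> \<Longrightarrow> continuous_on S (grad \<phi>)"
  unfolding grad_def by (intro continuous_intros smooth_continuous_on smooth_frechet_derivative)

lemma grad_outside:
  assumes "closed K" "\<And>x. x \<notin> K \<Longrightarrow> \<phi> x = (0::real)" "x \<notin> K"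
  shows "grad \<phi> x = 0"
  by (simp add: grad_def frechet_derivative_eq_0_outside[OF assms])

section \<open>Integrals of compactly supported functions\<close>

lemma integrable_compact_support:
  fixes f :: "'a::euclidean_space \<Rightarrow> 'b::euclidean_space"
  assumes "continuous_on UNIV f" "compact K" "\<And>x. x \<notin> K \<Longrightarrow> f x = 0"
  shows "integrable lborel f"
proof -
  have "integrable lborel (\<lambda>x. indicator K x *\<^sub>R f x)"
    by (rule borel_integrable_compact[OF assms(2)]) (use assms continuous_on_subset in blast)
  moreover have "(\<lambda>x. indicator K x *\<^sub>R f x) = f"
    using assms(3) by (auto simp: indicator_def)
  ultimately show ?thesis by simp
qed

lemma bounded_compact_support:
  fixes f :: "'a::euclidean_space \<Rightarrow> real"
  assumes "continuous_on UNIV f" "compact K" "\<And>x. x \<notin> K \<Longrightarrow> f x = 0"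
  obtains B where "\<And>x. \<bar>f x\<bar> \<le> B" "B > 0"
proof -
  have "compact (f ` K)"
    using assms compact_continuous_image continuous_on_subset by blast
  then obtain B where B: "B > 0" "\<forall>x\<in>f ` K. norm x \<le> B"
    by (metis bounded_pos compact_imp_bounded)
  show thesis
    by (rule that[of B]) (use B assms(3) in \<open>force+\<close>)
qed

lemma integral_lborel_translation:
  fixes f :: "'a::euclidean_space \<Rightarrow> real"
  assumes "f \<in> borel_measurable borel"
  shows "(LINT x|lborel. f (c + x)) = (LINT x|lborel. f x)"
proof -
  have "(LINT x|lborel. f x) = (LINT x|distr lborel borel ((+) c). f x)"
    by (simp add: lborel_distr_plus)
  also have "\<dots> = (LINT x|lborel. f (c + x))"
    by (rule integral_distr) (use assms in auto)
  finally show ?thesis ..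
qed

text \<open>The integral of a difference quotient vanishes by translation invariance.\<close>

lemma integral_frechet_derivative_eq_0:
  fixes \<phi> :: "'a::euclidean_space \<Rightarrow> real"
  assumes \<phi>: "smooth \<phi>" and K: "compact K" "\<And>x. x \<notin> K \<Longrightarrow> \<phi> x = 0"
  shows "(LINT x|lborel. frechet_derivative \<phi> (at x) v) = 0"
proof -
  define D where "D x = frechet_derivative \<phi> (at x) v" for x
  have D: "smooth D" unfolding D_def by (rule smooth_frechet_derivative[OF \<phi>])
  have D0: "D x = 0" if "x \<notin> K" for x
    using frechet_derivative_eq_0_outside[of K \<phi> x] K(2) that compact_imp_closed[OF K(1)] by (auto simp: D_def)
  obtain B where B: "\<And>x. \<bar>D x\<bar> \<le> B" "B > 0"
    using bounded_compact_support[OF smooth_continuous_on[OF D] K(1) D0] by blast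
  define h where "h n = inverse (real (Suc n))" for n
  have h: "h n > 0" "h n \<le> 1" for n by (auto simp: h_def field_simps)
  define s where "s n x = (\<phi> (h n *\<^sub>R v + x) - \<phi> x) / h n" for n x
  \<comment> \<open>Since 0 < \<open>h n\<close> <= 1, every difference quotient is supported in
    \<open>K\<close> minus the segment from 0 to \<open>v\<close>. Hence one compact set serves for
    all \<open>n\<close>, and \<open>B\<close> times its indicator is the integrable
    majorant.\<close>
  define K' where "K' = {x - y | x y. x \<in> K \<and> y \<in> closed_segment 0 v}"
  have K': "compact K'" unfolding K'_def by (rule compact_differences[OF K(1) compact_segment])
  have d: "((\<lambda>t. \<phi> (t *\<^sub>R v + x)) has_real_derivative D (t *\<^sub>R v + x)) (at t)" for t x
  proof -
    have "((\<lambda>t. t *\<^sub>R v + x) has_derivative (\<lambda>t. t *\<^sub>R v)) (at t)"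
      by (auto intro!: derivative_eq_intros)
    from diff_chain_at[OF this smooth_has_derivative[OF \<phi>]]
    have "((\<lambda>t. \<phi> (t *\<^sub>R v + x)) has_derivative (\<lambda>r. frechet_derivative \<phi> (at (t *\<^sub>R v + x)) (r *\<^sub>R v))) (at t)"
      by (simp add: o_def)
    moreover have "(\<lambda>r. frechet_derivative \<phi> (at y) (r *\<^sub>R v)) = (*) (D y)" for y
      by (auto simp: D_def fun_eq_iff simp flip: grad_inner_smooth[OF \<phi>])
    ultimately show ?thesis unfolding has_field_derivative_def by metis
  qed
  have s_bound: "norm (s n x) \<le> B * indicator K' x" for n x
  proof (cases "x \<in> K'")
    case True
    obtain z where "\<phi> (h n *\<^sub>R v + x) - \<phi> (0 *\<^sub>R v + x) = (h n - 0) * D (z *\<^sub>R v + x)"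
      using MVT2[of 0 "h n" "\<lambda>t. \<phi> (t *\<^sub>R v + x)" "\<lambda>t. D (t *\<^sub>R v + x)"] d h by blast
    then show ?thesis using True B h[of n] by (simp add: s_def)
  next
    case False
    have "x \<notin> K"
    proof
      assume "x \<in> K"
      then have "x - 0 \<in> K'" unfolding K'_def by blast
      with False show False by simp
    qed
    moreover have "h n *\<^sub>R v + x \<notin> K"
    proof
      assume "h n *\<^sub>R v + x \<in> K"
      moreover have "h n *\<^sub>R v \<in> closed_segment 0 v"
        using h[of n] by (auto simp: closed_segment_def intro!: exI[of _ "h n"])
      ultimately have "(h n *\<^sub>R v + x) - h n *\<^sub>R v \<in> K'" unfolding K'_def by blast
      with False show False by simp
    qed
    ultimately show ?thesis using K(2) False by (simp add: s_def)
  qed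
  have "(\<lambda>n. s n x) \<longlonglongrightarrow> D x" for x
  proof -
    have "((\<lambda>t. (\<phi> (t *\<^sub>R v + x) - \<phi> x) / t) \<longlongrightarrow> D x) (at 0)"
      using d[of x 0] by (simp add: DERIV_def)
    moreover have "filterlim h (at 0) sequentially"
      unfolding filterlim_at h_def using LIMSEQ_inverse_real_of_nat by auto
    ultimately show ?thesis unfolding s_def using filterlim_compose by blast
  qed
  moreover have cont: "continuous_on UNIV \<phi>" by (rule smooth_continuous_on[OF \<phi>])
  have meas: "\<phi> \<in> borel_measurable borel" "D \<in> borel_measurable borel"
    by (intro borel_measurable_continuous_onI cont smooth_continuous_on D)+
  have "(\<lambda>n. LINT x|lborel. s n x) \<longlonglongrightarrow> (LINT x|lborel. D x)"
  proof (rule integral_dominated_convergence[where w="\<lambda>x. B * indicator K' x"])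
    show "integrable lborel (\<lambda>x. B * indicator K' x)"
      using integrable_real_indicator[of K' lborel] emeasure_compact_finite[OF K'] K'
      by (auto simp: borel_compact intro!: integrable_mult_right)
    show "s n \<in> borel_measurable lborel" for n
      unfolding s_def using meas by measurable
  qed (use calculation s_bound meas in auto)
  moreover have "(LINT x|lborel. s n x) = 0" for n
  proof -
    have i: "integrable lborel \<phi>" by (rule integrable_compact_support[OF cont K])
    have "integrable (distr lborel borel ((+) (h n *\<^sub>R v))) \<phi>" using i by (simp add: lborel_distr_plus)
    then have "integrable lborel (\<lambda>x. \<phi> (h n *\<^sub>R v + x))"
      by (subst (asm) integrable_distr_eq) (use meas in auto)
    with i show ?thesis
      unfolding s_def using integral_lborel_translation[OF meas(1), of "h n *\<^sub>R v"] by simp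
  qed
  ultimately show ?thesis by (simp add: D_def LIMSEQ_unique)
qed

text \<open>The product of both functions is smooth and vanishes outside \<open>K\<close>, so the
  integral of its derivative is zero; the product rule splits that integral.\<close>

lemma integral_by_parts_smooth:
  fixes \<phi> \<psi> :: "'a::euclidean_space \<Rightarrow> real"
  assumes \<phi>: "smooth \<phi>" "smooth \<psi>" and K: "compact K" "\<And>x. x \<notin> K \<Longrightarrow> \<phi> x = 0"
  shows "(LINT x|lborel. \<psi> x * frechet_derivative \<phi> (at x) v) = - (LINT x|lborel. \<phi> x * frechet_derivative \<psi> (at x) v)"
proof -
  have "frechet_derivative (\<lambda>x. \<phi> x * \<psi> x) (at x) v = \<psi> x * frechet_derivative \<phi> (at x) v + \<phi> x * frechet_derivative \<psi> (at x) v" for x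
    using frechet_derivative_at[OF has_derivative_mult[OF smooth_has_derivative[OF \<phi>(1)] smooth_has_derivative[OF \<phi>(2)]], of x]
    by (metis (no_types, lifting) add.commute mult.commute)
  then have "(LINT x|lborel. \<psi> x * frechet_derivative \<phi> (at x) v + \<phi> x * frechet_derivative \<psi> (at x) v) = 0"
    using integral_frechet_derivative_eq_0[OF smooth_mult[OF \<phi>] K(1), of v] K(2) by simp
  moreover have "integrable lborel (\<lambda>x. \<psi> x * frechet_derivative \<phi> (at x) v)"
    using frechet_derivative_eq_0_outside[of K \<phi>] K(2) compact_imp_closed[OF K(1)]
    by (intro integrable_compact_support[OF _ K(1)] continuous_intros smooth_continuous_on smooth_frechet_derivative \<phi>) auto
  moreover have "integrable lborel (\<lambda>x. \<phi> x * frechet_derivative \<psi> (at x) v)"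
    using K(2) by (intro integrable_compact_support[OF _ K(1)] continuous_intros smooth_continuous_on smooth_frechet_derivative \<phi>) auto
  ultimately show ?thesis by simp
qed

text \<open>The function spaces live on \<open>lebesgue_on \<Omega>\<close>, whereas translations,
  rotations and Fubini are available on \<open>lborel\<close>; this is the passage between the
  two.\<close>

lemma integral_lebesgue_on_support:
  fixes f :: "'a::euclidean_space \<Rightarrow> 'b::euclidean_space"
  assumes "open \<Omega>" "continuous_on UNIV f" "\<And>x. x \<notin> \<Omega> \<Longrightarrow> f x = 0"
  shows "(LINT x|lebesgue_on \<Omega>. f x) = (LINT x|lborel. f x)"
proof -
  have "(LINT x|lebesgue_on \<Omega>. f x) = (LINT x|lebesgue. indicator \<Omega> x *\<^sub>R f x)"
    by (rule integral_restrict_space) (use assms in auto)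
  also have "(\<lambda>x. indicator \<Omega> x *\<^sub>R f x) = f" using assms(3) by (auto simp: indicator_def)
  also have "(LINT x|lebesgue. f x) = (LINT x|lborel. f x)"
    by (rule integral_completion) (use assms in \<open>auto intro: borel_measurable_continuous_onI\<close>)
  finally show ?thesis .
qed

lemma integrable_lebesgue_on_continuous:
  fixes f :: "'a::euclidean_space \<Rightarrow> 'b::euclidean_space"
  assumes "open \<Omega>" "continuous_on UNIV f" "compact K" "\<And>x. x \<notin> K \<Longrightarrow> f x = 0"
  shows "integrable (lebesgue_on \<Omega>) f"
proof -
  have "integrable lebesgue f"
    using integrable_compact_support[OF assms(2-4)] integrable_completion[of f lborel]
      borel_measurable_continuous_onI[OF assms(2)] by auto
  then show ?thesis
    using integrable_mult_indicator[of \<Omega> lebesgue f] assms(1)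
    by (subst integrable_restrict_space) auto
qed

lemma measurable_lebesgue_on_continuous:
  fixes f :: "'a::euclidean_space \<Rightarrow> 'b::euclidean_space"
  assumes "continuous_on UNIV f"
  shows "f \<in> borel_measurable (lebesgue_on \<Omega>)"
  using borel_measurable_continuous_onI[OF assms]
  by (intro measurable_restrict_space1) (simp add: measurable_completion)

lemma L2_continuous:
  fixes f :: "'a::euclidean_space \<Rightarrow> 'b::euclidean_space"
  assumes "open \<Omega>" "continuous_on UNIV f" "compact K" "\<And>x. x \<notin> K \<Longrightarrow> f x = 0"
  shows "f \<in> L2 \<Omega>"
proof -
  have "integrable (lebesgue_on \<Omega>) (\<lambda>x. (norm (f x))\<^sup>2)"
    by (rule integrable_lebesgue_on_continuous[OF assms(1) _ assms(3)])
       (simp_all add: continuous_on_power continuous_on_norm assms(2,4))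
  then show ?thesis
    unfolding L2_def using measurable_lebesgue_on_continuous[OF assms(2)] by blast
qed

lemma L2_test_function:
  assumes "open \<Omega>" "test_function \<Omega> \<phi>"
  shows "\<phi> \<in> L2 \<Omega>" "grad \<phi> \<in> L2 \<Omega>"
proof -
  obtain K where K: "smooth \<phi>" "compact K" "K \<subseteq> \<Omega>" "\<And>x. x \<notin> K \<Longrightarrow> \<phi> x = 0"
    using test_functionE[OF assms(2)] by blast
  show "\<phi> \<in> L2 \<Omega>"
    by (rule L2_continuous[OF assms(1) smooth_continuous_on[OF K(1)] K(2,4)])
  show "grad \<phi> \<in> L2 \<Omega>"
    by (rule L2_continuous[OF assms(1) continuous_grad[OF K(1)] K(2)])
       (rule grad_outside[OF compact_imp_closed[OF K(2)] K(4)])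
qed

lemma has_weak_gradient_test_function:
  assumes "open \<Omega>" "test_function \<Omega> \<phi>"
  shows "has_weak_gradient \<Omega> \<phi> (grad \<phi>)"
  unfolding has_weak_gradient_def
proof (intro allI impI)
  fix \<psi> assume \<psi>: "test_function \<Omega> \<psi>"
  obtain K where K: "smooth \<phi>" "compact K" "K \<subseteq> \<Omega>" "\<And>x. x \<notin> K \<Longrightarrow> \<phi> x = 0"
    using test_functionE[OF assms(2)] by blast
  obtain L where L: "smooth \<psi>" "compact L" "L \<subseteq> \<Omega>" "\<And>x. x \<notin> L \<Longrightarrow> \<psi> x = 0"
    using test_functionE[OF \<psi>] by blast
  have c: "continuous_on UNIV (\<lambda>x. \<phi> x *\<^sub>R grad \<psi> x)" "continuous_on UNIV (\<lambda>x. \<psi> x *\<^sub>R grad \<phi> x)"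
    by (intro continuous_intros smooth_continuous_on continuous_grad K L)+
  have i: "integrable lborel (\<lambda>x. \<phi> x *\<^sub>R grad \<psi> x)" "integrable lborel (\<lambda>x. \<psi> x *\<^sub>R grad \<phi> x)"
    by (rule integrable_compact_support[OF c(1) K(2)] integrable_compact_support[OF c(2) L(2)]; simp add: K(4) L(4))+
  have "(LINT x|lborel. \<phi> x *\<^sub>R grad \<psi> x) = - (LINT x|lborel. \<psi> x *\<^sub>R grad \<phi> x)"
  proof (rule euclidean_eqI)
    fix b :: 'a assume "b \<in> Basis"
    have "(LINT x|lborel. \<phi> x *\<^sub>R grad \<psi> x) \<bullet> b = (LINT x|lborel. \<phi> x * frechet_derivative \<psi> (at x) b)"
      using i by (simp flip: integral_inner_left grad_inner_smooth[OF L(1)])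
    also have "\<dots> = - (LINT x|lborel. \<psi> x * frechet_derivative \<phi> (at x) b)"
      by (rule integral_by_parts_smooth[OF L(1) K(1) L(2,4)])
    also have "\<dots> = - (LINT x|lborel. \<psi> x *\<^sub>R grad \<phi> x) \<bullet> b"
      using i by (simp flip: integral_inner_left grad_inner_smooth[OF K(1)])
    finally show "(LINT x|lborel. \<phi> x *\<^sub>R grad \<psi> x) \<bullet> b = - (LINT x|lborel. \<psi> x *\<^sub>R grad \<phi> x) \<bullet> b" .
  qed
  moreover have "(LINT x|lebesgue_on \<Omega>. \<phi> x *\<^sub>R grad \<psi> x) = (LINT x|lborel. \<phi> x *\<^sub>R grad \<psi> x)"
    by (rule integral_lebesgue_on_support[OF assms(1) c(1)]) (use K in auto)
  moreover have "(LINT x|lebesgue_on \<Omega>. \<psi> x *\<^sub>R grad \<phi> x) = (LINT x|lborel. \<psi> x *\<^sub>R grad \<phi> x)"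
    by (rule integral_lebesgue_on_support[OF assms(1) c(2)]) (use L in auto)
  ultimately show "(LINT x|lebesgue_on \<Omega>. \<phi> x *\<^sub>R grad \<psi> x) = - (LINT x|lebesgue_on \<Omega>. \<psi> x *\<^sub>R grad \<phi> x)"
    by simp
qed

section \<open>Uniqueness of weak gradients\<close>

text \<open>A product of one-dimensional bumps, positive exactly on the open box. The parameter
  \<open>e\<close> is kept free because the bumps increase to the indicator of the box as
  \<open>e\<close> tends to 0.\<close>

definition box_bump :: "real \<Rightarrow> 'a::euclidean_space \<Rightarrow> 'a \<Rightarrow> 'a \<Rightarrow> real" where
  "box_bump e a b x = (\<Prod>i\<in>Basis. flat e 0 1 ((x \<bullet> i - a \<bullet> i) * (b \<bullet> i - x \<bullet> i)))"

lemma flat_0_1: "flat e 0 1 t = (if t > 0 then exp (- e / t) else 0)"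
  by (simp add: flat_def)

lemma smooth_box_bump: "e > 0 \<Longrightarrow> smooth (box_bump e a b)"
  unfolding box_bump_def
  by (intro smooth_prod smooth_flat_compose smooth_mult smooth_diff smooth_inner smooth_const)

lemma box_bump_outside:
  assumes "\<And>i. i \<in> Basis \<Longrightarrow> a \<bullet> i < b \<bullet> i" "x \<notin> box a b"
  shows "box_bump e a b x = 0"
proof -
  obtain i where i: "i \<in> Basis" "x \<bullet> i \<le> a \<bullet> i \<or> b \<bullet> i \<le> x \<bullet> i"
    using assms(2) by (force simp: mem_box)
  then have "(x \<bullet> i - a \<bullet> i) * (b \<bullet> i - x \<bullet> i) \<le> 0"
    using assms(1)[OF i(1)] by (auto simp: mult_le_0_iff)
  then show ?thesis
    using i(1) by (auto simp: box_bump_def prod_zero_iff flat_0_1 intro!: bexI[of _ i])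
qed

lemma box_bump_bounds:
  assumes "e > 0"
  shows "0 \<le> box_bump e a b x" "box_bump e a b x \<le> 1"
  using assms unfolding box_bump_def by (auto intro!: prod_nonneg prod_le_1 simp: flat_0_1)

lemma test_function_box_bump:
  assumes "\<And>i. i \<in> Basis \<Longrightarrow> a \<bullet> i < b \<bullet> i" "cbox a b \<subseteq> \<Omega>" "e > 0"
  shows "test_function \<Omega> (box_bump e a b)"
proof (rule test_functionI[OF smooth_box_bump[OF assms(3)] compact_cbox assms(2)])
  show "x \<notin> cbox a b \<Longrightarrow> box_bump e a b x = 0" for x
    using box_bump_outside[OF assms(1), of x e] box_subset_cbox[of a b] by auto
qed

lemma box_bump_tendsto:
  assumes "x \<in> box a b"
  shows "(\<lambda>n. box_bump (inverse (real (Suc n))) a b x) \<longlonglongrightarrow> 1"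
proof -
  have "(\<lambda>n. \<Prod>i\<in>Basis. exp (- inverse (real (Suc n)) / ((x \<bullet> i - a \<bullet> i) * (b \<bullet> i - x \<bullet> i)))) \<longlonglongrightarrow> (\<Prod>i\<in>(Basis::'a set). exp (- 0 / ((x \<bullet> i - a \<bullet> i) * (b \<bullet> i - x \<bullet> i))))"
    using assms by (intro tendsto_intros LIMSEQ_inverse_real_of_nat) (auto simp: mem_box)
  also have "(\<lambda>n. \<Prod>i\<in>Basis. exp (- inverse (real (Suc n)) / ((x \<bullet> i - a \<bullet> i) * (b \<bullet> i - x \<bullet> i)))) = (\<lambda>n. box_bump (inverse (real (Suc n))) a b x)"
    using assms by (auto simp: box_bump_def flat_0_1 mem_box intro!: prod.cong ext)
  finally show ?thesis by simp
qed

text \<open>The bumps lie between 0 and 1 and converge pointwise to the indicator of the open box,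
  so the hypothesis on test functions passes to the limit under the majorant
  \<open>norm (g x)\<close>.\<close>

lemma integral_box_eq_0:
  fixes g :: "'a::euclidean_space \<Rightarrow> real"
  assumes "open \<Omega>" "integrable (lebesgue_on \<Omega>) g"
    and "\<And>\<phi>. test_function \<Omega> \<phi> \<Longrightarrow> (LINT x|lebesgue_on \<Omega>. \<phi> x * g x) = 0"
    and "cbox a b \<subseteq> \<Omega>"
  shows "(LINT x|lebesgue_on \<Omega>. indicator (box a b) x * g x) = 0"
proof (cases "\<forall>i\<in>Basis. a \<bullet> i < b \<bullet> i")
  case False
  then have "box a b = {}" by (force simp: box_eq_empty)
  then show ?thesis by simp
next
  case True
  define e where "e n = inverse (real (Suc n))" for n
  have e: "e n > 0" for n by (simp add: e_def)
  have m: "g \<in> borel_measurable (lebesgue_on \<Omega>)" using assms(2) by auto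
  have "(\<lambda>n. LINT x|lebesgue_on \<Omega>. box_bump (e n) a b x * g x) \<longlonglongrightarrow> (LINT x|lebesgue_on \<Omega>. indicator (box a b) x * g x)"
  proof (rule integral_dominated_convergence[where w="\<lambda>x. norm (g x)"])
    have "indicator (box a b) \<in> borel_measurable (lebesgue_on \<Omega>)"
      by (intro measurable_restrict_space1 borel_measurable_indicator) simp
    then show "(\<lambda>x. indicator (box a b) x * g x) \<in> borel_measurable (lebesgue_on \<Omega>)"
      using m by (rule borel_measurable_times)
    show "(\<lambda>x. box_bump (e n) a b x * g x) \<in> borel_measurable (lebesgue_on \<Omega>)" for n
      by (intro borel_measurable_times m measurable_lebesgue_on_continuous smooth_continuous_on smooth_box_bump e)
    have "(\<lambda>n. box_bump (e n) a b x) \<longlonglongrightarrow> indicator (box a b) x" for x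
      using box_bump_tendsto[of x a b] box_bump_outside[of a b x] True
      by (cases "x \<in> box a b") (auto simp: e_def)
    then show "AE x in lebesgue_on \<Omega>. (\<lambda>n. box_bump (e n) a b x * g x) \<longlonglongrightarrow> indicator (box a b) x * g x"
      by (auto intro!: tendsto_mult)
    show "AE x in lebesgue_on \<Omega>. norm (box_bump (e n) a b x * g x) \<le> norm (g x)" for n
      using box_bump_bounds[OF e, of n a b] by (auto simp: abs_mult intro!: mult_left_le_one_le)
  qed (use assms(2) in auto)
  moreover have "(LINT x|lebesgue_on \<Omega>. box_bump (e n) a b x * g x) = 0" for n
    using True assms(3,4) e test_function_box_bump by blast
  ultimately show ?thesis by (simp add: LIMSEQ_unique)
qed

text \<open>Open boxes are an intersection-stable generator of the Borel sets, so vanishing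
  integrals spread from boxes to all Borel sets, and then \<open>f\<close> and 0 are densities of
  the same measure. Because \<open>f\<close> vanishes off \<open>box u v\<close>, an arbitrary box
  may first be clipped to it.\<close>

lemma AE_eq_0_of_integral_boxes:
  fixes f :: "'a::euclidean_space \<Rightarrow> real"
  assumes f: "integrable lborel f" and Q: "\<And>x. x \<notin> box u v \<Longrightarrow> f x = 0"
    and 0: "\<And>a b. cbox a b \<subseteq> cbox u v \<Longrightarrow> (LINT x:box a b|lborel. f x) = 0"
  shows "AE x in lborel. f x = 0"
proof -
  have m[measurable]: "f \<in> borel_measurable borel" using f by auto
  have si: "set_integrable lborel A f" if "A \<in> sets borel" for A
    unfolding set_integrable_def using f that integrable_mult_indicator[of A lborel f] by simp
  have tot: "(LINT x|lborel. f x) = 0"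
  proof -
    have "(LINT x:box u v|lborel. f x) = (LINT x|lborel. f x)"
      unfolding set_lebesgue_integral_def by (intro Bochner_Integration.integral_cong) (auto simp: indicator_def Q)
    then show ?thesis using 0[of u v] by simp
  qed
  have "(LINT x:A|lborel. f x) = 0" if "A \<in> sets borel" for A
  proof -
    have "Int_stable (range (\<lambda>(a, b). box a b :: 'a set))"
      by (auto simp: Int_stable_def box_Int_box)
    moreover have "range (\<lambda>(a, b). box a b :: 'a set) \<subseteq> Pow UNIV" by auto
    moreover have "A \<in> sigma_sets UNIV (range (\<lambda>(a, b). box a b))"
      using that unfolding borel_eq_box by simp
    ultimately show ?thesis
    proof (induction rule: sigma_sets_induct_disjoint)
      case (basic B)
      then obtain a b where B: "B = box a b" by auto
      define a' where "a' = (\<Sum>i\<in>Basis. max (a \<bullet> i) (u \<bullet> i) *\<^sub>R i)"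
      define b' where "b' = (\<Sum>i\<in>Basis. min (b \<bullet> i) (v \<bullet> i) *\<^sub>R i)"
      have B': "box a b \<inter> box u v = box a' b'" unfolding a'_def b'_def by (rule box_Int_box)
      have "(LINT x:B|lborel. f x) = (LINT x:box a' b'|lborel. f x)"
        unfolding set_lebesgue_integral_def B B'[symmetric]
        by (intro Bochner_Integration.integral_cong) (auto simp: indicator_def Q)
      moreover have "cbox a' b' \<subseteq> cbox u v"
        by (auto simp: mem_box a'_def b'_def)
      ultimately show ?case using 0 by simp
    next
      case empty
      then show ?case by (simp add: set_lebesgue_integral_def)
    next
      case (compl B)
      then have B: "B \<in> sets borel" unfolding borel_eq_box by simp
      have "(LINT x:B \<union> (UNIV - B)|lborel. f x) = (LINT x:B|lborel. f x) + (LINT x:UNIV - B|lborel. f x)"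
        by (rule set_integral_Un) (use si B in auto)
      moreover have "(LINT x:B \<union> (UNIV - B)|lborel. f x) = 0"
        using tot by (simp add: set_lebesgue_integral_def)
      ultimately show ?case using compl by simp
    next
      case (union B)
      then have B: "B i \<in> sets borel" for i unfolding borel_eq_box by auto
      have "(LINT x:(\<Union>i. B i)|lborel. f x) = (\<Sum>i. (LINT x:(B i)|lborel. f x))"
        by (rule lebesgue_integral_countable_add) (use B union si in \<open>auto simp: disjoint_family_on_def\<close>)
      then show ?case using union by simp
    qed
  qed
  then show ?thesis
    by (intro density_unique_real[OF f, of "\<lambda>x. 0"]) auto
qed

text \<open>The fundamental lemma of the calculus of variations, proved on each closed box inside
  \<open>\<Omega>\<close> and then glued along a countable cover by such boxes.\<close>

lemma AE_eq_0_of_test_functions_real: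
  fixes g :: "'a::euclidean_space \<Rightarrow> real"
  assumes \<Omega>: "open \<Omega>" and g: "integrable (lebesgue_on \<Omega>) g"
    and 0: "\<And>\<phi>. test_function \<Omega> \<phi> \<Longrightarrow> (LINT x|lebesgue_on \<Omega>. \<phi> x * g x) = 0"
  shows "AE x in lebesgue_on \<Omega>. g x = 0"
proof -
  have *: "AE x in lebesgue. x \<in> cbox u v \<longrightarrow> g x = 0" if uv: "cbox u v \<subseteq> \<Omega>" for u v
  proof -
    define f where "f x = indicator (box u v) x * g x" for x
    have bO: "box u v \<inter> \<Omega> = box u v" using uv box_subset_cbox by blast
    have "integrable (lebesgue_on \<Omega>) f"
      unfolding f_def using integrable_mult_indicator[of "box u v" "lebesgue_on \<Omega>" g] g bO \<Omega>
      by (auto simp: sets_restrict_space_iff)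
    then have fi: "integrable lebesgue f"
      using bO \<Omega> by (subst (asm) integrable_restrict_space)
         (auto simp: f_def[abs_def] mult.assoc[symmetric] Int_commute simp flip: indicator_inter_arith)
    \<comment> \<open>The argument with boxes needs a Borel function, so \<open>f\<close> is
      replaced by a Borel representative, cut off again outside the box.\<close>
    obtain f' where f': "f' \<in> borel_measurable lborel" "AE x in lborel. f x = f' x"
      using completion_ex_borel_measurable_real[of f lborel] fi by auto
    define h where "h x = indicator (box u v) x * f' x" for x
    have fh: "AE x in lborel. f x = h x"
      using f'(2) by eventually_elim (auto simp: h_def f_def indicator_def)
    have hm: "h \<in> borel_measurable lborel" unfolding h_def using f' by auto
    have fh': "AE x in lebesgue. f x = h x" using fh by (rule AE_completion)
    have "integrable lebesgue h"
      using fi fh' hm by (subst integrable_cong_AE[of _ _ f]) (auto simp: measurable_completion)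
    then have hi: "integrable lborel h" using integrable_completion[of h lborel] hm by auto
    have "AE x in lborel. h x = 0"
    proof (rule AE_eq_0_of_integral_boxes[OF hi])
      show "x \<notin> box u v \<Longrightarrow> h x = 0" for x by (simp add: h_def)
      fix a b assume ab: "cbox a b \<subseteq> cbox u v"
      have "(LINT x:box a b|lborel. h x) = (LINT x|lebesgue. indicator (box a b) x *\<^sub>R h x)"
        unfolding set_lebesgue_integral_def using hm by (intro integral_completion[symmetric]) auto
      also have "\<dots> = (LINT x|lebesgue. indicator (box a b) x *\<^sub>R f x)"
        using fh' by (intro integral_cong_AE) (use hm fi in \<open>auto simp: measurable_completion intro!: borel_measurable_times\<close>)
      also have "\<dots> = (LINT x|lebesgue. indicator \<Omega> x *\<^sub>R (indicator (box a b) x * g x))"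
      proof (intro Bochner_Integration.integral_cong refl)
        fix x
        have "box a b \<subseteq> box u v"
          using ab by (metis interior_cbox interior_mono)
        then show "indicator (box a b) x *\<^sub>R f x = indicator \<Omega> x *\<^sub>R (indicator (box a b) x * g x)"
          using bO by (auto simp: f_def indicator_def)
      qed
      also have "\<dots> = (LINT x|lebesgue_on \<Omega>. indicator (box a b) x * g x)"
        by (rule integral_restrict_space[symmetric]) (use \<Omega> in auto)
      also have "\<dots> = 0"
        by (rule integral_box_eq_0[OF \<Omega> g 0]) (use ab uv in auto)
      finally show "(LINT x:box a b|lborel. h x) = 0" .
    qed
    then have "AE x in lebesgue. h x = 0" by (rule AE_completion)
    \<comment> \<open>So far only the open box is covered; the frontier of the closed one is a null
      set.\<close>
    moreover have "AE x in lebesgue. x \<notin> cbox u v - box u v"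
      using negligible_frontier_interval[of u v] by (intro AE_not_in) (simp add: negligible_iff_null_sets)
    ultimately show ?thesis using fh'
      by eventually_elim (auto simp: f_def indicator_def split: if_splits)
  qed
  obtain D where D: "countable D" "\<And>X. X \<in> D \<Longrightarrow> \<exists>a b. X = cbox a b" "\<Union>D = \<Omega>"
    using open_countable_Union_open_cbox[OF \<Omega>] by metis
  have "AE x in lebesgue. \<forall>X\<in>D. x \<in> X \<longrightarrow> g x = 0"
    unfolding AE_ball_countable[OF D(1)] using * D by (metis Union_upper)
  then have "AE x in lebesgue. x \<in> \<Omega> \<longrightarrow> g x = 0"
    by eventually_elim (use D(3) in auto)
  then show ?thesis
    using \<Omega> by (subst AE_restrict_space_iff) auto
qed

lemma AE_eq_0_of_test_functions:
  fixes g :: "'a::euclidean_space \<Rightarrow> 'b::euclidean_space"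
  assumes \<Omega>: "open \<Omega>" and g: "integrable (lebesgue_on \<Omega>) g"
    and 0: "\<And>\<phi>. test_function \<Omega> \<phi> \<Longrightarrow> (LINT x|lebesgue_on \<Omega>. \<phi> x *\<^sub>R g x) = 0"
  shows "AE x in lebesgue_on \<Omega>. g x = 0"
proof -
  have "AE x in lebesgue_on \<Omega>. g x \<bullet> b = 0" if "b \<in> Basis" for b
  proof (rule AE_eq_0_of_test_functions_real[OF \<Omega>])
    show "integrable (lebesgue_on \<Omega>) (\<lambda>x. g x \<bullet> b)" using g by simp
    fix \<phi> assume \<phi>: "test_function \<Omega> \<phi>"
    obtain K where K: "smooth \<phi>" "compact K" "K \<subseteq> \<Omega>" "\<And>x. x \<notin> K \<Longrightarrow> \<phi> x = 0"
      using test_functionE[OF \<phi>] by blast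
    obtain B where B: "\<And>x. \<bar>\<phi> x\<bar> \<le> B" "B > 0"
      using bounded_compact_support[OF smooth_continuous_on[OF K(1)] K(2,4)] by blast
    have m: "\<phi> \<in> borel_measurable (lebesgue_on \<Omega>)"
      by (rule measurable_lebesgue_on_continuous[OF smooth_continuous_on[OF K(1)]])
    have "integrable (lebesgue_on \<Omega>) (\<lambda>x. \<phi> x *\<^sub>R g x)"
    proof (rule Bochner_Integration.integrable_bound)
      show "integrable (lebesgue_on \<Omega>) (\<lambda>x. B * norm (g x))" using g by simp
      show "AE x in lebesgue_on \<Omega>. norm (\<phi> x *\<^sub>R g x) \<le> norm (B * norm (g x))"
        using B by (intro AE_I2) (auto simp: abs_mult intro!: mult_right_mono)
    qed (use m g in auto)
    then have "(LINT x|lebesgue_on \<Omega>. (\<phi> x *\<^sub>R g x) \<bullet> b) = 0"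
      using 0[OF \<phi>] by (subst integral_inner_left) auto
    then show "(LINT x|lebesgue_on \<Omega>. \<phi> x * (g x \<bullet> b)) = 0" by simp
  qed
  then have "AE x in lebesgue_on \<Omega>. \<forall>b\<in>Basis. g x \<bullet> b = 0"
    by (subst AE_ball_countable) (auto intro: countable_finite)
  then show ?thesis
    by eventually_elim (auto intro: euclidean_eqI)
qed

section \<open>Square integrable functions\<close>

definition sq_int :: "'a measure \<Rightarrow> ('a \<Rightarrow> 'b::euclidean_space) \<Rightarrow> bool" where
  "sq_int M f \<longleftrightarrow> f \<in> borel_measurable M \<and> integrable M (\<lambda>x. (norm (f x))\<^sup>2)"

text \<open>Kept squared, so that Rayleigh quotients and expansions of \<open>w - m\<close> need no
  square roots.\<close>

definition sqnorm :: "'a measure \<Rightarrow> ('a \<Rightarrow> 'b::euclidean_space) \<Rightarrow> real" where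
  "sqnorm M f = (LINT x|M. (norm (f x))\<^sup>2)"

lemma L2_iff: "f \<in> L2 \<Omega> \<longleftrightarrow> sq_int (lebesgue_on \<Omega>) f"
  by (simp add: L2_def sq_int_def)

lemma sq_int_measurable: "sq_int M f \<Longrightarrow> f \<in> borel_measurable M"
  and sq_int_integrable: "sq_int M f \<Longrightarrow> integrable M (\<lambda>x. (norm (f x))\<^sup>2)"
  by (simp_all add: sq_int_def)

lemma sqnorm_nonneg: "sqnorm M f \<ge> 0"
  by (simp add: sqnorm_def)

lemma sq_int_scaleR: "sq_int M f \<Longrightarrow> sq_int M (\<lambda>x. c *\<^sub>R f x)"
  by (auto simp add: sq_int_def power_mult_distrib)

lemma sq_int_add:
  assumes f: "sq_int M f" and g: "sq_int M g"
  shows "sq_int M (\<lambda>x. f x + g x)"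
  unfolding sq_int_def
proof
  show m: "(\<lambda>x. f x + g x) \<in> borel_measurable M"
    using f g by (auto simp add: sq_int_def)
  show "integrable M (\<lambda>x. (norm (f x + g x))\<^sup>2)"
  proof (rule Bochner_Integration.integrable_bound)
    show "integrable M (\<lambda>x. 2 * (norm (f x))\<^sup>2 + 2 * (norm (g x))\<^sup>2)"
      using f g by (simp add: sq_int_def)
    have "(norm (f x + g x))\<^sup>2 \<le> 2 * (norm (f x))\<^sup>2 + 2 * (norm (g x))\<^sup>2" for x
    proof -
      have "(norm (f x + g x))\<^sup>2 \<le> (norm (f x) + norm (g x))\<^sup>2"
        by (intro power_mono norm_triangle_ineq) auto
      also have "\<dots> \<le> 2 * (norm (f x))\<^sup>2 + 2 * (norm (g x))\<^sup>2"
        using sum_squares_bound[of "norm (f x)" "norm (g x)"] by (simp add: power2_sum)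
      finally show ?thesis .
    qed
    then show "AE x in M. norm ((norm (f x + g x))\<^sup>2) \<le> norm (2 * (norm (f x))\<^sup>2 + 2 * (norm (g x))\<^sup>2)"
      by (intro AE_I2) (auto simp: abs_of_nonneg add_nonneg_nonneg)
  qed (use m in simp)
qed

lemma sq_int_diff: "sq_int M f \<Longrightarrow> sq_int M g \<Longrightarrow> sq_int M (\<lambda>x. f x - g x)"
  using sq_int_add[of M f "\<lambda>x. (-1) *\<^sub>R g x"] sq_int_scaleR[of M g "-1"] by simp

lemma integrable_inner_sq_int:
  assumes f: "sq_int M f" and g: "sq_int M g"
  shows "integrable M (\<lambda>x. f x \<bullet> g x)"
proof (rule Bochner_Integration.integrable_bound)
  show "integrable M (\<lambda>x. (norm (f x))\<^sup>2 + (norm (g x))\<^sup>2)"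
    using f g by (simp add: sq_int_def)
  show "(\<lambda>x. f x \<bullet> g x) \<in> borel_measurable M"
    using f g by (auto simp: sq_int_def)
  have "\<bar>f x \<bullet> g x\<bar> \<le> (norm (f x))\<^sup>2 + (norm (g x))\<^sup>2" for x
  proof -
    have "\<bar>f x \<bullet> g x\<bar> \<le> norm (f x) * norm (g x)" by (rule Cauchy_Schwarz_ineq2)
    also have "2 * (norm (f x) * norm (g x)) \<le> (norm (f x))\<^sup>2 + (norm (g x))\<^sup>2"
      using sum_squares_bound[of "norm (f x)" "norm (g x)"] by simp
    moreover have "norm (f x) * norm (g x) \<ge> 0" by simp
    ultimately show ?thesis by linarith
  qed
  then show "AE x in M. norm (f x \<bullet> g x) \<le> norm ((norm (f x))\<^sup>2 + (norm (g x))\<^sup>2)"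
    by (intro AE_I2) (auto simp: abs_of_nonneg add_nonneg_nonneg)
qed

lemma sqnorm_eq_inner: "sqnorm M f = (LINT x|M. f x \<bullet> f x)"
  by (simp add: sqnorm_def power2_norm_eq_inner)

lemma sqnorm_expand:
  assumes f: "sq_int M f" and g: "sq_int M g"
  shows "sqnorm M (\<lambda>x. f x + t *\<^sub>R g x) = sqnorm M f + 2 * t * (LINT x|M. f x \<bullet> g x) + t\<^sup>2 * sqnorm M g"
proof -
  have "(f x + t *\<^sub>R g x) \<bullet> (f x + t *\<^sub>R g x) = (f x \<bullet> f x + (2 * t) * (f x \<bullet> g x)) + t\<^sup>2 * (g x \<bullet> g x)" for x
    by (simp add: inner_add_left inner_add_right inner_commute power2_eq_square algebra_simps)
  then show ?thesis
    unfolding sqnorm_eq_inner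
    using integrable_inner_sq_int[OF f f] integrable_inner_sq_int[OF f g] integrable_inner_sq_int[OF g g]
    by simp
qed

text \<open>Evaluation at the minimiser t = -b/c; if c = 0, an affine function bounded below has
  slope 0. It is used twice: for Cauchy-Schwarz, and to turn near-minimality of an energy into an
  approximate Euler-Lagrange equation.\<close>

lemma nonneg_quadratic_discriminant:
  fixes a b c :: real
  assumes "\<And>t. a + 2 * t * b + t\<^sup>2 * c \<ge> 0" "c \<ge> 0"
  shows "b\<^sup>2 \<le> a * c"
proof (cases "c = 0")
  case True
  have "b = 0"
  proof (rule ccontr)
    assume "b \<noteq> 0"
    then have "a + 2 * (- (a + 1) / (2 * b)) * b = - 1" by (simp add: field_simps)
    then show False using assms(1)[of "- (a + 1) / (2 * b)"] True by simp
  qed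
  then show ?thesis using True by simp
next
  case False
  then have c: "c > 0" using assms(2) by simp
  have "a + 2 * (- b / c) * b + (- b / c)\<^sup>2 * c = (a * c - b\<^sup>2) / c"
    using c by (simp add: field_simps power2_eq_square)
  then have "(a * c - b\<^sup>2) / c \<ge> 0" using assms(1)[of "- b / c"] by simp
  then show ?thesis using c by (simp add: zero_le_divide_iff)
qed

lemma Cauchy_Schwarz_sq_int:
  assumes f: "sq_int M f" and g: "sq_int M g"
  shows "(LINT x|M. f x \<bullet> g x)\<^sup>2 \<le> sqnorm M f * sqnorm M g"
  by (rule nonneg_quadratic_discriminant) (use sqnorm_expand[OF f g] sqnorm_nonneg in \<open>metis, simp add: sqnorm_nonneg\<close>)

lemma Cauchy_Schwarz_sq_int_abs:
  assumes f: "sq_int M f" and g: "sq_int M g"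
  shows "\<bar>LINT x|M. f x \<bullet> g x\<bar> \<le> sqrt (sqnorm M f) * sqrt (sqnorm M g)"
  using real_sqrt_le_mono[OF Cauchy_Schwarz_sq_int[OF f g]] by (simp add: real_sqrt_mult)

text \<open>The difference of the two integrals expands into three inner products, each with at
  least one factor tending to 0 in L2, and Cauchy-Schwarz bounds every one of them.\<close>

lemma tendsto_integral_inner:
  assumes f: "\<And>n. sq_int M (f n)" "sq_int M f'" "(\<lambda>n. sqnorm M (\<lambda>x. f n x - f' x)) \<longlonglongrightarrow> 0"
    and g: "\<And>n. sq_int M (g n)" "sq_int M g'" "(\<lambda>n. sqnorm M (\<lambda>x. g n x - g' x)) \<longlonglongrightarrow> 0"
  shows "(\<lambda>n. LINT x|M. f n x \<bullet> g n x) \<longlonglongrightarrow> (LINT x|M. f' x \<bullet> g' x)"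
proof -
  let ?F = "\<lambda>n x. f n x - f' x" and ?G = "\<lambda>n x. g n x - g' x"
  have F: "sq_int M (?F n)" and G: "sq_int M (?G n)" for n
    by (intro sq_int_diff f g)+
  have eq: "(LINT x|M. f n x \<bullet> g n x) - (LINT x|M. f' x \<bullet> g' x)
      = (LINT x|M. ?F n x \<bullet> ?G n x) + (LINT x|M. ?F n x \<bullet> g' x) + (LINT x|M. f' x \<bullet> ?G n x)" for n
  proof -
    have "(LINT x|M. f n x \<bullet> g n x) - (LINT x|M. f' x \<bullet> g' x) = (LINT x|M. f n x \<bullet> g n x - f' x \<bullet> g' x)"
      by (rule Bochner_Integration.integral_diff[symmetric]) (intro integrable_inner_sq_int f g)+
    also have "\<dots> = (LINT x|M. (?F n x \<bullet> ?G n x + ?F n x \<bullet> g' x) + f' x \<bullet> ?G n x)"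
      by (intro Bochner_Integration.integral_cong refl) (simp add: inner_diff_left inner_diff_right)
    also have "\<dots> = (LINT x|M. ?F n x \<bullet> ?G n x + ?F n x \<bullet> g' x) + (LINT x|M. f' x \<bullet> ?G n x)"
      by (rule Bochner_Integration.integral_add)
         (intro Bochner_Integration.integrable_add integrable_inner_sq_int F G f g)+
    also have "(LINT x|M. ?F n x \<bullet> ?G n x + ?F n x \<bullet> g' x) = (LINT x|M. ?F n x \<bullet> ?G n x) + (LINT x|M. ?F n x \<bullet> g' x)"
      by (rule Bochner_Integration.integral_add) (intro integrable_inner_sq_int F G f g)+
    finally show ?thesis .
  qed
  let ?B = "\<lambda>n. sqrt (sqnorm M (?F n)) * sqrt (sqnorm M (?G n)) + sqrt (sqnorm M (?F n)) * sqrt (sqnorm M g') + sqrt (sqnorm M f') * sqrt (sqnorm M (?G n))"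
  have bd: "norm ((LINT x|M. f n x \<bullet> g n x) - (LINT x|M. f' x \<bullet> g' x)) \<le> ?B n" for n
    using Cauchy_Schwarz_sq_int_abs[OF F[of n] G[of n]] Cauchy_Schwarz_sq_int_abs[OF F[of n] g(2)]
      Cauchy_Schwarz_sq_int_abs[OF f(2) G[of n]] eq[of n] unfolding real_norm_def by linarith
  have sf: "(\<lambda>n. sqrt (sqnorm M (?F n))) \<longlonglongrightarrow> 0" and sg: "(\<lambda>n. sqrt (sqnorm M (?G n))) \<longlonglongrightarrow> 0"
    using tendsto_real_sqrt[OF f(3)] tendsto_real_sqrt[OF g(3)] by simp_all
  have "?B \<longlonglongrightarrow> 0 * 0 + 0 * sqrt (sqnorm M g') + sqrt (sqnorm M f') * 0"
    by (rule tendsto_add[OF tendsto_add[OF tendsto_mult[OF sf sg] tendsto_mult_right[OF sf]] tendsto_mult_left[OF sg]])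
  then have "?B \<longlonglongrightarrow> 0" by simp
  then have "(\<lambda>n. (LINT x|M. f n x \<bullet> g n x) - (LINT x|M. f' x \<bullet> g' x)) \<longlonglongrightarrow> 0"
    by (rule Lim_null_comparison[rotated]) (rule always_eventually, use bd in blast)
  then show ?thesis by (rule LIM_zero_cancel)
qed

lemma tendsto_integral_inner_const:
  assumes f: "\<And>n. sq_int M (f n)" "sq_int M f'" "(\<lambda>n. sqnorm M (\<lambda>x. f n x - f' x)) \<longlonglongrightarrow> 0"
    and g: "sq_int M g"
  shows "(\<lambda>n. LINT x|M. f n x \<bullet> g x) \<longlonglongrightarrow> (LINT x|M. f' x \<bullet> g x)"
  by (rule tendsto_integral_inner[OF f g g]) (simp add: sqnorm_def)

lemma tendsto_sqnorm:
  assumes f: "\<And>n. sq_int M (f n)" "sq_int M f'" "(\<lambda>n. sqnorm M (\<lambda>x. f n x - f' x)) \<longlonglongrightarrow> 0"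
  shows "(\<lambda>n. sqnorm M (f n)) \<longlonglongrightarrow> sqnorm M f'"
  unfolding sqnorm_eq_inner by (rule tendsto_integral_inner[OF f f])

lemma sq_int_const: "finite_measure M \<Longrightarrow> sq_int M (\<lambda>x. c)"
  by (simp add: sq_int_def finite_measure.integrable_const)

lemma sq_int_imp_integrable:
  assumes "finite_measure M" "sq_int M f"
  shows "integrable M f"
proof (rule Bochner_Integration.integrable_bound)
  show "integrable M (\<lambda>x. 1 + (norm (f x))\<^sup>2)"
    using assms by (simp add: sq_int_def finite_measure.integrable_const)
  have "norm (f x) \<le> 1 + (norm (f x))\<^sup>2" for x
    using sum_squares_bound[of "norm (f x)" 1] by (simp, smt (verit) norm_ge_zero)
  then show "AE x in M. norm (f x) \<le> norm (1 + (norm (f x))\<^sup>2)"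
    by (intro AE_I2) (auto simp: abs_of_nonneg add_nonneg_nonneg)
qed (use assms in \<open>simp add: sq_int_def\<close>)

lemma integral_norm_le_sqnorm:
  assumes "finite_measure M" "sq_int M f"
  shows "(LINT x|M. norm (f x)) \<le> sqrt (sqnorm M f) * sqrt (measure M (space M))"
proof -
  have "sq_int M (\<lambda>x. norm (f x))" using assms by (auto simp add: sq_int_def)
  from Cauchy_Schwarz_sq_int_abs[OF this sq_int_const[OF assms(1), of 1]]
  show ?thesis by (simp add: sqnorm_def)
qed

text \<open>A subsequence with summable increments converges almost
  everywhere since it does so in \<open>L\<^sup>1\<close>; Fatou's lemma then identifies the limit.\<close>

lemma sq_int_complete:
  fixes f :: "nat \<Rightarrow> 'a \<Rightarrow> 'b::euclidean_space"
  assumes fin: "finite_measure M" and f: "\<And>n. sq_int M (f n)"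
    and cau: "\<And>e. e > 0 \<Longrightarrow> \<exists>N. \<forall>m\<ge>N. \<forall>n\<ge>N. sqnorm M (\<lambda>x. f m x - f n x) < e"
  obtains F where "sq_int M F" "(\<lambda>n. sqnorm M (\<lambda>x. f n x - F x)) \<longlonglongrightarrow> 0"
proof -
  define c where "c = sqrt (measure M (space M))"
  have "\<exists>N. \<forall>m\<ge>N. \<forall>n\<ge>N. sqnorm M (\<lambda>x. f m x - f n x) < ((1/2) ^ k)\<^sup>2" for k :: nat
    by (rule cau) simp
  then obtain N where N: "\<And>k m n. m \<ge> N k \<Longrightarrow> n \<ge> N k \<Longrightarrow> sqnorm M (\<lambda>x. f m x - f n x) < ((1/2) ^ k)\<^sup>2"
    by metis
  \<comment> \<open>The sum puts \<open>r k\<close> and \<open>r (Suc k)\<close> beyond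
    \<open>N k\<close>; the added \<open>k\<close> forces \<open>r k\<close> to infinity, which the
    Fatou step needs.\<close>
  define r where "r k = (\<Sum>i\<le>k. N i) + k" for k
  have rN: "r k \<ge> N k" "r (Suc k) \<ge> N k" "r k \<ge> k" for k
    using member_le_sum[of k "{..k}" N] by (simp_all add: r_def)
  have d: "sq_int M (\<lambda>x. f m x - f n x)" for m n by (intro sq_int_diff f)
  have fm[measurable]: "f n \<in> borel_measurable M" for n using f sq_int_measurable by blast
  define D where "D k x = norm (f (r (Suc k)) x - f (r k) x)" for k x
  have Di: "integrable M (D k)" for k
    unfolding D_def using sq_int_imp_integrable[OF fin d] by (rule integrable_norm)
  have Dle: "(LINT x|M. D k x) \<le> (1/2) ^ k * c" for k
  proof -
    have "sqrt (sqnorm M (\<lambda>x. f (r (Suc k)) x - f (r k) x)) \<le> sqrt (((1/2) ^ k)\<^sup>2)"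
      using N[of k "r (Suc k)" "r k"] rN by (intro real_sqrt_le_mono) (simp add: less_imp_le)
    also have "\<dots> = (1/2) ^ k" by (simp add: real_sqrt_abs)
    finally show ?thesis
      using integral_norm_le_sqnorm[OF fin d, of "r (Suc k)" "r k"] unfolding D_def c_def
      by (meson mult_right_mono order_trans real_sqrt_ge_zero measure_nonneg)
  qed
  have "AE x in M. summable (\<lambda>k. norm (D k x))"
  proof -
    have "(\<integral>\<^sup>+x. (\<Sum>k. ennreal (D k x)) \<partial>M) = (\<Sum>k. \<integral>\<^sup>+x. ennreal (D k x) \<partial>M)"
      by (rule nn_integral_suminf) (use Di in auto)
    also have "\<dots> \<le> (\<Sum>k. ennreal ((1/2) ^ k * c))"
    proof (intro suminf_le summableI)
      fix k
      have "(\<integral>\<^sup>+x. ennreal (D k x) \<partial>M) = ennreal (LINT x|M. D k x)"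
        by (rule nn_integral_eq_integral[OF Di]) (simp add: D_def)
      also have "\<dots> \<le> ennreal ((1/2) ^ k * c)" using Dle by (rule ennreal_leI)
      finally show "(\<integral>\<^sup>+x. ennreal (D k x) \<partial>M) \<le> ennreal ((1/2) ^ k * c)" .
    qed
    also have "\<dots> = ennreal (\<Sum>k. (1/2) ^ k * c)"
      by (rule suminf_ennreal2) (auto simp: c_def intro!: summable_mult2 summable_geometric)
    also have "\<dots> < \<infinity>" by simp
    finally have "AE x in M. (\<Sum>k. ennreal (D k x)) \<noteq> \<infinity>"
      by (intro nn_integral_PInf_AE) (use Di in auto)
    then show ?thesis
    proof eventually_elim
      case (elim x)
      have "summable (\<lambda>k. D k x)"
        by (rule summable_suminf_not_top) (use elim in \<open>auto simp: D_def\<close>)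
      then show ?case by (simp add: D_def)
    qed
  qed
  then have conv: "AE x in M. convergent (\<lambda>k. f (r k) x)"
  proof eventually_elim
    case (elim x)
    have "summable (\<lambda>k. f (r (Suc k)) x - f (r k) x)"
      using elim unfolding D_def by (auto intro: summable_norm_cancel)
    then have "convergent (\<lambda>k. \<Sum>i<k. f (r (Suc i)) x - f (r i) x)"
      by (simp add: summable_iff_convergent)
    then have "convergent (\<lambda>k. f (r k) x - f (r 0) x)"
      by (simp add: sum_lessThan_telescope[of "\<lambda>i. f (r i) x"])
    then show ?case
      using convergent_diff_const_right_iff[of "\<lambda>k. f (r k) x" "f (r 0) x"] by simp
  qed
  define F where "F x = lim (\<lambda>k. f (r k) x)" for x
  have Fm[measurable]: "F \<in> borel_measurable M" unfolding F_def by measurable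
  have lim: "AE x in M. (\<lambda>k. f (r k) x) \<longlonglongrightarrow> F x"
    using conv by eventually_elim (simp add: F_def convergent_LIMSEQ_iff)
  have bound: "(\<integral>\<^sup>+x. ennreal ((norm (f n x - F x))\<^sup>2) \<partial>M) \<le> ennreal e"
    if e: "e > 0" and N: "\<And>m n. m \<ge> N \<Longrightarrow> n \<ge> N \<Longrightarrow> sqnorm M (\<lambda>x. f m x - f n x) < e" and n: "n \<ge> N" for e N n
  proof -
    have "(\<integral>\<^sup>+x. ennreal ((norm (f n x - F x))\<^sup>2) \<partial>M) = (\<integral>\<^sup>+x. liminf (\<lambda>k. ennreal ((norm (f n x - f (r k) x))\<^sup>2)) \<partial>M)"
    proof (rule nn_integral_cong_AE)
      show "AE x in M. ennreal ((norm (f n x - F x))\<^sup>2) = liminf (\<lambda>k. ennreal ((norm (f n x - f (r k) x))\<^sup>2))"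
        using lim
      proof eventually_elim
        case (elim x)
        have "(\<lambda>k. ennreal ((norm (f n x - f (r k) x))\<^sup>2)) \<longlonglongrightarrow> ennreal ((norm (f n x - F x))\<^sup>2)"
          by (intro tendsto_ennrealI tendsto_intros elim)
        then show ?case by (rule lim_imp_Liminf[OF sequentially_bot, symmetric])
      qed
    qed
    also have "\<dots> \<le> liminf (\<lambda>k. \<integral>\<^sup>+x. ennreal ((norm (f n x - f (r k) x))\<^sup>2) \<partial>M)"
      by (rule nn_integral_liminf) measurable
    also have "\<dots> \<le> ennreal e"
    proof (rule Liminf_le)
      have "(\<integral>\<^sup>+x. ennreal ((norm (f n x - f (r k) x))\<^sup>2) \<partial>M) \<le> ennreal e" if "k \<ge> N" for k
      proof -
        have "(\<integral>\<^sup>+x. ennreal ((norm (f n x - f (r k) x))\<^sup>2) \<partial>M) = ennreal (sqnorm M (\<lambda>x. f n x - f (r k) x))"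
          unfolding sqnorm_def by (rule nn_integral_eq_integral) (use sq_int_integrable[OF d] in auto)
        moreover have "r k \<ge> N" using that rN(3)[of k] by linarith
        ultimately show ?thesis using N[OF n, of "r k"] by (simp add: ennreal_leI)
      qed
      then show "eventually (\<lambda>k. (\<integral>\<^sup>+x. ennreal ((norm (f n x - f (r k) x))\<^sup>2) \<partial>M) \<le> ennreal e) sequentially"
        by (auto simp: eventually_sequentially)
    qed simp
    finally show ?thesis .
  qed
  obtain N1 where N1: "\<And>m n. m \<ge> N1 \<Longrightarrow> n \<ge> N1 \<Longrightarrow> sqnorm M (\<lambda>x. f m x - f n x) < 1"
    using cau[of 1] by auto
  have sq: "sq_int M (\<lambda>x. f n x - F x)" if "n \<ge> N1" for n
    unfolding sq_int_def
  proof
    show "integrable M (\<lambda>x. (norm (f n x - F x))\<^sup>2)"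
      using bound[of 1 N1 n] N1 that
      by (intro integrableI_bounded) (auto simp: top.extremum_strict intro: le_less_trans)
  qed simp
  have FL: "sq_int M F"
    using sq_int_diff[OF f sq[of N1], of N1] by simp
  have dF: "sq_int M (\<lambda>x. f n x - F x)" for n by (intro sq_int_diff f FL)
  have "(\<lambda>n. sqnorm M (\<lambda>x. f n x - F x)) \<longlonglongrightarrow> 0"
  proof (rule LIMSEQ_I)
    fix e :: real assume e: "e > 0"
    then obtain N where N: "\<And>m n. m \<ge> N \<Longrightarrow> n \<ge> N \<Longrightarrow> sqnorm M (\<lambda>x. f m x - f n x) < e / 2"
      using cau[of "e/2"] by auto
    have "norm (sqnorm M (\<lambda>x. f n x - F x) - 0) < e" if "n \<ge> N" for n
    proof -
      have "ennreal (sqnorm M (\<lambda>x. f n x - F x)) = (\<integral>\<^sup>+x. ennreal ((norm (f n x - F x))\<^sup>2) \<partial>M)"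
        unfolding sqnorm_def by (rule nn_integral_eq_integral[symmetric]) (use sq_int_integrable[OF dF] in auto)
      also have "\<dots> \<le> ennreal (e/2)" by (rule bound[OF _ N that]) (use e in auto)
      finally show ?thesis using e sqnorm_nonneg[of M "\<lambda>x. f n x - F x"] by (simp add: ennreal_le_iff)
    qed
    then show "\<exists>N. \<forall>n\<ge>N. norm (sqnorm M (\<lambda>x. f n x - F x) - 0) < e" by blast
  qed
  with FL show ?thesis by (rule that)
qed

section \<open>Existence of the torsion function\<close>

lemma integrable_scaleR_sq_int:
  fixes u :: "'a \<Rightarrow> real"
  assumes u: "sq_int M u" and G: "sq_int M G"
  shows "integrable M (\<lambda>x. u x *\<^sub>R G x)"
proof (rule Bochner_Integration.integrable_bound)
  show "integrable M (\<lambda>x. (norm (u x))\<^sup>2 + (norm (G x))\<^sup>2)"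
    using u G unfolding sq_int_def by (intro Bochner_Integration.integrable_add) auto
  show "(\<lambda>x. u x *\<^sub>R G x) \<in> borel_measurable M"
    using u G unfolding sq_int_def by (intro borel_measurable_scaleR) auto
  have "norm (u x *\<^sub>R G x) \<le> (norm (u x))\<^sup>2 + (norm (G x))\<^sup>2" for x
  proof -
    have "2 * (norm (u x) * norm (G x)) \<le> (norm (u x))\<^sup>2 + (norm (G x))\<^sup>2"
      using sum_squares_bound[of "norm (u x)" "norm (G x)"] by simp
    moreover have "norm (u x) * norm (G x) \<ge> 0" by simp
    moreover have "norm (u x *\<^sub>R G x) = norm (u x) * norm (G x)" by simp
    ultimately show ?thesis by linarith
  qed
  then show "AE x in M. norm (u x *\<^sub>R G x) \<le> norm ((norm (u x))\<^sup>2 + (norm (G x))\<^sup>2)"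
    by (intro AE_I2) (simp add: abs_of_nonneg add_nonneg_nonneg)
qed

text \<open>Makes the \<open>SOME\<close> in \<open>weak_grad\<close> harmless: two candidates
  differ by a function whose integral against every test function is 0.\<close>

lemma has_weak_gradient_unique:
  assumes \<Omega>: "open \<Omega>" and fin: "finite_measure (lebesgue_on \<Omega>)"
    and g: "g \<in> L2 \<Omega>" "has_weak_gradient \<Omega> u g" and h: "h \<in> L2 \<Omega>" "has_weak_gradient \<Omega> u h"
  shows "AE x in lebesgue_on \<Omega>. g x = h x"
proof -
  let ?M = "lebesgue_on \<Omega>"
  have gh: "sq_int ?M g" "sq_int ?M h" using g h by (simp_all add: L2_iff)
  have "AE x in ?M. g x - h x = 0"
  proof (rule AE_eq_0_of_test_functions[OF \<Omega>])
    show "integrable ?M (\<lambda>x. g x - h x)"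
      by (intro sq_int_imp_integrable[OF fin] sq_int_diff gh)
    fix \<phi> assume \<phi>: "test_function \<Omega> \<phi>"
    then have s: "sq_int ?M \<phi>" using L2_test_function[OF \<Omega>] by (simp add: L2_iff)
    have "(LINT x|?M. \<phi> x *\<^sub>R (g x - h x)) = (LINT x|?M. \<phi> x *\<^sub>R g x) - (LINT x|?M. \<phi> x *\<^sub>R h x)"
      unfolding scaleR_diff_right
      by (rule Bochner_Integration.integral_diff) (intro integrable_scaleR_sq_int s gh)+
    also have "\<dots> = 0"
      using g(2) h(2) \<phi> unfolding has_weak_gradient_def by (metis diff_self neg_equal_iff_equal)
    finally show "(LINT x|?M. \<phi> x *\<^sub>R (g x - h x)) = 0" .
  qed
  then show ?thesis by simp
qed

text \<open>For each basis vector \<open>b\<close>, integration by parts for \<open>\<phi> n\<close>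
  compares two L2 inner products with the fixed functions \<open>grad \<psi> x \<bullet> b\<close>
  and \<open>\<psi> x *\<^sub>R b\<close>, hence it survives L2 limits.\<close>

lemma has_weak_gradient_limit:
  assumes \<Omega>: "open \<Omega>" and \<phi>: "\<And>n. test_function \<Omega> (\<phi> n)"
    and u: "u \<in> L2 \<Omega>" "G \<in> L2 \<Omega>"
    and lim: "(\<lambda>n. sqnorm (lebesgue_on \<Omega>) (\<lambda>x. \<phi> n x - u x)) \<longlonglongrightarrow> 0"
      "(\<lambda>n. sqnorm (lebesgue_on \<Omega>) (\<lambda>x. grad (\<phi> n) x - G x)) \<longlonglongrightarrow> 0"
  shows "has_weak_gradient \<Omega> u G"
  unfolding has_weak_gradient_def
proof (intro allI impI)
  fix \<psi> assume \<psi>: "test_function \<Omega> \<psi>"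
  let ?M = "lebesgue_on \<Omega>"
  have s: "sq_int ?M (\<phi> n)" "sq_int ?M (grad (\<phi> n))" "sq_int ?M \<psi>" "sq_int ?M (grad \<psi>)" for n
    using L2_test_function[OF \<Omega>] \<phi> \<psi> by (simp_all add: L2_iff)
  have sb: "sq_int ?M (\<lambda>x. \<psi> x *\<^sub>R b)" "sq_int ?M (\<lambda>x. grad \<psi> x \<bullet> b)" if "b \<in> Basis" for b
  proof -
    show "sq_int ?M (\<lambda>x. \<psi> x *\<^sub>R b)"
      using s(3) that by (auto simp: sq_int_def)
    have "integrable ?M (\<lambda>x. (norm (grad \<psi> x \<bullet> b))\<^sup>2)"
    proof (rule Bochner_Integration.integrable_bound[OF sq_int_integrable[OF s(4)]])
      show "AE x in ?M. norm ((norm (grad \<psi> x \<bullet> b))\<^sup>2) \<le> norm ((norm (grad \<psi> x))\<^sup>2)"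
        using that by (intro AE_I2) (simp add: Basis_le_norm flip: abs_le_square_iff)
    qed (use sq_int_measurable[OF s(4)] in measurable)
    then show "sq_int ?M (\<lambda>x. grad \<psi> x \<bullet> b)"
      unfolding sq_int_def using sq_int_measurable[OF s(4)] by auto
  qed
  have su: "sq_int ?M u" "sq_int ?M G" using u by (simp_all add: L2_iff)
  show "(LINT x|?M. u x *\<^sub>R grad \<psi> x) = - (LINT x|?M. \<psi> x *\<^sub>R G x)"
  proof (rule euclidean_eqI)
    fix b :: 'a assume b: "b \<in> Basis"
    have 1: "(\<lambda>n. LINT x|?M. \<phi> n x \<bullet> (grad \<psi> x \<bullet> b)) \<longlonglongrightarrow> (LINT x|?M. u x \<bullet> (grad \<psi> x \<bullet> b))"
      by (rule tendsto_integral_inner_const[OF s(1) su(1) lim(1) sb(2)[OF b]])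
    have 2: "(\<lambda>n. LINT x|?M. grad (\<phi> n) x \<bullet> (\<psi> x *\<^sub>R b)) \<longlonglongrightarrow> (LINT x|?M. G x \<bullet> (\<psi> x *\<^sub>R b))"
      by (rule tendsto_integral_inner_const[OF s(2) su(2) lim(2) sb(1)[OF b]])
    have "(LINT x|?M. \<phi> n x \<bullet> (grad \<psi> x \<bullet> b)) = - (LINT x|?M. grad (\<phi> n) x \<bullet> (\<psi> x *\<^sub>R b))" for n
    proof -
      have "(LINT x|?M. \<phi> n x \<bullet> (grad \<psi> x \<bullet> b)) = (LINT x|?M. (\<phi> n x *\<^sub>R grad \<psi> x) \<bullet> b)" by simp
      also have "\<dots> = (LINT x|?M. \<phi> n x *\<^sub>R grad \<psi> x) \<bullet> b"
        by (rule integral_inner_left) (intro integrable_scaleR_sq_int s)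
      also have "\<dots> = - (LINT x|?M. \<psi> x *\<^sub>R grad (\<phi> n) x) \<bullet> b"
        using has_weak_gradient_test_function[OF \<Omega> \<phi>] \<psi> unfolding has_weak_gradient_def by metis
      also have "\<dots> = - ((LINT x|?M. \<psi> x *\<^sub>R grad (\<phi> n) x) \<bullet> b)" by simp
      also have "(LINT x|?M. \<psi> x *\<^sub>R grad (\<phi> n) x) \<bullet> b = (LINT x|?M. (\<psi> x *\<^sub>R grad (\<phi> n) x) \<bullet> b)"
        by (rule integral_inner_left[symmetric]) (intro integrable_scaleR_sq_int s)
      finally show ?thesis by (simp add: mult.commute)
    qed
    with 1 have "(\<lambda>n. LINT x|?M. grad (\<phi> n) x \<bullet> (\<psi> x *\<^sub>R b)) \<longlonglongrightarrow> - (LINT x|?M. u x \<bullet> (grad \<psi> x \<bullet> b))"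
      using tendsto_minus by fastforce
    with 2 have eq: "(LINT x|?M. u x \<bullet> (grad \<psi> x \<bullet> b)) = - (LINT x|?M. G x \<bullet> (\<psi> x *\<^sub>R b))"
      using LIMSEQ_unique by fastforce
    have "(LINT x|?M. u x *\<^sub>R grad \<psi> x) \<bullet> b = (LINT x|?M. (u x *\<^sub>R grad \<psi> x) \<bullet> b)"
      by (rule integral_inner_left[symmetric]) (intro integrable_scaleR_sq_int s su)
    also have "\<dots> = - (LINT x|?M. (\<psi> x *\<^sub>R G x) \<bullet> b)" using eq by simp
    also have "(LINT x|?M. (\<psi> x *\<^sub>R G x) \<bullet> b) = (LINT x|?M. \<psi> x *\<^sub>R G x) \<bullet> b"
      by (rule integral_inner_left) (intro integrable_scaleR_sq_int s su)
    finally show "(LINT x|?M. u x *\<^sub>R grad \<psi> x) \<bullet> b = - (LINT x|?M. \<psi> x *\<^sub>R G x) \<bullet> b"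
      by simp
  qed
qed

section \<open>Working with \<open>H10\<close> through approximating test functions\<close>

lemma weak_grad_H1:
  assumes "u \<in> H1 \<Omega>"
  shows "weak_grad \<Omega> u \<in> L2 \<Omega>" "has_weak_gradient \<Omega> u (weak_grad \<Omega> u)"
proof -
  have "\<exists>g. g \<in> L2 \<Omega> \<and> has_weak_gradient \<Omega> u g" using assms by (auto simp: H1_def)
  from someI_ex[OF this] show "weak_grad \<Omega> u \<in> L2 \<Omega>" "has_weak_gradient \<Omega> u (weak_grad \<Omega> u)"
    by (simp_all add: weak_grad_def)
qed

lemma sqnorm_cong_AE:
  assumes "AE x in M. f x = g x" "sq_int M f" "sq_int M g"
  shows "sqnorm M f = sqnorm M g"
  unfolding sqnorm_def by (intro integral_cong_AE) (use assms in \<open>auto simp: sq_int_def\<close>)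

text \<open>The definition of \<open>H10\<close> refers to the chosen representative
  \<open>weak_grad\<close>. Here any L2 limit \<open>G\<close> of the gradients may be used, and
  uniqueness identifies the two almost everywhere.\<close>

lemma H10I:
  assumes \<Omega>: "open \<Omega>" and fin: "finite_measure (lebesgue_on \<Omega>)" and \<phi>: "\<And>n. test_function \<Omega> (\<phi> n)"
    and u: "u \<in> L2 \<Omega>" "G \<in> L2 \<Omega>"
    and lim: "(\<lambda>n. sqnorm (lebesgue_on \<Omega>) (\<lambda>x. \<phi> n x - u x)) \<longlonglongrightarrow> 0"
      "(\<lambda>n. sqnorm (lebesgue_on \<Omega>) (\<lambda>x. grad (\<phi> n) x - G x)) \<longlonglongrightarrow> 0"
  shows "u \<in> H10 \<Omega>" "AE x in lebesgue_on \<Omega>. weak_grad \<Omega> u x = G x"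
proof -
  let ?M = "lebesgue_on \<Omega>"
  have w: "has_weak_gradient \<Omega> u G" by (rule has_weak_gradient_limit[OF \<Omega> \<phi> u lim])
  then have H1: "u \<in> H1 \<Omega>" using u by (auto simp: H1_def)
  show AE: "AE x in ?M. weak_grad \<Omega> u x = G x"
    by (rule has_weak_gradient_unique[OF \<Omega> fin weak_grad_H1[OF H1] u(2) w])
  have s: "sq_int ?M (grad (\<phi> n))" "sq_int ?M G" "sq_int ?M (weak_grad \<Omega> u)" for n
    using L2_test_function[OF \<Omega> \<phi>] u weak_grad_H1[OF H1] by (simp_all add: L2_iff)
  have "sqnorm ?M (\<lambda>x. grad (\<phi> n) x - weak_grad \<Omega> u x) = sqnorm ?M (\<lambda>x. grad (\<phi> n) x - G x)" for n
    by (intro sqnorm_cong_AE sq_int_diff s) (use AE in eventually_elim, simp)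
  then have "(\<lambda>n. sqnorm ?M (\<lambda>x. \<phi> n x - u x) + sqnorm ?M (\<lambda>x. grad (\<phi> n) x - weak_grad \<Omega> u x)) \<longlonglongrightarrow> 0"
    using tendsto_add[OF lim] by simp
  then show "u \<in> H10 \<Omega>"
    unfolding H10_def using H1 \<phi> by (auto simp: sqnorm_def)
qed

lemma H10E:
  assumes "u \<in> H10 \<Omega>"
  obtains \<phi> where "\<And>n. test_function \<Omega> (\<phi> n)"
    "(\<lambda>n. sqnorm (lebesgue_on \<Omega>) (\<lambda>x. \<phi> n x - u x)) \<longlonglongrightarrow> 0"
    "(\<lambda>n. sqnorm (lebesgue_on \<Omega>) (\<lambda>x. grad (\<phi> n) x - weak_grad \<Omega> u x)) \<longlonglongrightarrow> 0"
proof -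
  let ?M = "lebesgue_on \<Omega>"
  obtain \<phi> where \<phi>: "\<And>n. test_function \<Omega> (\<phi> n)"
    and "(\<lambda>n. (LINT x|?M. (\<phi> n x - u x)\<^sup>2) + (LINT x|?M. (norm (grad (\<phi> n) x - weak_grad \<Omega> u x))\<^sup>2)) \<longlonglongrightarrow> 0"
    using assms by (auto simp: H10_def)
  then have lim: "(\<lambda>n. sqnorm ?M (\<lambda>x. \<phi> n x - u x) + sqnorm ?M (\<lambda>x. grad (\<phi> n) x - weak_grad \<Omega> u x)) \<longlonglongrightarrow> 0"
    by (simp add: sqnorm_def)
  show thesis
  proof (rule that[OF \<phi>])
    show "(\<lambda>n. sqnorm ?M (\<lambda>x. \<phi> n x - u x)) \<longlonglongrightarrow> 0"
      by (rule tendsto_sandwich[OF _ _ tendsto_const lim]) (auto simp: sqnorm_nonneg)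
    show "(\<lambda>n. sqnorm ?M (\<lambda>x. grad (\<phi> n) x - weak_grad \<Omega> u x)) \<longlonglongrightarrow> 0"
      by (rule tendsto_sandwich[OF _ _ tendsto_const lim]) (auto simp: sqnorm_nonneg)
  qed
qed

lemma H10_sq_int:
  assumes "u \<in> H10 \<Omega>"
  shows "sq_int (lebesgue_on \<Omega>) u" "sq_int (lebesgue_on \<Omega>) (weak_grad \<Omega> u)"
  using assms weak_grad_H1[of u \<Omega>] by (auto simp: H10_def H1_def L2_iff)

lemma test_function_H10:
  assumes \<Omega>: "open \<Omega>" and fin: "finite_measure (lebesgue_on \<Omega>)" and \<phi>: "test_function \<Omega> \<phi>"
  shows "\<phi> \<in> H10 \<Omega>" "AE x in lebesgue_on \<Omega>. weak_grad \<Omega> \<phi> x = grad \<phi> x"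
  using H10I[OF \<Omega> fin, of "\<lambda>_. \<phi>" \<phi> "grad \<phi>"] \<phi> L2_test_function[OF \<Omega> \<phi>] by (simp_all add: sqnorm_def)

text \<open>The direct method, carried out on test functions. The energy \<open>J\<close> is bounded
  below by the Poincare inequality; a minimising sequence satisfies the equation up to a vanishing
  error, and the same error estimate makes it a Cauchy sequence in the H1 norm. Its limit is the
  solution.\<close>

lemma torsion_solution_exists:
  assumes \<Omega>: "open \<Omega>" and fin: "finite_measure (lebesgue_on \<Omega>)"
    and poincare: "\<And>\<phi>. test_function \<Omega> \<phi> \<Longrightarrow> sqnorm (lebesgue_on \<Omega>) \<phi> \<le> C * sqnorm (lebesgue_on \<Omega>) (grad \<phi>)"
    and C: "C \<ge> 0"
  shows "\<exists>w. torsion_solution \<Omega> w"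
proof -
  let ?M = "lebesgue_on \<Omega>"
  let ?T = "test_function \<Omega>"
  define B where "B \<phi> \<psi> = (LINT x|?M. grad \<phi> x \<bullet> grad \<psi> x)" for \<phi> \<psi> :: "'a \<Rightarrow> real"
  define L where "L \<phi> = (LINT x|?M. \<phi> x)" for \<phi> :: "'a \<Rightarrow> real"
  define N where "N = measure ?M (space ?M)"
  have s: "sq_int ?M \<phi>" "sq_int ?M (grad \<phi>)" if "?T \<phi>" for \<phi>
    using L2_test_function[OF \<Omega> that] by (simp_all add: L2_iff)
  have one: "sq_int ?M (\<lambda>x. 1::real)" by (rule sq_int_const[OF fin])
  have L_inner: "L \<phi> = (LINT x|?M. \<phi> x \<bullet> 1)" for \<phi> by (simp add: L_def)
  have BB: "B \<phi> \<phi> = sqnorm ?M (grad \<phi>)" for \<phi> by (simp add: B_def sqnorm_eq_inner)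
  have L2B: "(L \<phi>)\<^sup>2 \<le> (C * N) * B \<phi> \<phi>" if "?T \<phi>" for \<phi>
  proof -
    have "(L \<phi>)\<^sup>2 \<le> sqnorm ?M \<phi> * sqnorm ?M (\<lambda>x. 1::real)"
      unfolding L_inner by (rule Cauchy_Schwarz_sq_int[OF s(1)[OF that] one])
    also have "sqnorm ?M (\<lambda>x. 1::real) = N" by (simp add: sqnorm_def N_def)
    also have "sqnorm ?M \<phi> * N \<le> C * B \<phi> \<phi> * N"
      unfolding BB by (intro mult_right_mono poincare that) (simp add: N_def)
    finally show ?thesis by (simp add: mult_ac)
  qed
  define J where "J \<phi> = B \<phi> \<phi> - 2 * L \<phi>" for \<phi>
  have J_lower: "J \<phi> \<ge> - (C * N)" if "?T \<phi>" for \<phi>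
  proof -
    \<comment> \<open>Squared, this is \<open>L2B\<close> followed by 4ab <= (a + b)^2; it gives the
      lower bound on the energy.\<close>
    have "\<bar>2 * L \<phi>\<bar> \<le> C * N + B \<phi> \<phi>"
    proof (rule power2_le_imp_le)
      have "\<bar>2 * L \<phi>\<bar>\<^sup>2 \<le> 4 * ((C * N) * B \<phi> \<phi>)" using L2B[OF that] by (simp add: power_mult_distrib)
      also have "\<dots> \<le> (C * N + B \<phi> \<phi>)\<^sup>2"
        using sum_squares_bound[of "C * N" "B \<phi> \<phi>"] by (simp add: power2_sum)
      finally show "\<bar>2 * L \<phi>\<bar>\<^sup>2 \<le> (C * N + B \<phi> \<phi>)\<^sup>2" .
      show "0 \<le> C * N + B \<phi> \<phi>" using C by (simp add: BB sqnorm_nonneg N_def)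
    qed
    then show ?thesis by (simp add: J_def)
  qed
  have T0: "?T (\<lambda>x. 0)" by (rule test_functionI[OF smooth_const compact_empty]) auto
  define S where "S = Inf (J ` {\<phi>. ?T \<phi>})"
  have bdd: "bdd_below (J ` {\<phi>. ?T \<phi>})" using J_lower by (auto intro!: bdd_belowI2)
  have S_le: "S \<le> J \<phi>" if "?T \<phi>" for \<phi> unfolding S_def using that bdd by (auto intro: cInf_lower)
  define \<delta> where "\<delta> n = inverse (real (Suc n))" for n
  have \<delta>: "\<delta> n > 0" "\<delta> \<longlonglongrightarrow> 0" for n
    using LIMSEQ_inverse_real_of_nat by (simp_all add: \<delta>_def[abs_def])
  have "\<exists>\<phi>. ?T \<phi> \<and> J \<phi> < S + \<delta> n" for n
  proof -
    have "\<exists>y\<in>J ` {\<phi>. ?T \<phi>}. y < S + \<delta> n"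
      unfolding S_def by (rule cInf_lessD) (use T0 \<delta> in auto)
    then show ?thesis by auto
  qed
  then obtain \<psi> where \<psi>: "\<And>n. ?T (\<psi> n)" "\<And>n. J (\<psi> n) < S + \<delta> n" by metis
  \<comment> \<open>Along the line \<open>\<psi> n + t * v\<close> the energy is quadratic in
    \<open>t\<close> and never drops below its infimum \<open>S\<close>. The discriminant therefore
    bounds the residual of the equation by the excess energy, which is below
    \<open>\<delta> n\<close>.\<close>
  have EL: "(B (\<psi> n) v - L v)\<^sup>2 \<le> \<delta> n * B v v" if v: "?T v" for n v
  proof -
    have "(B (\<psi> n) v - L v)\<^sup>2 \<le> (J (\<psi> n) - S) * B v v"
    proof (rule nonneg_quadratic_discriminant)
      fix t
      have tv: "?T (\<lambda>x. \<psi> n x + t * v x)" by (intro test_function_add test_function_cmult \<psi> v)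
      have g: "grad (\<lambda>x. \<psi> n x + t * v x) = (\<lambda>x. grad (\<psi> n) x + t *\<^sub>R grad v x)"
        by (intro ext) (simp add: grad_add grad_cmult smooth_mult smooth_const
            test_function_smooth[OF \<psi>(1)] test_function_smooth[OF v])
      have "L (\<lambda>x. \<psi> n x + t * v x) = L (\<psi> n) + t * L v"
        unfolding L_def using sq_int_imp_integrable[OF fin s(1)[OF \<psi>(1)[of n]]]
          sq_int_imp_integrable[OF fin s(1)[OF v]] by simp
      moreover have "B (\<lambda>x. \<psi> n x + t * v x) (\<lambda>x. \<psi> n x + t * v x) = B (\<psi> n) (\<psi> n) + 2 * t * B (\<psi> n) v + t\<^sup>2 * B v v"
        unfolding BB g using sqnorm_expand[OF s(2)[OF \<psi>(1)[of n]] s(2)[OF v], of t] by (simp add: B_def)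
      ultimately have "J (\<lambda>x. \<psi> n x + t * v x) = J (\<psi> n) + 2 * t * (B (\<psi> n) v - L v) + t\<^sup>2 * B v v"
        by (simp add: J_def algebra_simps)
      then show "0 \<le> (J (\<psi> n) - S) + 2 * t * (B (\<psi> n) v - L v) + t\<^sup>2 * B v v"
        using S_le[OF tv] by linarith
    qed (simp add: BB sqnorm_nonneg)
    also have "\<dots> \<le> \<delta> n * B v v"
      using \<psi>(2)[of n] by (intro mult_right_mono) (auto simp: BB sqnorm_nonneg)
    finally show ?thesis .
  qed
  have gd: "grad (\<lambda>x. \<psi> m x + (-1) * \<psi> n x) x = grad (\<psi> m) x - grad (\<psi> n) x" for m n x
  proof -
    note sm = test_function_smooth[OF \<psi>(1)]
    show ?thesis
      by (simp only: grad_add[OF sm smooth_mult[OF smooth_const sm]] grad_cmult[OF sm]) simp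
  qed
  \<comment> \<open>For v equal to the difference of two members of the sequence, the energy of v is
    the difference of their residuals at v, because \<open>L v\<close> cancels. Each residual is of
    order sqrt(\<open>\<delta>\<close> * energy), and one factor of the energy can be divided
    out.\<close>
  have cauchy_grad: "sqnorm ?M (\<lambda>x. grad (\<psi> m) x - grad (\<psi> n) x) \<le> 2 * (\<delta> m + \<delta> n)" for m n
  proof -
    define v where "v x = \<psi> m x + (-1) * \<psi> n x" for x
    have v: "?T v" unfolding v_def by (intro test_function_add test_function_cmult \<psi>)
    have gv: "grad v x = grad (\<psi> m) x - grad (\<psi> n) x" for x
      unfolding v_def by (rule gd)
    define b where "b = B v v"
    have b0: "b \<ge> 0" by (simp add: b_def BB sqnorm_nonneg)
    have "b = B (\<psi> m) v - B (\<psi> n) v"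
      unfolding b_def B_def gv inner_diff_left
      by (rule Bochner_Integration.integral_diff)
        (intro integrable_inner_sq_int sq_int_diff s \<psi>)+
    then have "b = (B (\<psi> m) v - L v) - (B (\<psi> n) v - L v)" by simp
    note beq = this
    have "b\<^sup>2 \<le> 2 * (B (\<psi> m) v - L v)\<^sup>2 + 2 * (B (\<psi> n) v - L v)\<^sup>2"
    proof -
      have "(p - q)\<^sup>2 \<le> 2 * p\<^sup>2 + 2 * q\<^sup>2" for p q :: real
        using zero_le_power2[of "p + q"] by (simp add: power2_eq_square algebra_simps)
      then show ?thesis unfolding beq .
    qed
    also have "\<dots> \<le> 2 * (\<delta> m * b) + 2 * (\<delta> n * b)"
      using EL[OF v, of m] EL[OF v, of n] by (simp add: b_def)
    finally have "b * b \<le> (2 * (\<delta> m + \<delta> n)) * b" by (simp add: power2_eq_square algebra_simps)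
    then have "b \<le> 2 * (\<delta> m + \<delta> n)"
      using b0 \<delta>(1)[of m] \<delta>(1)[of n] by (cases "b = 0") auto
    moreover have "grad v = (\<lambda>x. grad (\<psi> m) x - grad (\<psi> n) x)" using gv by auto
    ultimately show ?thesis by (simp add: b_def BB)
  qed
  \<comment> \<open>Value and gradient are packed into one pair-valued function, so that a single
    use of completeness yields both limits.\<close>
  define P where "P n x = (\<psi> n x, grad (\<psi> n) x)" for n x
  have P: "sq_int ?M (P n)" for n
    using s[OF \<psi>(1)[of n]] unfolding sq_int_def P_def norm_Pair by auto
  have Pd: "sqnorm ?M (\<lambda>x. P m x - P n x) \<le> (C + 1) * (2 * (\<delta> m + \<delta> n))" for m n
  proof -
    let ?v = "\<lambda>x. \<psi> m x + (-1) * \<psi> n x"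
    have v: "?T ?v" by (intro test_function_add test_function_cmult \<psi>)
    have gv: "grad ?v = (\<lambda>x. grad (\<psi> m) x - grad (\<psi> n) x)"
      using gd by auto
    have "sqnorm ?M (\<lambda>x. P m x - P n x) = (LINT x|?M. (norm (?v x))\<^sup>2 + (norm (grad ?v x))\<^sup>2)"
      unfolding sqnorm_def P_def gv by (simp add: norm_Pair)
    also have "\<dots> = sqnorm ?M ?v + sqnorm ?M (grad ?v)"
      unfolding sqnorm_def by (intro Bochner_Integration.integral_add sq_int_integrable s v)
    also have "\<dots> \<le> (C + 1) * sqnorm ?M (grad ?v)"
      using poincare[OF v] by (simp add: algebra_simps)
    also have "\<dots> \<le> (C + 1) * (2 * (\<delta> m + \<delta> n))"
      using cauchy_grad[of m n] C unfolding gv by (intro mult_left_mono) auto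
    finally show ?thesis .
  qed
  have cau: "\<exists>K. \<forall>m\<ge>K. \<forall>n\<ge>K. sqnorm ?M (\<lambda>x. P m x - P n x) < e" if e: "e > 0" for e
  proof -
    have "e / (4 * (C + 1)) > 0" using e C by simp
    then obtain K where K: "\<And>n. n \<ge> K \<Longrightarrow> \<delta> n < e / (4 * (C + 1))"
      using order_tendstoD(2)[OF \<delta>(2)] by (auto simp: eventually_sequentially)
    have "sqnorm ?M (\<lambda>x. P m x - P n x) < e" if "m \<ge> K" "n \<ge> K" for m n
    proof -
      have "(C + 1) * (2 * (\<delta> m + \<delta> n)) < (C + 1) * (2 * (e / (4 * (C + 1)) + e / (4 * (C + 1))))"
        using K[OF that(1)] K[OF that(2)] C by (intro mult_strict_left_mono) auto
      also have "\<dots> = 4 * (C + 1) * (e / (4 * (C + 1)))"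
      proof -
        have "(C + 1) * (2 * (x + x)) = 4 * (C + 1) * x" for x by (simp add: algebra_simps)
        then show ?thesis by blast
      qed
      also have "\<dots> = e" using C by simp
      finally show ?thesis using Pd[of m n] by linarith
    qed
    then show ?thesis by blast
  qed
  obtain F where F: "sq_int ?M F" "(\<lambda>n. sqnorm ?M (\<lambda>x. P n x - F x)) \<longlonglongrightarrow> 0"
    by (rule sq_int_complete[OF fin P cau])
  define w where "w x = fst (F x)" for x
  define G where "G x = snd (F x)" for x
  have Fm[measurable]: "F \<in> borel_measurable ?M" by (rule sq_int_measurable[OF F(1)])
  have wm: "w \<in> borel_measurable ?M" "G \<in> borel_measurable ?M"
    unfolding w_def G_def by (auto intro!: borel_measurable_continuous_on[OF _ Fm] continuous_intros)
  have nF: "(norm (w x))\<^sup>2 + (norm (G x))\<^sup>2 = (norm (F x))\<^sup>2" for x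
    by (simp add: w_def G_def norm_prod_def)
  have le: "(norm (w x))\<^sup>2 \<le> (norm (F x))\<^sup>2" "(norm (G x))\<^sup>2 \<le> (norm (F x))\<^sup>2" for x
    by (simp_all flip: nF)
  have "integrable ?M (\<lambda>x. (norm (w x))\<^sup>2)" "integrable ?M (\<lambda>x. (norm (G x))\<^sup>2)"
    by (rule Bochner_Integration.integrable_bound[OF sq_int_integrable[OF F(1)]];
        use wm le in simp)+
  with wm have wG: "sq_int ?M w" "sq_int ?M G" by (simp_all add: sq_int_def)
  have PF: "sqnorm ?M (\<lambda>x. P n x - F x) = sqnorm ?M (\<lambda>x. \<psi> n x - w x) + sqnorm ?M (\<lambda>x. grad (\<psi> n) x - G x)" for n
  proof -
    have "sqnorm ?M (\<lambda>x. P n x - F x) = (LINT x|?M. (norm (\<psi> n x - w x))\<^sup>2 + (norm (grad (\<psi> n) x - G x))\<^sup>2)"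
      unfolding sqnorm_def by (simp add: P_def w_def G_def norm_prod_def)
    also have "\<dots> = sqnorm ?M (\<lambda>x. \<psi> n x - w x) + sqnorm ?M (\<lambda>x. grad (\<psi> n) x - G x)"
      unfolding sqnorm_def by (intro Bochner_Integration.integral_add sq_int_integrable sq_int_diff s \<psi> wG)
    finally show ?thesis .
  qed
  have lw: "(\<lambda>n. sqnorm ?M (\<lambda>x. \<psi> n x - w x)) \<longlonglongrightarrow> 0"
    by (rule tendsto_sandwich[OF _ _ tendsto_const F(2)]) (auto simp: sqnorm_nonneg PF)
  have lG: "(\<lambda>n. sqnorm ?M (\<lambda>x. grad (\<psi> n) x - G x)) \<longlonglongrightarrow> 0"
    by (rule tendsto_sandwich[OF _ _ tendsto_const F(2)]) (auto simp: sqnorm_nonneg PF)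
  have w: "w \<in> H10 \<Omega>" "AE x in ?M. weak_grad \<Omega> w x = G x"
    using H10I[OF \<Omega> fin \<psi>(1) _ _ lw lG] wG by (simp_all add: L2_iff)
  have test: "(LINT x|?M. G x \<bullet> grad v x) = L v" if v: "?T v" for v
  proof -
    have "(\<lambda>n. B (\<psi> n) v) \<longlonglongrightarrow> (LINT x|?M. G x \<bullet> grad v x)"
      unfolding B_def by (rule tendsto_integral_inner_const[OF s(2)[OF \<psi>(1)] wG(2) lG s(2)[OF v]])
    moreover have "(\<lambda>n. B (\<psi> n) v) \<longlonglongrightarrow> L v"
    proof -
      have "(\<lambda>n. \<delta> n * B v v) \<longlonglongrightarrow> 0 * B v v" by (intro tendsto_intros \<delta>)
      then have d0: "(\<lambda>n. \<delta> n * B v v) \<longlonglongrightarrow> 0" by simp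
      have "(\<lambda>n. (B (\<psi> n) v - L v)\<^sup>2) \<longlonglongrightarrow> 0"
        by (rule tendsto_sandwich[OF _ _ tendsto_const d0]) (auto simp: EL[OF v])
      then have "(\<lambda>n. B (\<psi> n) v - L v) \<longlonglongrightarrow> 0"
        using tendsto_real_sqrt[of "\<lambda>n. (B (\<psi> n) v - L v)\<^sup>2" 0] by (simp add: tendsto_rabs_zero_iff)
      then show ?thesis by (rule LIM_zero_cancel)
    qed
    ultimately show ?thesis by (rule LIMSEQ_unique)
  qed
  \<comment> \<open>The equation, known for test functions, extends to \<open>H10\<close> because
    both sides are L2 continuous in \<open>v\<close> and its gradient.\<close>
  have "(LINT x|?M. weak_grad \<Omega> w x \<bullet> weak_grad \<Omega> v x) = (LINT x|?M. v x)" if v: "v \<in> H10 \<Omega>" for v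
  proof -
    obtain \<phi> where \<phi>: "\<And>n. ?T (\<phi> n)"
      "(\<lambda>n. sqnorm ?M (\<lambda>x. \<phi> n x - v x)) \<longlonglongrightarrow> 0"
      "(\<lambda>n. sqnorm ?M (\<lambda>x. grad (\<phi> n) x - weak_grad \<Omega> v x)) \<longlonglongrightarrow> 0"
      by (rule H10E[OF v], rule that) blast+
    note sv = H10_sq_int[OF v] and sw = H10_sq_int[OF w(1)]
    have "(\<lambda>n. LINT x|?M. \<phi> n x \<bullet> 1) \<longlonglongrightarrow> (LINT x|?M. v x \<bullet> 1)"
      by (rule tendsto_integral_inner_const[OF s(1)[OF \<phi>(1)] sv(1) \<phi>(2) one])
    then have 1: "(\<lambda>n. L (\<phi> n)) \<longlonglongrightarrow> L v" by (simp add: L_inner)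
    have "(\<lambda>n. LINT x|?M. grad (\<phi> n) x \<bullet> G x) \<longlonglongrightarrow> (LINT x|?M. weak_grad \<Omega> v x \<bullet> G x)"
      by (rule tendsto_integral_inner_const[OF s(2)[OF \<phi>(1)] sv(2) \<phi>(3) wG(2)])
    then have 2: "(\<lambda>n. L (\<phi> n)) \<longlonglongrightarrow> (LINT x|?M. weak_grad \<Omega> v x \<bullet> G x)"
      using test[OF \<phi>(1)] by (simp only: inner_commute)
    have "(LINT x|?M. weak_grad \<Omega> w x \<bullet> weak_grad \<Omega> v x) = (LINT x|?M. weak_grad \<Omega> v x \<bullet> G x)"
    proof (rule integral_cong_AE)
      show "AE x in ?M. weak_grad \<Omega> w x \<bullet> weak_grad \<Omega> v x = weak_grad \<Omega> v x \<bullet> G x"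
        using w(2) by eventually_elim (simp add: inner_commute)
    qed (intro borel_measurable_inner sq_int_measurable sv sw wG)+
    also have "\<dots> = L v" by (rule LIMSEQ_unique[OF 2 1])
    finally show ?thesis by (simp add: L_def)
  qed
  with w(1) show ?thesis by (auto simp: torsion_solution_def)
qed

section \<open>A Poincare inequality on discs centred outside the domain\<close>

definition rot90 :: "real^2 \<Rightarrow> real^2" where
  "rot90 v = vector [- (v $ 2), v $ 1]"

definition rotate_about :: "real^2 \<Rightarrow> real \<Rightarrow> real^2 \<Rightarrow> real^2" where
  "rotate_about p \<theta> x = p + (cos \<theta> *\<^sub>R (x - p) + sin \<theta> *\<^sub>R rot90 (x - p))"

lemma rot90_nth [simp]: "rot90 v $ 1 = - (v $ 2)" "rot90 v $ 2 = v $ 1"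
  by (simp_all add: rot90_def)

lemma linear_rot90: "linear rot90"
  by (auto simp: linear_iff vec_eq_iff forall_2)

lemma bounded_linear_rot90: "bounded_linear rot90"
  by (rule linear_conv_bounded_linear[THEN iffD1, OF linear_rot90])

lemma inner_rot90: "v \<bullet> rot90 w = - (rot90 v \<bullet> w)" "rot90 v \<bullet> rot90 w = v \<bullet> w"
  by (simp_all add: inner_vec_def sum_2)

lemma rot90_rot90 [simp]: "rot90 (rot90 v) = - v"
  by (simp add: vec_eq_iff forall_2)

lemma norm_rot90 [simp]: "norm (rot90 v) = norm v"
  by (simp add: norm_eq_sqrt_inner inner_rot90)

lemma orthogonal_transformation_rotation:
  "orthogonal_transformation (\<lambda>v. cos \<theta> *\<^sub>R v + sin \<theta> *\<^sub>R rot90 v)"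
  unfolding orthogonal_transformation_def
proof
  show "linear (\<lambda>v. cos \<theta> *\<^sub>R v + sin \<theta> *\<^sub>R rot90 v)"
    by (intro linear_compose_add linear_compose_scale_right linear_ident linear_rot90)
  show "\<forall>v w. (cos \<theta> *\<^sub>R v + sin \<theta> *\<^sub>R rot90 v) \<bullet> (cos \<theta> *\<^sub>R w + sin \<theta> *\<^sub>R rot90 w) = v \<bullet> w"
  proof (intro allI)
    fix v w :: "real^2"
    have "(cos \<theta> *\<^sub>R v + sin \<theta> *\<^sub>R rot90 v) \<bullet> (cos \<theta> *\<^sub>R w + sin \<theta> *\<^sub>R rot90 w)
       = ((cos \<theta>)\<^sup>2 + (sin \<theta>)\<^sup>2) * (v \<bullet> w)"
      unfolding inner_add_left inner_add_right inner_scaleR_left inner_scaleR_right distrib_right power2_eq_square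
      by (simp add: inner_rot90 algebra_simps power2_eq_square)
    then show "(cos \<theta> *\<^sub>R v + sin \<theta> *\<^sub>R rot90 v) \<bullet> (cos \<theta> *\<^sub>R w + sin \<theta> *\<^sub>R rot90 w) = v \<bullet> w"
      by simp
  qed
qed

lemma dist_rotate_about: "norm (rotate_about p \<theta> x - p) = norm (x - p)"
  using orthogonal_transformation_norm[OF orthogonal_transformation_rotation[of \<theta>], of "x - p"]
  by (simp add: rotate_about_def)

lemma rotate_about_has_vector_derivative:
  "((\<lambda>\<theta>. rotate_about p \<theta> x) has_vector_derivative rot90 (rotate_about p \<theta> x - p)) (at \<theta> within S)"
proof -
  have "rot90 (rotate_about p \<theta> x - p) = - sin \<theta> *\<^sub>R (x - p) + cos \<theta> *\<^sub>R rot90 (x - p)"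
  proof -
    have "rotate_about p \<theta> x - p = cos \<theta> *\<^sub>R (x - p) + sin \<theta> *\<^sub>R rot90 (x - p)"
      by (simp add: rotate_about_def)
    then show ?thesis
      by (simp add: linear_add[OF linear_rot90] linear_scale[OF linear_rot90] linear_diff[OF linear_rot90] scaleR_diff_right)
  qed
  then show ?thesis
    unfolding rotate_about_def by (auto intro!: derivative_eq_intros)
qed

lemma continuous_on_rotate_about [continuous_intros]:
  fixes f :: "'c::t2_space \<Rightarrow> real"
  assumes "continuous_on S f" "continuous_on S g"
  shows "continuous_on S (\<lambda>z. rotate_about p (f z) (g z))"
  unfolding rotate_about_def
  by (intro continuous_intros assms bounded_linear.continuous_on[OF bounded_linear_rot90])

text \<open>Lebesgue measure is determined by its values on boxes, and the preimage of a box is its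
  image under the inverse, an orthogonal map that preserves measure.\<close>

lemma orthogonal_transformation_distr_lborel:
  fixes f :: "real^2 \<Rightarrow> real^2"
  assumes f: "orthogonal_transformation f"
  shows "distr lborel borel f = lborel"
proof (rule lborel_eqI[symmetric])
  have fm: "f \<in> borel_measurable borel"
    by (intro borel_measurable_continuous_onI linear_continuous_on
        linear_conv_bounded_linear[THEN iffD1] orthogonal_transformation_linear[OF f])
  have bij: "bij f" by (rule orthogonal_transformation_bij[OF f])
  have inv: "orthogonal_transformation (inv f)" by (rule orthogonal_transformation_inv[OF f])
  fix l u :: "real^2" assume lu: "\<And>b. b \<in> Basis \<Longrightarrow> l \<bullet> b \<le> u \<bullet> b"
  have vi: "f -` box l u = inv f ` box l u" by (rule bij_vimage_eq_inv_image[OF bij])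
  have lm: "inv f ` box l u \<in> lmeasurable"
    by (rule measurable_orthogonal_image[OF inv]) simp
  have "emeasure (distr lborel borel f) (box l u) = emeasure lborel (f -` box l u)"
    by (subst emeasure_distr) (use fm in auto)
  also have "\<dots> = emeasure lebesgue (f -` box l u)"
  proof -
    have "f -` box l u \<in> sets borel" using measurable_sets[OF fm, of "box l u"] by simp
    then show ?thesis by simp
  qed
  also have "\<dots> = ennreal (measure lebesgue (inv f ` box l u))"
    unfolding vi by (rule emeasure_eq_measure2[OF lm])
  also have "measure lebesgue (inv f ` box l u) = measure lebesgue (box l u)"
    by (rule measure_orthogonal_image[OF inv]) simp
  also have "\<dots> = (\<Prod>b\<in>Basis. (u - l) \<bullet> b)"
    using lu by (simp add: measure_lborel_box_eq inner_diff_left)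
  finally show "emeasure (distr lborel borel f) (box l u) = ennreal (\<Prod>b\<in>Basis. (u - l) \<bullet> b)" .
qed simp

lemma nn_integral_rotate_about:
  assumes g[measurable]: "g \<in> borel_measurable borel"
  shows "(\<integral>\<^sup>+x. g (rotate_about p \<theta> x) \<partial>lborel) = (\<integral>\<^sup>+x. g x \<partial>lborel)"
proof -
  let ?R = "\<lambda>v. cos \<theta> *\<^sub>R v + sin \<theta> *\<^sub>R rot90 v"
  have Rm[measurable]: "?R \<in> borel_measurable borel"
    by (intro borel_measurable_continuous_onI linear_continuous_on
        linear_conv_bounded_linear[THEN iffD1] orthogonal_transformation_linear orthogonal_transformation_rotation)
  have "(\<integral>\<^sup>+x. g (rotate_about p \<theta> x) \<partial>lborel) = (\<integral>\<^sup>+x. g (rotate_about p \<theta> x) \<partial>distr lborel borel ((+) p))"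
    by (simp only: lborel_distr_plus)
  also have "\<dots> = (\<integral>\<^sup>+x. g (rotate_about p \<theta> (p + x)) \<partial>lborel)"
  proof -
    have "rotate_about p \<theta> \<in> borel_measurable borel"
      by (intro borel_measurable_continuous_onI continuous_on_rotate_about continuous_on_const continuous_on_id)
    then have "(\<lambda>x. g (rotate_about p \<theta> x)) \<in> borel_measurable borel"
      by (rule measurable_compose[OF _ g])
    then show ?thesis by (intro nn_integral_distr) auto
  qed
  also have "\<dots> = (\<integral>\<^sup>+x. g (p + ?R x) \<partial>lborel)"
    by (simp add: rotate_about_def)
  also have "\<dots> = (\<integral>\<^sup>+x. g (p + x) \<partial>distr lborel borel ?R)"
    by (rule nn_integral_distr[symmetric]) auto
  also have "\<dots> = (\<integral>\<^sup>+x. g (p + x) \<partial>lborel)"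
    by (simp only: orthogonal_transformation_distr_lborel[OF orthogonal_transformation_rotation])
  also have "\<dots> = (\<integral>\<^sup>+x. g x \<partial>distr lborel borel ((+) p))"
    by (rule nn_integral_distr[symmetric]) auto
  finally show ?thesis by (simp only: lborel_distr_plus)
qed

text \<open>A circle around a point outside a simply connected domain cannot lie inside the domain,
  since it winds once around its centre.\<close>

lemma circle_leaves_simply_connected:
  assumes sc: "simply_connected \<Omega>" and p: "p \<notin> \<Omega>"
  shows "\<exists>\<theta>\<in>{0..2*pi}. rotate_about p \<theta> x \<notin> \<Omega>"
proof (cases "x = p")
  case True
  then show ?thesis using p by (auto intro!: bexI[of _ 0] simp: rotate_about_def)
next
  case False
  \<comment> \<open>A linear homeomorphism onto the complex plane carries simple connectivity to the
    place where winding numbers are defined; the rotation becomes multiplication by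
    \<open>cis \<theta>\<close>.\<close>
  define h where "h v = Complex (v $ 1) (v $ 2)" for v :: "real^2"
  have lin: "linear h" by (auto simp: linear_iff h_def complex_eq_iff)
  have inj: "inj h" by (auto simp: inj_def h_def vec_eq_iff forall_2)
  have hrot: "h (rotate_about p \<theta> x) = h p + cis \<theta> * (h x - h p)" for \<theta>
    by (simp add: h_def rotate_about_def complex_eq_iff algebra_simps)
  have "h ` \<Omega> homeomorphic \<Omega>"
    using linear_homeomorphic_image[OF lin inj] homeomorphic_sym by blast
  then have sch: "simply_connected (h ` \<Omega>)"
    using sc homeomorphic_simply_connected_eq by blast
  have php: "h p \<notin> h ` \<Omega>" using p inj by (auto dest: injD)
  define r where "r = norm (h x - h p)"
  have r: "r > 0" using False inj by (auto simp: r_def dest: injD)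
  have "\<not> path_image (circlepath (h p) r) \<subseteq> h ` \<Omega>"
  proof
    assume "path_image (circlepath (h p) r) \<subseteq> h ` \<Omega>"
    then have "winding_number (circlepath (h p) r) (h p) = 0"
      by (intro simply_connected_imp_winding_number_zero[OF sch]) (use php in auto)
    then show False using winding_number_circlepath_centre[OF r, of "h p"] by simp
  qed
  moreover have "path_image (circlepath (h p) r) = sphere (h p) r"
    using r by simp
  ultimately obtain z where z: "z \<in> sphere (h p) r" "z \<notin> h ` \<Omega>"
    by blast
  define y where "y = (z - h p) / (h x - h p)"
  have "norm y = 1"
    using z(1) r by (simp add: y_def norm_divide r_def dist_norm norm_minus_commute)
  then obtain t where t: "0 \<le> t" "t < 2 * pi" "y = cis t"
    by (metis complex_norm_eq_1_exp cis_conv_exp Arg2pi)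
  have "z = h p + y * (h x - h p)" using r by (simp add: y_def r_def)
  then have "h (rotate_about p t x) \<notin> h ` \<Omega>" using z(2) t(3) hrot by simp
  then show ?thesis using t by (intro bexI[of _ t]) auto
qed

text \<open>The weight \<open>- a tan (a (\<theta> - c))\<close> solves the Riccati equation \<open>g' + g\<^sup>2 = - a\<^sup>2\<close>, so that
  \<open>f'\<^sup>2 - a\<^sup>2 f\<^sup>2 = (f' - g f)\<^sup>2 + (g f\<^sup>2)'\<close>.\<close>

lemma integral_deriv_square_ge:
  fixes f f' :: "real \<Rightarrow> real"
  assumes "l \<le> u" and c: "c - pi \<le> l" "u \<le> c + pi" and a: "0 < a" "a < 1/2"
    and f: "\<And>t. t \<in> {l..u} \<Longrightarrow> (f has_real_derivative f' t) (at t within {l..u})"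
    and f': "continuous_on {l..u} f'"
  shows "integral {l..u} (\<lambda>t. (f' t)\<^sup>2) - a\<^sup>2 * integral {l..u} (\<lambda>t. (f t)\<^sup>2)
    \<ge> - a * tan (a * (u - c)) * (f u)\<^sup>2 + a * tan (a * (l - c)) * (f l)\<^sup>2"
proof -
  define g where "g t = - a * tan (a * (t - c)) * (f t)\<^sup>2" for t
  define g' where "g' t = - a\<^sup>2 * (1 + (tan (a * (t - c)))\<^sup>2) * (f t)\<^sup>2 - 2 * a * tan (a * (t - c)) * f t * f' t" for t
  have cf: "continuous_on {l..u} f"
    using f by (meson DERIV_continuous_on)
  \<comment> \<open>From \<open>a < 1/2\<close> and |t - c| <= pi the argument stays strictly inside
    (-pi/2, pi/2), so the weight has no pole.\<close>
  have cos: "cos (a * (t - c)) \<noteq> 0" if "t \<in> {l..u}" for t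
  proof -
    have "\<bar>a * (t - c)\<bar> = a * \<bar>t - c\<bar>" using a by (simp add: abs_mult)
    also have "\<dots> \<le> a * pi" using that c a by (intro mult_left_mono) auto
    also have "\<dots> < pi / 2" using mult_strict_right_mono[OF a(2) pi_gt_zero] by simp
    finally have "cos (a * (t - c)) > 0" by (intro cos_gt_zero_pi) auto
    then show ?thesis by simp
  qed
  have dg: "(g has_real_derivative g' t) (at t within {l..u})" if t: "t \<in> {l..u}" for t
  proof -
    have sec: "inverse ((cos (a * (t - c)))\<^sup>2) = 1 + (tan (a * (t - c)))\<^sup>2"
      using tan_sec[OF cos[OF t]] by (simp add: power_inverse)
    show ?thesis
      unfolding g_def[abs_def] g'_def sec[symmetric]
      by (rule derivative_eq_intros f[OF t] cos[OF t] refl | simp)+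
         (simp add: algebra_simps power2_eq_square)
  qed
  have "(g' has_integral (g u - g l)) {l..u}"
    by (rule fundamental_theorem_of_calculus[OF \<open>l \<le> u\<close>])
       (use dg in \<open>simp add: has_real_derivative_iff_has_vector_derivative\<close>)
  moreover have "((\<lambda>t. (f' t)\<^sup>2 - a\<^sup>2 * (f t)\<^sup>2) has_integral
     integral {l..u} (\<lambda>t. (f' t)\<^sup>2) - a\<^sup>2 * integral {l..u} (\<lambda>t. (f t)\<^sup>2)) {l..u}"
    by (intro has_integral_diff has_integral_mult_right integrable_integral integrable_continuous_interval
        continuous_intros cf f')
  moreover have "g' t \<le> (f' t)\<^sup>2 - a\<^sup>2 * (f t)\<^sup>2" for t
    using zero_le_power2[of "f' t + a * tan (a * (t - c)) * f t"]
    by (simp add: g'_def power2_eq_square algebra_simps)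
  ultimately have "g u - g l \<le> integral {l..u} (\<lambda>t. (f' t)\<^sup>2) - a\<^sup>2 * integral {l..u} (\<lambda>t. (f t)\<^sup>2)"
    by (rule has_integral_le)
  then show ?thesis by (simp add: g_def)
qed

text \<open>Read once around the circle from \<open>t0\<close>, \<open>f\<close> vanishes at both
  ends of an interval of length 2 pi, whose first Dirichlet eigenvalue is 1/4; this explains
  \<open>a < 1/2\<close>. On the two pieces cut at \<open>t0\<close> the weights are centred at t0 -
  pi and t0 + pi. The boundary terms at \<open>t0\<close> vanish with \<open>f t0\<close>, and those
  at 0 and 2 pi cancel by periodicity.\<close>

lemma wirtinger_periodic_zero:
  fixes f f' :: "real \<Rightarrow> real"
  assumes a: "0 < a" "a < 1/2" and t0: "t0 \<in> {0..2*pi}" "f t0 = 0" and per: "f 0 = f (2*pi)"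
    and f: "\<And>t. t \<in> {0..2*pi} \<Longrightarrow> (f has_real_derivative f' t) (at t within {0..2*pi})"
    and f': "continuous_on {0..2*pi} f'"
  shows "a\<^sup>2 * integral {0..2*pi} (\<lambda>t. (f t)\<^sup>2) \<le> integral {0..2*pi} (\<lambda>t. (f' t)\<^sup>2)"
proof -
  have cf: "continuous_on {0..2*pi} f"
    using f by (meson DERIV_continuous_on)
  have sub: "{0..t0} \<subseteq> {0..2*pi}" "{t0..2*pi} \<subseteq> {0..2*pi}" using t0 by auto
  have "integral {0..t0} (\<lambda>t. (f' t)\<^sup>2) - a\<^sup>2 * integral {0..t0} (\<lambda>t. (f t)\<^sup>2)
    \<ge> - a * tan (a * (t0 - (t0 - pi))) * (f t0)\<^sup>2 + a * tan (a * (0 - (t0 - pi))) * (f 0)\<^sup>2"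
    by (rule integral_deriv_square_ge)
       (use t0 a in \<open>auto intro: continuous_on_subset[OF f'] DERIV_subset[OF f]\<close>)
  moreover have "integral {t0..2*pi} (\<lambda>t. (f' t)\<^sup>2) - a\<^sup>2 * integral {t0..2*pi} (\<lambda>t. (f t)\<^sup>2)
    \<ge> - a * tan (a * (2*pi - (t0 + pi))) * (f (2*pi))\<^sup>2 + a * tan (a * (t0 - (t0 + pi))) * (f t0)\<^sup>2"
    by (rule integral_deriv_square_ge)
       (use t0 a in \<open>auto intro: continuous_on_subset[OF f'] DERIV_subset[OF f]\<close>)
  moreover have I: "integral {0..2*pi} h = integral {0..t0} h + integral {t0..2*pi} h"
    if "continuous_on {0..2*pi} h" for h :: "real \<Rightarrow> real"
    by (rule Henstock_Kurzweil_Integration.integral_combine[symmetric])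
       (use t0 that in \<open>auto intro!: integrable_continuous_interval\<close>)
  moreover have "tan (a * (2*pi - (t0 + pi))) = tan (a * (0 - (t0 - pi)))" by (simp add: algebra_simps)
  ultimately have "a\<^sup>2 * integral {0..t0} (\<lambda>t. (f t)\<^sup>2) + a\<^sup>2 * integral {t0..2*pi} (\<lambda>t. (f t)\<^sup>2)
      \<le> integral {0..t0} (\<lambda>t. (f' t)\<^sup>2) + integral {t0..2*pi} (\<lambda>t. (f' t)\<^sup>2)"
    using t0(2) per by simp
  then show ?thesis
    using I[of "\<lambda>t. (f t)\<^sup>2"] I[of "\<lambda>t. (f' t)\<^sup>2"] cf f' by (simp add: continuous_on_power distrib_left)
qed

section \<open>From circles to discs\<close>

lemma nn_integral_interval_continuous:
  fixes g :: "real \<Rightarrow> real"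
  assumes "continuous_on {a..b} g" "\<And>t. g t \<ge> 0"
  shows "(\<integral>\<^sup>+t. indicator {a..b} t * ennreal (g t) \<partial>lborel) = ennreal (integral {a..b} g)"
proof -
  have i: "set_integrable lborel {a..b} g"
    by (rule borel_integrable_atLeastAtMost') (rule assms)
  have "(\<integral>\<^sup>+t. indicator {a..b} t * ennreal (g t) \<partial>lborel) = (\<integral>\<^sup>+t. ennreal (indicator {a..b} t *\<^sub>R g t) \<partial>lborel)"
    by (intro nn_integral_cong) (auto simp: indicator_def)
  also have "\<dots> = ennreal (LINT t:{a..b}|lborel. g t)"
    unfolding set_lebesgue_integral_def
    by (rule nn_integral_eq_integral) (use i assms(2) in \<open>auto simp: set_integrable_def\<close>)
  also have "(LINT t:{a..b}|lborel. g t) = integral {a..b} g"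
    by (rule set_borel_integral_eq_integral(2)[OF i])
  finally show ?thesis .
qed

text \<open>The circle leaves the domain, so \<open>\<psi>\<close> has a zero on it. The angular
  derivative is at most the radius times the length of the gradient, and 25/4 is the inverse square
  of a = 2/5, a rational choice below 1/2.\<close>

lemma poincare_circle:
  assumes sc: "simply_connected \<Omega>" and p: "p \<notin> \<Omega>" and \<psi>: "test_function \<Omega> \<psi>"
    and x: "norm (x - p) \<le> R"
  shows "(\<integral>\<^sup>+\<theta>. indicator {0..2*pi} \<theta> * ennreal ((\<psi> (rotate_about p \<theta> x))\<^sup>2) \<partial>lborel)
    \<le> (\<integral>\<^sup>+\<theta>. indicator {0..2*pi} \<theta> * ennreal (25/4 * R\<^sup>2 * (norm (grad \<psi> (rotate_about p \<theta> x)))\<^sup>2) \<partial>lborel)"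
proof -
  have sm: "smooth \<psi>" by (rule test_function_smooth[OF \<psi>])
  define f where "f \<theta> = \<psi> (rotate_about p \<theta> x)" for \<theta>
  define f' where "f' \<theta> = grad \<psi> (rotate_about p \<theta> x) \<bullet> rot90 (rotate_about p \<theta> x - p)" for \<theta>
  have d: "(f has_real_derivative f' \<theta>) (at \<theta> within S)" for \<theta> S
  proof -
    have "(f has_derivative (\<lambda>r. grad \<psi> (rotate_about p \<theta> x) \<bullet> (r *\<^sub>R rot90 (rotate_about p \<theta> x - p)))) (at \<theta> within S)"
      unfolding f_def
      using has_derivative_compose[OF rotate_about_has_vector_derivative[unfolded has_vector_derivative_def]
          smooth_has_derivative_grad[OF sm]] by simp
    then show ?thesis
      by (simp add: has_field_derivative_def f'_def mult.commute[of _ "_ \<bullet> _"])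
  qed
  have cg: "continuous_on UNIV (grad \<psi>)" by (rule continuous_grad[OF sm])
  have cgr: "continuous_on S (\<lambda>\<theta>. grad \<psi> (rotate_about p \<theta> x))" for S
    by (rule continuous_on_compose2[OF cg]) (auto intro!: continuous_intros)
  have cf': "continuous_on S f'" for S
    unfolding f'_def by (intro continuous_intros cgr bounded_linear.continuous_on[OF bounded_linear_rot90])
  have cf: "continuous_on S f" for S
    using d by (meson DERIV_continuous_on)
  obtain t0 where t0: "t0 \<in> {0..2*pi}" "rotate_about p t0 x \<notin> \<Omega>"
    using circle_leaves_simply_connected[OF sc p] by blast
  have "(2/5)\<^sup>2 * integral {0..2*pi} (\<lambda>t. (f t)\<^sup>2) \<le> integral {0..2*pi} (\<lambda>t. (f' t)\<^sup>2)"
  proof (rule wirtinger_periodic_zero[of _ t0])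
    show "f t0 = 0" using test_function_outside[OF \<psi> t0(2)] by (simp add: f_def)
    show "f 0 = f (2*pi)" by (simp add: f_def rotate_about_def)
  qed (use t0 d cf' in auto)
  also have "\<dots> \<le> integral {0..2*pi} (\<lambda>t. R\<^sup>2 * (norm (grad \<psi> (rotate_about p t x)))\<^sup>2)"
  proof (rule integral_le)
    show "(f' t)\<^sup>2 \<le> R\<^sup>2 * (norm (grad \<psi> (rotate_about p t x)))\<^sup>2" for t
    proof -
      have "\<bar>f' t\<bar> \<le> norm (grad \<psi> (rotate_about p t x)) * norm (x - p)"
        using Cauchy_Schwarz_ineq2[of "grad \<psi> (rotate_about p t x)" "rot90 (rotate_about p t x - p)"]
        by (simp add: f'_def dist_rotate_about)
      also have "\<dots> \<le> norm (grad \<psi> (rotate_about p t x)) * R"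
        using x by (intro mult_left_mono) auto
      finally have "\<bar>f' t\<bar>\<^sup>2 \<le> (norm (grad \<psi> (rotate_about p t x)) * R)\<^sup>2"
        by (intro power_mono) auto
      then show ?thesis by (simp add: power_mult_distrib mult.commute)
    qed
  qed (intro integrable_continuous_interval continuous_intros cf' cgr)+
  also have "\<dots> = (2/5)\<^sup>2 * integral {0..2*pi} (\<lambda>t. 25/4 * R\<^sup>2 * (norm (grad \<psi> (rotate_about p t x)))\<^sup>2)"
    by (simp add: power2_eq_square)
  finally have le: "integral {0..2*pi} (\<lambda>t. (f t)\<^sup>2) \<le> integral {0..2*pi} (\<lambda>t. 25/4 * R\<^sup>2 * (norm (grad \<psi> (rotate_about p t x)))\<^sup>2)"
    by simp
  have "(\<integral>\<^sup>+\<theta>. indicator {0..2*pi} \<theta> * ennreal ((f \<theta>)\<^sup>2) \<partial>lborel) = ennreal (integral {0..2*pi} (\<lambda>t. (f t)\<^sup>2))"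
    by (rule nn_integral_interval_continuous) (auto intro!: continuous_intros cf)
  also have "\<dots> \<le> ennreal (integral {0..2*pi} (\<lambda>t. 25/4 * R\<^sup>2 * (norm (grad \<psi> (rotate_about p t x)))\<^sup>2))"
    by (rule ennreal_leI[OF le])
  also have "\<dots> = (\<integral>\<^sup>+\<theta>. indicator {0..2*pi} \<theta> * ennreal (25/4 * R\<^sup>2 * (norm (grad \<psi> (rotate_about p \<theta> x)))\<^sup>2) \<partial>lborel)"
    by (rule nn_integral_interval_continuous[symmetric]) (auto intro!: continuous_intros cgr)
  finally show ?thesis by (simp add: f_def)
qed

text \<open>A substitute for polar coordinates: the disc is invariant under every rotation about
  \<open>p\<close>, so averaging over the angle and exchanging the integrals turns a disc integral
  into integrals over circles.\<close>

lemma nn_integral_circle_average: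
  fixes F :: "real^2 \<Rightarrow> real"
  assumes F: "continuous_on UNIV F"
  shows "ennreal (2 * pi) * (\<integral>\<^sup>+x. indicator (cball p R) x * ennreal (F x) \<partial>lborel)
    = (\<integral>\<^sup>+x. indicator (cball p R) x * (\<integral>\<^sup>+\<theta>. indicator {0..2*pi} \<theta> * ennreal (F (rotate_about p \<theta> x)) \<partial>lborel) \<partial>lborel)"
proof -
  let ?G = "\<lambda>x. indicator (cball p R) x * ennreal (F x)"
  have Fm[measurable]: "F \<in> borel_measurable borel" by (rule borel_measurable_continuous_onI[OF F])
  have Gm: "?G \<in> borel_measurable borel"
    by (intro borel_measurable_times_ennreal borel_measurable_indicator measurable_compose[OF Fm measurable_ennreal])
       (simp add: borel_closed)
  have ind: "indicator (cball p R) (rotate_about p \<theta> x) = (indicator (cball p R) x :: ennreal)" for \<theta> x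
    using dist_rotate_about[of p \<theta> x] by (simp add: indicator_def dist_norm norm_minus_commute)
  have rm: "(\<lambda>z. rotate_about p (fst z) (snd z)) \<in> borel_measurable (borel \<Otimes>\<^sub>M borel)"
    unfolding borel_prod by (intro borel_measurable_continuous_onI continuous_intros)
  have "case_prod (\<lambda>\<theta> x. indicator {0..2*pi} \<theta> * ?G (rotate_about p \<theta> x)) \<in> borel_measurable (borel \<Otimes>\<^sub>M borel)"
  proof -
    have "(\<lambda>z. F (rotate_about p (fst z) (snd z))) \<in> borel_measurable (borel \<Otimes>\<^sub>M borel)"
      by (rule measurable_compose[OF rm Fm])
    moreover have "(\<lambda>z. indicator (cball p R) (rotate_about p (fst z) (snd z)) :: ennreal) \<in> borel_measurable (borel \<Otimes>\<^sub>M borel)"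
      by (rule measurable_compose[OF rm borel_measurable_indicator]) (simp add: borel_closed)
    ultimately show ?thesis unfolding case_prod_beta by measurable
  qed
  then have meas: "case_prod (\<lambda>\<theta> x. indicator {0..2*pi} \<theta> * ?G (rotate_about p \<theta> x)) \<in> borel_measurable (lborel \<Otimes>\<^sub>M lborel)"
    by (simp cong: measurable_cong_sets)
  have "ennreal (2 * pi) * (\<integral>\<^sup>+x. ?G x \<partial>lborel) = (\<integral>\<^sup>+\<theta>. indicator {0..2*pi} \<theta> * (\<integral>\<^sup>+x. ?G x \<partial>lborel) \<partial>(lborel::real measure))"
    by (subst nn_integral_multc) (auto simp: emeasure_lborel_Icc)
  also have "\<dots> = (\<integral>\<^sup>+\<theta>. indicator {0..2*pi} \<theta> * (\<integral>\<^sup>+x. ?G (rotate_about p \<theta> x) \<partial>lborel) \<partial>lborel)"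
  proof (rule nn_integral_cong)
    fix \<theta>
    have "(\<integral>\<^sup>+x. ?G (rotate_about p \<theta> x) \<partial>lborel) = (\<integral>\<^sup>+x. ?G x \<partial>lborel)"
      by (rule nn_integral_rotate_about[OF Gm])
    then show "indicator {0..2*pi} \<theta> * (\<integral>\<^sup>+x. ?G x \<partial>lborel) = indicator {0..2*pi} \<theta> * (\<integral>\<^sup>+x. ?G (rotate_about p \<theta> x) \<partial>lborel)"
      by simp
  qed
  also have "\<dots> = (\<integral>\<^sup>+\<theta>. (\<integral>\<^sup>+x. indicator {0..2*pi} \<theta> * ?G (rotate_about p \<theta> x) \<partial>lborel) \<partial>lborel)"
  proof (intro nn_integral_cong nn_integral_cmult[symmetric])
    fix \<theta> :: real
    have "rotate_about p \<theta> \<in> borel_measurable borel"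
      using borel_measurable_continuous_onI[OF continuous_on_rotate_about[OF continuous_on_const continuous_on_id], of p \<theta>]
      by simp
    from measurable_compose[OF this Gm] show "(\<lambda>x. ?G (rotate_about p \<theta> x)) \<in> borel_measurable lborel"
      by (simp add: measurable_lborel1)
  qed
  also have "\<dots> = (\<integral>\<^sup>+x. (\<integral>\<^sup>+\<theta>. indicator {0..2*pi} \<theta> * ?G (rotate_about p \<theta> x) \<partial>lborel) \<partial>lborel)"
    by (rule lborel_pair.Fubini'[symmetric, of "\<lambda>\<theta> x. indicator {0..2*pi} \<theta> * ?G (rotate_about p \<theta> x)"])
       (rule meas)
  also have "\<dots> = (\<integral>\<^sup>+x. indicator (cball p R) x * (\<integral>\<^sup>+\<theta>. indicator {0..2*pi} \<theta> * ennreal (F (rotate_about p \<theta> x)) \<partial>lborel) \<partial>lborel)"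
    unfolding ind by (intro nn_integral_cong) (auto simp: indicator_def)
  finally show ?thesis .
qed

text \<open>The circle inequality integrated over the starting point; the factor 2 pi from the
  averaging cancels.\<close>

lemma poincare_cball:
  fixes \<Omega> :: "(real^2) set"
  assumes sc: "simply_connected \<Omega>" and p: "p \<notin> \<Omega>" and \<psi>: "test_function \<Omega> \<psi>"
  shows "(\<integral>\<^sup>+x. indicator (cball p R) x * ennreal ((\<psi> x)\<^sup>2) \<partial>lborel)
    \<le> ennreal (25/4 * R\<^sup>2) * (\<integral>\<^sup>+x. indicator (cball p R) x * ennreal ((norm (grad \<psi> x))\<^sup>2) \<partial>lborel)"
proof -
  let ?I = "\<lambda>F. \<integral>\<^sup>+x. indicator (cball p R) x * ennreal (F x) \<partial>lborel"
  have sm: "smooth \<psi>" by (rule test_function_smooth[OF \<psi>])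
  let ?F = "\<lambda>x. 25/4 * R\<^sup>2 * (norm (grad \<psi> x))\<^sup>2"
  have c: "continuous_on UNIV (\<lambda>x. (\<psi> x)\<^sup>2)" "continuous_on UNIV (\<lambda>x. (norm (grad \<psi> x))\<^sup>2)" "continuous_on UNIV ?F"
    by (intro continuous_intros smooth_continuous_on continuous_grad sm)+
  have "ennreal (2 * pi) * ?I (\<lambda>x. (\<psi> x)\<^sup>2) \<le> ennreal (2 * pi) * ?I ?F"
    unfolding nn_integral_circle_average[OF c(1)] nn_integral_circle_average[OF c(3)]
  proof (rule nn_integral_mono)
    fix x
    show "indicator (cball p R) x * (\<integral>\<^sup>+\<theta>. indicator {0..2*pi} \<theta> * ennreal ((\<psi> (rotate_about p \<theta> x))\<^sup>2) \<partial>lborel)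
      \<le> indicator (cball p R) x * (\<integral>\<^sup>+\<theta>. indicator {0..2*pi} \<theta> * ennreal (?F (rotate_about p \<theta> x)) \<partial>lborel)"
      using poincare_circle[OF sc p \<psi>, of x R]
      by (cases "x \<in> cball p R") (auto simp: dist_norm norm_minus_commute)
  qed
  then have "?I (\<lambda>x. (\<psi> x)\<^sup>2) \<le> ?I ?F"
    by (subst (asm) ennreal_mult_le_mult_iff) auto
  also have "?I ?F = (\<integral>\<^sup>+x. ennreal (25/4 * R\<^sup>2) * (indicator (cball p R) x * ennreal ((norm (grad \<psi> x))\<^sup>2)) \<partial>lborel)"
    by (intro nn_integral_cong) (auto simp: indicator_def simp flip: ennreal_mult')
  also have "\<dots> = ennreal (25/4 * R\<^sup>2) * ?I (\<lambda>x. (norm (grad \<psi> x))\<^sup>2)"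
    by (intro nn_integral_cmult borel_measurable_times_ennreal borel_measurable_indicator
        measurable_compose[OF _ measurable_ennreal])
       (use borel_measurable_continuous_onI[OF c(2)] in \<open>auto simp: borel_closed\<close>)
  finally show ?thesis .
qed

section \<open>Boundary cells of a square grid\<close>

definition grid_index :: "real \<Rightarrow> real^2 \<Rightarrow> int \<times> int" where
  "grid_index s x = (\<lfloor>x $ 1 / s\<rfloor>, \<lfloor>x $ 2 / s\<rfloor>)"

text \<open>As fibres of \<open>grid_index\<close> the cells are half-open and partition the plane
  exactly.\<close>

definition grid_cell :: "real \<Rightarrow> int \<times> int \<Rightarrow> (real^2) set" where
  "grid_cell s k = {x. grid_index s x = k}"

definition grid_point :: "real \<Rightarrow> real \<Rightarrow> real \<Rightarrow> real^2" where
  "grid_point s a b = vector [s * a, s * b]"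

lemma grid_point_nth [simp]: "grid_point s a b $ 1 = s * a" "grid_point s a b $ 2 = s * b"
  by (simp_all add: grid_point_def)

lemma mem_grid_cell:
  assumes "s > 0"
  shows "x \<in> grid_cell s k \<longleftrightarrow> s * fst k \<le> x $ 1 \<and> x $ 1 < s * (fst k + 1) \<and> s * snd k \<le> x $ 2 \<and> x $ 2 < s * (snd k + 1)"
  using assms by (cases k) (auto simp: grid_cell_def grid_index_def floor_eq_iff field_simps)

lemma mem_box_vec2: "x \<in> box a b \<longleftrightarrow> a $ 1 < x $ 1 \<and> x $ 1 < b $ 1 \<and> a $ 2 < x $ 2 \<and> x $ 2 < b $ (2::2)"
  and mem_cbox_vec2: "x \<in> cbox a b \<longleftrightarrow> a $ 1 \<le> x $ 1 \<and> x $ 1 \<le> b $ 1 \<and> a $ 2 \<le> x $ 2 \<and> x $ 2 \<le> b $ (2::2)"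
  for a b x :: "real^2"
  by (auto simp: mem_box_cart forall_2)

lemma measure_cbox_vec2:
  fixes a b :: "real^2"
  assumes "a $ 1 \<le> b $ 1" "a $ 2 \<le> b $ 2"
  shows "measure lborel (cbox a b) = (b $ 1 - a $ 1) * (b $ 2 - a $ 2)"
    and "measure lborel (box a b) = (b $ 1 - a $ 1) * (b $ 2 - a $ 2)"
  using assms
  by (auto simp: measure_lborel_cbox_eq measure_lborel_box_eq Basis_vec_def axis_eq_axis inner_axis forall_2
      prod.UNION_disjoint UNIV_2 inner_diff_left)

lemma grid_cell_borel:
  assumes s: "s > 0"
  shows "grid_cell s k \<in> sets borel"
proof -
  have "{x::real^2. a \<le> x $ i} \<in> sets borel" "{x::real^2. x $ i < a} \<in> sets borel" for a i
    by (auto intro: borel_closed borel_open closed_halfspace_component_ge_cart open_halfspace_component_lt_cart)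
  then have "{x. s * fst k \<le> x $ 1} \<inter> {x. x $ 1 < s * (fst k + 1)} \<inter> {x. s * snd k \<le> x $ 2} \<inter> {x::real^2. x $ 2 < s * (snd k + 1)} \<in> sets borel"
    by (intro sets.Int)
  also have "{x. s * fst k \<le> x $ 1} \<inter> {x. x $ 1 < s * (fst k + 1)} \<inter> {x. s * snd k \<le> x $ 2} \<inter> {x::real^2. x $ 2 < s * (snd k + 1)} = grid_cell s k"
    by (auto simp: mem_grid_cell[OF s])
  finally show ?thesis .
qed

lemma emeasure_grid_cell:
  assumes s: "s > 0"
  shows "emeasure lborel (grid_cell s k) = ennreal (s\<^sup>2)"
proof -
  let ?a = "grid_point s (fst k) (snd k)" and ?b = "grid_point s (fst k + 1) (snd k + 1)"
  have "box ?a ?b \<subseteq> grid_cell s k" "grid_cell s k \<subseteq> cbox ?a ?b"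
    by (auto simp: mem_box_vec2 mem_cbox_vec2 mem_grid_cell[OF s])
  moreover have "emeasure lborel (box ?a ?b) = ennreal (s\<^sup>2)" "emeasure lborel (cbox ?a ?b) = ennreal (s\<^sup>2)"
    using measure_cbox_vec2[of ?a ?b] s
      emeasure_eq_ennreal_measure[of lborel "box ?a ?b"] emeasure_lborel_box_finite[of ?a ?b]
      emeasure_eq_ennreal_measure[of lborel "cbox ?a ?b"] emeasure_lborel_cbox_finite[of ?a ?b]
    by (simp_all add: algebra_simps power2_eq_square)
  moreover have "grid_cell s k \<in> sets lborel" "cbox ?a ?b \<in> sets lborel"
    using grid_cell_borel[OF s] by simp_all
  ultimately show ?thesis
    using emeasure_mono[of "box ?a ?b" "grid_cell s k" lborel] emeasure_mono[of "grid_cell s k" "cbox ?a ?b" lborel]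
    by (intro antisym) simp_all
qed

lemma dist_grid_cell:
  assumes s: "s > 0" and x: "x \<in> grid_cell s k" and y: "y \<in> grid_cell s k"
  shows "dist x y \<le> sqrt 2 * s"
proof -
  have "\<bar>x $ 1 - y $ 1\<bar> \<le> s" "\<bar>x $ 2 - y $ 2\<bar> \<le> s"
    using x y unfolding mem_grid_cell[OF s] of_int_add of_int_1 distrib_left mult_1_right abs_le_iff
    by auto
  note le = this
  have "(x $ 1 - y $ 1)\<^sup>2 \<le> s\<^sup>2" "(x $ 2 - y $ 2)\<^sup>2 \<le> s\<^sup>2"
    using power_mono[OF le(1), of 2] power_mono[OF le(2), of 2] by simp_all
  moreover have "(dist x y)\<^sup>2 = (x $ 1 - y $ 1)\<^sup>2 + (x $ 2 - y $ 2)\<^sup>2"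
    unfolding dist_vec_def L2_set_def sum_2 dist_real_def by simp
  moreover have "(sqrt 2 * s)\<^sup>2 = 2 * s\<^sup>2" by (simp add: power_mult_distrib)
  ultimately have "(dist x y)\<^sup>2 \<le> (sqrt 2 * s)\<^sup>2" by linarith
  then show ?thesis by (rule power2_le_imp_le) (use s in simp)
qed

text \<open>Because sqrt 2 < 2, the cell indices of \<open>p\<close> and \<open>y\<close> differ by
  at most 2 in each coordinate. Hence at most 5 * 5 = 25 of the discs used below contain a given
  \<open>y\<close>.\<close>

lemma grid_overlap:
  assumes s: "s > 0" and p: "p \<in> grid_cell s k" and y: "dist p y \<le> sqrt 2 * s"
  shows "k \<in> {fst (grid_index s y) - 2..fst (grid_index s y) + 2} \<times> {snd (grid_index s y) - 2..snd (grid_index s y) + 2}"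
proof -
  have "sqrt 2 < 2" using real_sqrt_less_mono[of 2 4] by simp
  then have "sqrt 2 * s < 2 * s" using s by simp
  then have "dist p y < 2 * s" using y by linarith
  moreover have "\<bar>p $ i - y $ i\<bar> \<le> dist p y" for i
    using component_le_norm_cart[of "p - y" i] by (simp add: dist_norm)
  ultimately have *: "\<bar>p $ i - y $ i\<bar> < 2 * s" for i by (meson le_less_trans)
  have "\<bar>p $ i / s - y $ i / s\<bar> < 2" for i
  proof -
    have "\<bar>p $ i / s - y $ i / s\<bar> = \<bar>p $ i - y $ i\<bar> / s" using s by (simp flip: diff_divide_distrib)
    then show ?thesis using *[of i] s by (simp add: field_simps)
  qed
  from this[of 1] this[of 2] have "\<bar>\<lfloor>p $ 1 / s\<rfloor> - \<lfloor>y $ 1 / s\<rfloor>\<bar> \<le> 2" "\<bar>\<lfloor>p $ 2 / s\<rfloor> - \<lfloor>y $ 2 / s\<rfloor>\<bar> \<le> 2"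
    by linarith+
  moreover have "k = (\<lfloor>p $ 1 / s\<rfloor>, \<lfloor>p $ 2 / s\<rfloor>)" using p by (simp add: grid_cell_def grid_index_def)
  ultimately show ?thesis by (auto simp: grid_index_def)
qed

text \<open>Cells disjoint from \<open>\<Omega>\<close> are included; they contribute nothing, since
  the functions concerned vanish outside \<open>\<Omega>\<close> or are integrated over
  \<open>\<Omega>\<close> only.\<close>

definition boundary_cells :: "real \<Rightarrow> (real^2) set \<Rightarrow> (real^2) set" where
  "boundary_cells s \<Omega> = {x. \<not> grid_cell s (grid_index s x) \<subseteq> \<Omega>}"

lemma boundary_cells_eq: "boundary_cells s \<Omega> = (\<Union>k\<in>{k. \<not> grid_cell s k \<subseteq> \<Omega>}. grid_cell s k)"
  by (auto simp: boundary_cells_def grid_cell_def)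

lemma boundary_cells_borel: "s > 0 \<Longrightarrow> boundary_cells s \<Omega> \<in> sets borel"
  unfolding boundary_cells_eq by (intro sets.countable_UN') (auto intro: grid_cell_borel)

lemma finite_grid_index_image:
  assumes s: "s > 0" and K: "bounded K"
  shows "finite (grid_index s ` K)"
proof -
  obtain B where B: "\<And>x. x \<in> K \<Longrightarrow> norm x \<le> B" using K by (auto simp: bounded_iff)
  have "grid_index s x \<in> {\<lfloor>- B / s\<rfloor>..\<lfloor>B / s\<rfloor>} \<times> {\<lfloor>- B / s\<rfloor>..\<lfloor>B / s\<rfloor>}" if "x \<in> K" for x
  proof -
    have b: "- B \<le> x $ i" "x $ i \<le> B" for i using component_le_norm_cart[of x i] B[OF that] by linarith+
    have "\<lfloor>- B / s\<rfloor> \<le> \<lfloor>x $ i / s\<rfloor>" "\<lfloor>x $ i / s\<rfloor> \<le> \<lfloor>B / s\<rfloor>" for i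
      by (rule floor_mono[OF divide_right_mono[OF b(1) less_imp_le[OF s]]],
          rule floor_mono[OF divide_right_mono[OF b(2) less_imp_le[OF s]]])
    then show ?thesis by (simp only: grid_index_def mem_Times_iff fst_conv snd_conv atLeastAtMost_iff simp_thms)
  qed
  then have "grid_index s ` K \<subseteq> {\<lfloor>- B / s\<rfloor>..\<lfloor>B / s\<rfloor>} \<times> {\<lfloor>- B / s\<rfloor>..\<lfloor>B / s\<rfloor>}"
    by (rule image_subsetI)
  then show ?thesis by (rule finite_subset) (intro finite_cartesian_product finite_atLeastAtMost_int)
qed

text \<open>A cell not contained in \<open>\<Omega>\<close> has a point outside
  \<open>\<Omega>\<close> and lies in the disc of radius sqrt 2 * s about it. The constant is 25/4
  for a disc, times 2 from the squared radius, times 25 for the overlap of the discs.\<close>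

lemma poincare_boundary_cells:
  assumes sc: "simply_connected \<Omega>" and \<psi>: "test_function \<Omega> \<psi>" and s: "s > 0"
  shows "(\<integral>\<^sup>+x. indicator (boundary_cells s \<Omega>) x * ennreal ((\<psi> x)\<^sup>2) \<partial>lborel)
    \<le> ennreal (625/2 * s\<^sup>2) * (\<integral>\<^sup>+x. ennreal ((norm (grad \<psi> x))\<^sup>2) \<partial>lborel)"
proof -
  obtain K where K: "smooth \<psi>" "compact K" "K \<subseteq> \<Omega>" "\<And>x. x \<notin> K \<Longrightarrow> \<psi> x = 0"
    using test_functionE[OF \<psi>] by blast
  \<comment> \<open>Only cells meeting the compact support matter, which keeps the sum over discs
    finite.\<close>
  define F where "F = {k \<in> grid_index s ` K. \<not> grid_cell s k \<subseteq> \<Omega>}"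
  have F: "finite F"
    using finite_grid_index_image[OF s compact_imp_bounded[OF K(2)]] by (simp add: F_def)
  have "\<forall>k\<in>F. \<exists>p. p \<in> grid_cell s k \<and> p \<notin> \<Omega>" by (auto simp: F_def)
  then obtain p where p: "\<And>k. k \<in> F \<Longrightarrow> p k \<in> grid_cell s k" "\<And>k. k \<in> F \<Longrightarrow> p k \<notin> \<Omega>" by metis
  let ?u = "\<lambda>x. ennreal ((\<psi> x)\<^sup>2)" and ?v = "\<lambda>x. ennreal ((norm (grad \<psi> x))\<^sup>2)"
  let ?R = "sqrt 2 * s"
  have um: "?u \<in> borel_measurable borel" "?v \<in> borel_measurable borel"
    by (intro measurable_compose[OF _ measurable_ennreal] borel_measurable_continuous_onI continuous_intros
        smooth_continuous_on continuous_grad K(1))+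
  have bm: "(indicator (cball q ?R) :: real^2 \<Rightarrow> ennreal) \<in> borel_measurable borel" for q
    by (intro borel_measurable_indicator) (simp add: borel_closed)
  have "(\<integral>\<^sup>+x. indicator (boundary_cells s \<Omega>) x * ?u x \<partial>lborel) \<le> (\<integral>\<^sup>+x. (\<Sum>k\<in>F. indicator (cball (p k) ?R) x * ?u x) \<partial>lborel)"
  proof (rule nn_integral_mono)
    fix x
    show "indicator (boundary_cells s \<Omega>) x * ?u x \<le> (\<Sum>k\<in>F. indicator (cball (p k) ?R) x * ?u x)"
    proof (cases "x \<in> boundary_cells s \<Omega> \<and> x \<in> K")
      case True
      define k where "k = grid_index s x"
      have k: "k \<in> F" using True by (auto simp: F_def k_def boundary_cells_def)
      have "x \<in> cball (p k) ?R"
        using dist_grid_cell[OF s p(1)[OF k], of x] by (simp add: grid_cell_def k_def)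
      then have "indicator (boundary_cells s \<Omega>) x * ?u x = indicator (cball (p k) ?R) x * ?u x"
        using True by simp
      also have "\<dots> \<le> (\<Sum>k\<in>F. indicator (cball (p k) ?R) x * ?u x)"
        by (rule member_le_sum[OF k _ F]) simp
      finally show ?thesis .
    qed (use K(4) in auto)
  qed
  also have "\<dots> = (\<Sum>k\<in>F. \<integral>\<^sup>+x. indicator (cball (p k) ?R) x * ?u x \<partial>lborel)"
    by (rule nn_integral_sum) (use um bm in \<open>auto intro!: borel_measurable_times_ennreal\<close>)
  also have "\<dots> \<le> (\<Sum>k\<in>F. ennreal (25/4 * ?R\<^sup>2) * (\<integral>\<^sup>+x. indicator (cball (p k) ?R) x * ?v x \<partial>lborel))"
    by (rule sum_mono) (rule poincare_cball[OF sc p(2) \<psi>])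
  also have "\<dots> = ennreal (25/2 * s\<^sup>2) * (\<Sum>k\<in>F. \<integral>\<^sup>+x. indicator (cball (p k) ?R) x * ?v x \<partial>lborel)"
    by (simp add: sum_distrib_left power_mult_distrib)
  finally have A: "(\<integral>\<^sup>+x. indicator (boundary_cells s \<Omega>) x * ?u x \<partial>lborel)
    \<le> ennreal (25/2 * s\<^sup>2) * (\<Sum>k\<in>F. \<integral>\<^sup>+x. indicator (cball (p k) ?R) x * ?v x \<partial>lborel)" .
  have "(\<Sum>k\<in>F. \<integral>\<^sup>+x. indicator (cball (p k) ?R) x * ?v x \<partial>lborel) = (\<integral>\<^sup>+x. (\<Sum>k\<in>F. indicator (cball (p k) ?R) x * ?v x) \<partial>lborel)"
    by (rule nn_integral_sum[symmetric]) (use um bm in \<open>auto intro!: borel_measurable_times_ennreal\<close>)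
  also have "\<dots> \<le> (\<integral>\<^sup>+x. 25 * ?v x \<partial>lborel)"
  proof (rule nn_integral_mono)
    fix y
    define Q where "Q = {fst (grid_index s y) - 2..fst (grid_index s y) + 2} \<times> {snd (grid_index s y) - 2..snd (grid_index s y) + 2}"
    have "(\<Sum>k\<in>F. indicator (cball (p k) ?R) y * ?v y) \<le> (\<Sum>k\<in>Q. ?v y)"
    proof -
      have "(\<Sum>k\<in>F. indicator (cball (p k) ?R) y * ?v y) = (\<Sum>k\<in>F \<inter> Q. indicator (cball (p k) ?R) y * ?v y)"
        by (rule sum.mono_neutral_right[OF F])
           (use grid_overlap[OF s p(1), of _ y] in \<open>auto simp: Q_def indicator_def\<close>)
      also have "\<dots> \<le> (\<Sum>k\<in>F \<inter> Q. ?v y)"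
        by (intro sum_mono) (auto simp: indicator_def)
      also have "\<dots> \<le> (\<Sum>k\<in>Q. ?v y)"
        by (intro sum_mono2) (auto simp: Q_def)
      finally show ?thesis .
    qed
    also have "\<dots> = 25 * ?v y" by (simp add: Q_def card_cartesian_product)
    finally show "(\<Sum>k\<in>F. indicator (cball (p k) ?R) y * ?v y) \<le> 25 * ?v y" .
  qed
  also have "\<dots> = 25 * (\<integral>\<^sup>+x. ?v x \<partial>lborel)"
    by (rule nn_integral_cmult) (use um in simp)
  finally have B: "(\<Sum>k\<in>F. \<integral>\<^sup>+x. indicator (cball (p k) ?R) x * ?v x \<partial>lborel) \<le> 25 * (\<integral>\<^sup>+x. ?v x \<partial>lborel)" .
  have "ennreal (25/2 * s\<^sup>2) * (25 * (\<integral>\<^sup>+x. ?v x \<partial>lborel)) = ennreal (625/2 * s\<^sup>2) * (\<integral>\<^sup>+x. ?v x \<partial>lborel)"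
  proof -
    have "ennreal (25/2 * s\<^sup>2) * 25 = ennreal (25/2 * s\<^sup>2) * ennreal 25" by simp
    also have "\<dots> = ennreal (625/2 * s\<^sup>2)" by (subst ennreal_mult[symmetric]) auto
    finally show ?thesis by (simp flip: mult.assoc)
  qed
  then show ?thesis using order_trans[OF A mult_left_mono[OF B zero_le]] by simp
qed

section \<open>Passage of the boundary estimate to \<open>H10\<close>\<close>

lemma ennreal_sqnorm:
  fixes f :: "'a::euclidean_space \<Rightarrow> 'b::euclidean_space"
  assumes "open \<Omega>" "sq_int (lebesgue_on \<Omega>) f" "\<And>x. x \<notin> \<Omega> \<Longrightarrow> f x = 0"
  shows "ennreal (sqnorm (lebesgue_on \<Omega>) f) = (\<integral>\<^sup>+x. ennreal ((norm (f x))\<^sup>2) \<partial>lborel)"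
proof -
  have "ennreal (sqnorm (lebesgue_on \<Omega>) f) = (\<integral>\<^sup>+x. ennreal ((norm (f x))\<^sup>2) \<partial>lebesgue_on \<Omega>)"
    unfolding sqnorm_def by (rule nn_integral_eq_integral[symmetric]) (use sq_int_integrable[OF assms(2)] in auto)
  also have "\<dots> = (\<integral>\<^sup>+x. ennreal ((norm (f x))\<^sup>2) * indicator \<Omega> x \<partial>lebesgue)"
    by (rule nn_integral_restrict_space) (use assms(1) in auto)
  also have "\<dots> = (\<integral>\<^sup>+x. ennreal ((norm (f x))\<^sup>2) \<partial>lebesgue)"
    by (intro nn_integral_cong) (auto simp: indicator_def assms(3))
  also have "\<dots> = (\<integral>\<^sup>+x. ennreal ((norm (f x))\<^sup>2) \<partial>lborel)"
    by (rule nn_integral_completion)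
  finally show ?thesis .
qed

lemma indicator_measurable_lebesgue_on:
  "A \<in> sets borel \<Longrightarrow> indicator A \<in> borel_measurable (lebesgue_on \<Omega>)"
  by (intro measurable_restrict_space1 borel_measurable_indicator) simp

lemma sq_int_indicator:
  assumes f: "sq_int (lebesgue_on \<Omega>) f" and A: "A \<in> sets borel"
  shows "sq_int (lebesgue_on \<Omega>) (\<lambda>x. indicator A x *\<^sub>R f x)"
    and "sqnorm (lebesgue_on \<Omega>) (\<lambda>x. indicator A x *\<^sub>R f x) \<le> sqnorm (lebesgue_on \<Omega>) f"
proof -
  have m: "(\<lambda>x. indicator A x *\<^sub>R f x) \<in> borel_measurable (lebesgue_on \<Omega>)"
    by (intro borel_measurable_scaleR indicator_measurable_lebesgue_on A sq_int_measurable f)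
  have le: "(norm (indicator A x *\<^sub>R f x))\<^sup>2 \<le> (norm (f x))\<^sup>2" for x
    by (auto simp: indicator_def)
  have i: "integrable (lebesgue_on \<Omega>) (\<lambda>x. (norm (indicator A x *\<^sub>R f x))\<^sup>2)"
  proof (rule Bochner_Integration.integrable_bound[OF sq_int_integrable[OF f]])
    show "(\<lambda>x. (norm (indicator A x *\<^sub>R f x))\<^sup>2) \<in> borel_measurable (lebesgue_on \<Omega>)"
      by (intro borel_measurable_power measurable_compose[OF m borel_measurable_norm] measurable_ident_sets refl | simp)+
  qed (use le in auto)
  show "sq_int (lebesgue_on \<Omega>) (\<lambda>x. indicator A x *\<^sub>R f x)"
    using m i by (simp add: sq_int_def)
  show "sqnorm (lebesgue_on \<Omega>) (\<lambda>x. indicator A x *\<^sub>R f x) \<le> sqnorm (lebesgue_on \<Omega>) f"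
    unfolding sqnorm_def by (rule integral_mono[OF i sq_int_integrable[OF f] le])
qed

lemma poincare_boundary_cells_sqnorm:
  assumes \<Omega>: "open \<Omega>" and sc: "simply_connected \<Omega>" and \<psi>: "test_function \<Omega> \<psi>" and s: "s > 0"
  shows "sqnorm (lebesgue_on \<Omega>) (\<lambda>x. indicator (boundary_cells s \<Omega>) x *\<^sub>R \<psi> x)
    \<le> 625/2 * s\<^sup>2 * sqnorm (lebesgue_on \<Omega>) (grad \<psi>)"
proof -
  let ?M = "lebesgue_on \<Omega>" and ?B = "boundary_cells s \<Omega>"
  have sq: "sq_int ?M \<psi>" "sq_int ?M (grad \<psi>)"
    using L2_test_function[OF \<Omega> \<psi>] by (simp_all add: L2_iff)
  have g0: "grad \<psi> x = 0" if "x \<notin> \<Omega>" for x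
  proof -
    obtain K where K: "smooth \<psi>" "compact K" "K \<subseteq> \<Omega>" "\<And>x. x \<notin> K \<Longrightarrow> \<psi> x = 0"
      using test_functionE[OF \<psi>] by blast
    show ?thesis by (rule grad_outside[OF compact_imp_closed[OF K(2)] K(4)]) (use that K(3) in auto)
  qed
  have "ennreal (sqnorm ?M (\<lambda>x. indicator ?B x *\<^sub>R \<psi> x)) = (\<integral>\<^sup>+x. ennreal ((norm (indicator ?B x *\<^sub>R \<psi> x))\<^sup>2) \<partial>lborel)"
    by (rule ennreal_sqnorm[OF \<Omega> sq_int_indicator(1)[OF sq(1) boundary_cells_borel[OF s]]])
       (simp add: test_function_outside[OF \<psi>])
  also have "\<dots> = (\<integral>\<^sup>+x. indicator ?B x * ennreal ((\<psi> x)\<^sup>2) \<partial>lborel)"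
    by (intro nn_integral_cong) (auto simp: indicator_def)
  also have "\<dots> \<le> ennreal (625/2 * s\<^sup>2) * (\<integral>\<^sup>+x. ennreal ((norm (grad \<psi> x))\<^sup>2) \<partial>lborel)"
    by (rule poincare_boundary_cells[OF sc \<psi> s])
  also have "\<dots> = ennreal (625/2 * s\<^sup>2) * ennreal (sqnorm ?M (grad \<psi>))"
    using ennreal_sqnorm[OF \<Omega> sq(2) g0] by simp
  also have "\<dots> = ennreal (625/2 * s\<^sup>2 * sqnorm ?M (grad \<psi>))"
    by (rule ennreal_mult[symmetric]) (auto simp: sqnorm_nonneg)
  finally show ?thesis
    by (subst (asm) ennreal_le_iff) (auto simp: sqnorm_nonneg)
qed

text \<open>Cutting off by an indicator does not increase the L2 norm, so both sides converge along
  approximating test functions.\<close>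

lemma poincare_boundary_cells_H10:
  assumes \<Omega>: "open \<Omega>" and sc: "simply_connected \<Omega>" and u: "u \<in> H10 \<Omega>" and s: "s > 0"
  shows "sqnorm (lebesgue_on \<Omega>) (\<lambda>x. indicator (boundary_cells s \<Omega>) x *\<^sub>R u x)
    \<le> 625/2 * s\<^sup>2 * sqnorm (lebesgue_on \<Omega>) (weak_grad \<Omega> u)"
proof -
  let ?M = "lebesgue_on \<Omega>" and ?B = "boundary_cells s \<Omega>"
  obtain \<phi> where \<phi>: "\<And>n. test_function \<Omega> (\<phi> n)"
    "(\<lambda>n. sqnorm ?M (\<lambda>x. \<phi> n x - u x)) \<longlonglongrightarrow> 0"
    "(\<lambda>n. sqnorm ?M (\<lambda>x. grad (\<phi> n) x - weak_grad \<Omega> u x)) \<longlonglongrightarrow> 0"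
    by (rule H10E[OF u], rule that) blast+
  have sq: "sq_int ?M (\<phi> n)" "sq_int ?M (grad (\<phi> n))" for n
    using L2_test_function[OF \<Omega> \<phi>(1)] by (simp_all add: L2_iff)
  note su = H10_sq_int[OF u]
  note I = sq_int_indicator[OF _ boundary_cells_borel[OF s]]
  have "(\<lambda>n. sqnorm ?M (\<lambda>x. indicator ?B x *\<^sub>R \<phi> n x)) \<longlonglongrightarrow> sqnorm ?M (\<lambda>x. indicator ?B x *\<^sub>R u x)"
  proof (rule tendsto_sqnorm[OF I(1)[OF sq(1)] I(1)[OF su(1)]])
    have "sqnorm ?M (\<lambda>x. indicator ?B x *\<^sub>R \<phi> n x - indicator ?B x *\<^sub>R u x) \<le> sqnorm ?M (\<lambda>x. \<phi> n x - u x)" for n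
      using I(2)[OF sq_int_diff[OF sq(1)[of n] su(1)]] by (simp add: right_diff_distrib)
    then show "(\<lambda>n. sqnorm ?M (\<lambda>x. indicator ?B x *\<^sub>R \<phi> n x - indicator ?B x *\<^sub>R u x)) \<longlonglongrightarrow> 0"
      by (intro tendsto_sandwich[OF _ _ tendsto_const \<phi>(2)] always_eventually allI) (auto simp: sqnorm_nonneg)
  qed
  moreover have "(\<lambda>n. 625/2 * s\<^sup>2 * sqnorm ?M (grad (\<phi> n))) \<longlonglongrightarrow> 625/2 * s\<^sup>2 * sqnorm ?M (weak_grad \<Omega> u)"
    by (intro tendsto_mult_left tendsto_sqnorm[OF sq(2) su(2) \<phi>(3)])
  ultimately show ?thesis
    by (rule LIMSEQ_le) (use poincare_boundary_cells_sqnorm[OF \<Omega> sc \<phi>(1) s] in blast)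
qed

text \<open>For s = |\<open>\<Omega>\<close>| + 1 a cell has area s^2 >= s >
  |\<open>\<Omega>\<close>| and cannot fit into \<open>\<Omega>\<close>, so every cell is a boundary
  cell and the estimate covers the whole domain.\<close>

lemma poincare_finite_measure:
  fixes \<Omega> :: "(real^2) set"
  assumes \<Omega>: "open \<Omega>" and sc: "simply_connected \<Omega>" and fin: "emeasure lebesgue \<Omega> < \<infinity>"
  obtains C where "C \<ge> 0"
    "\<And>\<psi>. test_function \<Omega> \<psi> \<Longrightarrow> sqnorm (lebesgue_on \<Omega>) \<psi> \<le> C * sqnorm (lebesgue_on \<Omega>) (grad \<psi>)"
proof -
  define s where "s = measure lborel \<Omega> + 1"
  have s: "s > 0" by (simp add: s_def add_nonneg_pos)
  have em: "emeasure lborel \<Omega> = ennreal (measure lborel \<Omega>)"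
    using fin \<Omega> by (intro emeasure_eq_ennreal_measure) auto
  have "\<not> grid_cell s k \<subseteq> \<Omega>" for k
  proof
    assume "grid_cell s k \<subseteq> \<Omega>"
    then have "emeasure lborel (grid_cell s k) \<le> emeasure lborel \<Omega>"
      by (rule emeasure_mono) (use \<Omega> in auto)
    then have "s\<^sup>2 \<le> measure lborel \<Omega>"
      unfolding emeasure_grid_cell[OF s] em by (simp add: ennreal_le_iff)
    moreover have "s * 1 \<le> s * s" using s by (intro mult_left_mono) (simp_all add: s_def)
    ultimately show False by (simp add: s_def power2_eq_square)
  qed
  then have "boundary_cells s \<Omega> = UNIV" by (auto simp: boundary_cells_def)
  then show thesis
    using poincare_boundary_cells_sqnorm[OF \<Omega> sc _ s] by (intro that[of "625/2 * s\<^sup>2"]) auto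
qed

section \<open>Oscillation of the torsion function on discs inside the domain\<close>

definition laplacian :: "('a::euclidean_space \<Rightarrow> real) \<Rightarrow> 'a \<Rightarrow> real" where
  "laplacian \<phi> x = (\<Sum>b\<in>Basis. frechet_derivative (\<lambda>y. frechet_derivative \<phi> (at y) b) (at x) b)"

lemma smooth_laplacian: "smooth \<phi> \<Longrightarrow> smooth (laplacian \<phi>)"
  unfolding laplacian_def[abs_def] by (intro smooth_sum smooth_frechet_derivative)

lemma test_function_laplacian:
  assumes "test_function \<Omega> \<phi>"
  shows "test_function \<Omega> (laplacian \<phi>)"
proof -
  have t: "test_function \<Omega> (\<lambda>x. frechet_derivative (\<lambda>y. frechet_derivative \<phi> (at y) b) (at x) b)" for b
    by (intro test_function_frechet_derivative assms)
  have "test_function \<Omega> (\<lambda>x. \<Sum>b\<in>B. frechet_derivative (\<lambda>y. frechet_derivative \<phi> (at y) b) (at x) b)" for B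
  proof (induction B rule: infinite_finite_induct)
    case (insert b B)
    then show ?case using test_function_add[OF t[of b]] by simp
  qed (simp_all add: test_functionI[OF smooth_const compact_empty])
  then show ?thesis unfolding laplacian_def[abs_def] .
qed

text \<open>This allows an arbitrary constant to be subtracted from \<open>w\<close> when it is
  integrated against a Laplacian.\<close>

lemma integral_laplacian_eq_0:
  assumes \<Omega>: "open \<Omega>" and \<phi>: "test_function \<Omega> \<phi>"
  shows "(LINT x|lebesgue_on \<Omega>. laplacian \<phi> x) = 0"
proof -
  let ?D = "\<lambda>b x. frechet_derivative \<phi> (at x) b"
  have i: "integrable lborel (\<lambda>x. frechet_derivative (?D b) (at x) b)"
    and 0: "(LINT x|lborel. frechet_derivative (?D b) (at x) b) = 0" for b
  proof -
    have "test_function \<Omega> (?D b)" by (rule test_function_frechet_derivative[OF \<phi>])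
    then obtain K where K: "smooth (?D b)" "compact K" "K \<subseteq> \<Omega>" "\<And>x. x \<notin> K \<Longrightarrow> ?D b x = 0"
      using test_functionE[of \<Omega> "?D b"] by blast
    show "(LINT x|lborel. frechet_derivative (?D b) (at x) b) = 0"
      by (rule integral_frechet_derivative_eq_0[OF K(1,2,4)])
    show "integrable lborel (\<lambda>x. frechet_derivative (?D b) (at x) b)"
      by (rule integrable_compact_support[OF smooth_continuous_on[OF smooth_frechet_derivative[OF K(1)]] K(2)])
         (simp add: frechet_derivative_eq_0_outside[OF compact_imp_closed[OF K(2)] K(4)])
  qed
  have "(LINT x|lebesgue_on \<Omega>. laplacian \<phi> x) = (LINT x|lborel. laplacian \<phi> x)"
    by (rule integral_lebesgue_on_support[OF \<Omega> smooth_continuous_on[OF smooth_laplacian[OF test_function_smooth[OF \<phi>]]]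
          test_function_outside[OF test_function_laplacian[OF \<phi>]]])
  also have "\<dots> = 0"
    unfolding laplacian_def using i 0 by (subst Bochner_Integration.integral_sum) auto
  finally show ?thesis .
qed

text \<open>Each partial derivative of \<open>\<phi>\<close> is itself a test function; the
  definition of the weak gradient is applied to it and the components are summed.\<close>

lemma integral_grad_inner_weak_grad:
  assumes \<Omega>: "open \<Omega>" and u: "u \<in> H1 \<Omega>" and \<phi>: "test_function \<Omega> \<phi>"
  shows "(LINT x|lebesgue_on \<Omega>. weak_grad \<Omega> u x \<bullet> grad \<phi> x) = - (LINT x|lebesgue_on \<Omega>. u x * laplacian \<phi> x)"
proof -
  let ?M = "lebesgue_on \<Omega>"
  let ?D = "\<lambda>b x. frechet_derivative \<phi> (at x) b"
  have t: "test_function \<Omega> (?D b)" for b by (rule test_function_frechet_derivative[OF \<phi>])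
  have sm: "smooth \<phi>" by (rule test_function_smooth[OF \<phi>])
  have su: "sq_int ?M u" "sq_int ?M (weak_grad \<Omega> u)"
    using u weak_grad_H1[OF u] by (auto simp: H1_def L2_iff)
  have st: "sq_int ?M (?D b)" "sq_int ?M (grad (?D b))" for b
    using L2_test_function[OF \<Omega> t] by (simp_all add: L2_iff)
  have i1: "integrable ?M (\<lambda>x. u x *\<^sub>R grad (?D b) x)" and i2: "integrable ?M (\<lambda>x. ?D b x *\<^sub>R weak_grad \<Omega> u x)" for b
    by (intro integrable_scaleR_sq_int su st)+
  have eq: "(LINT x|?M. ?D b x * (weak_grad \<Omega> u x \<bullet> b)) = - (LINT x|?M. u x * frechet_derivative (?D b) (at x) b)" for b
  proof -
    have "(LINT x|?M. u x *\<^sub>R grad (?D b) x) = - (LINT x|?M. ?D b x *\<^sub>R weak_grad \<Omega> u x)"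
      using weak_grad_H1(2)[OF u] t[of b] unfolding has_weak_gradient_def by blast
    then have "(LINT x|?M. (?D b x *\<^sub>R weak_grad \<Omega> u x) \<bullet> b) = - (LINT x|?M. (u x *\<^sub>R grad (?D b) x) \<bullet> b)"
      unfolding integral_inner_left[OF i1] integral_inner_left[OF i2] by simp
    then show ?thesis by (simp add: grad_inner_smooth[OF smooth_frechet_derivative[OF sm]])
  qed
  have "weak_grad \<Omega> u x \<bullet> grad \<phi> x = (\<Sum>b\<in>Basis. ?D b x * (weak_grad \<Omega> u x \<bullet> b))" for x
    unfolding grad_def by (simp add: inner_sum_right)
  moreover have "u x * laplacian \<phi> x = (\<Sum>b\<in>Basis. u x * frechet_derivative (?D b) (at x) b)" for x
    by (simp add: laplacian_def sum_distrib_left)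
  moreover have "integrable ?M (\<lambda>x. ?D b x * (weak_grad \<Omega> u x \<bullet> b))" for b
    using integrable_inner_left[of b ?M, OF i2[of b]] by simp
  moreover have "integrable ?M (\<lambda>x. u x * frechet_derivative (?D b) (at x) b)" for b
    using integrable_inner_left[of b ?M, OF i1[of b]] by (simp add: grad_inner_smooth[OF smooth_frechet_derivative[OF sm]])
  ultimately show ?thesis
    by (simp add: eq sum_negf)
qed

text \<open>Once both derivatives rest on the test function, the left-hand side is controlled by the
  L2 distance of \<open>w\<close> from the constant \<open>m\<close>.\<close>

lemma torsion_solution_laplacian:
  assumes \<Omega>: "open \<Omega>" and fin: "finite_measure (lebesgue_on \<Omega>)" and w: "torsion_solution \<Omega> w"
    and \<phi>: "test_function \<Omega> \<phi>"
  shows "(LINT x|lebesgue_on \<Omega>. weak_grad \<Omega> w x \<bullet> grad \<phi> x) = (LINT x|lebesgue_on \<Omega>. \<phi> x)"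
    and "(LINT x|lebesgue_on \<Omega>. (w x - m) * laplacian \<phi> x) = - (LINT x|lebesgue_on \<Omega>. \<phi> x)"
proof -
  let ?M = "lebesgue_on \<Omega>"
  have wH: "w \<in> H10 \<Omega>" using w by (simp add: torsion_solution_def)
  note sw = H10_sq_int[OF wH]
  note p = test_function_H10[OF \<Omega> fin \<phi>]
  have sg: "sq_int ?M (grad \<phi>)" "sq_int ?M (weak_grad \<Omega> \<phi>)" "sq_int ?M (laplacian \<phi>)"
    using L2_test_function[OF \<Omega> \<phi>] H10_sq_int[OF p(1)] L2_test_function[OF \<Omega> test_function_laplacian[OF \<phi>]]
    by (simp_all add: L2_iff)
  have "(LINT x|?M. weak_grad \<Omega> w x \<bullet> weak_grad \<Omega> \<phi> x) = (LINT x|?M. \<phi> x)"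
    using w p(1) by (simp add: torsion_solution_def)
  moreover have "(LINT x|?M. weak_grad \<Omega> w x \<bullet> weak_grad \<Omega> \<phi> x) = (LINT x|?M. weak_grad \<Omega> w x \<bullet> grad \<phi> x)"
  proof (rule integral_cong_AE)
    show "AE x in ?M. weak_grad \<Omega> w x \<bullet> weak_grad \<Omega> \<phi> x = weak_grad \<Omega> w x \<bullet> grad \<phi> x"
      using p(2) by eventually_elim simp
  qed (intro borel_measurable_inner sq_int_measurable sw sg)+
  ultimately show 1: "(LINT x|?M. weak_grad \<Omega> w x \<bullet> grad \<phi> x) = (LINT x|?M. \<phi> x)" by simp
  have "w \<in> H1 \<Omega>" using wH by (simp add: H10_def)
  from integral_grad_inner_weak_grad[OF \<Omega> this \<phi>] 1
  have 2: "(LINT x|?M. w x * laplacian \<phi> x) = - (LINT x|?M. \<phi> x)" by simp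
  have i: "integrable ?M (\<lambda>x. w x * laplacian \<phi> x)" "integrable ?M (laplacian \<phi>)"
    using integrable_inner_sq_int[OF sw(1) sg(3)] sq_int_imp_integrable[OF fin sg(3)] by simp_all
  have "(LINT x|?M. (w x - m) * laplacian \<phi> x) = (LINT x|?M. w x * laplacian \<phi> x) - m * (LINT x|?M. laplacian \<phi> x)"
    using i by (simp add: left_diff_distrib)
  then show "(LINT x|?M. (w x - m) * laplacian \<phi> x) = - (LINT x|?M. \<phi> x)"
    using 2 integral_laplacian_eq_0[OF \<Omega> \<phi>] by simp
qed

text \<open>Cauchy-Schwarz localised to \<open>A\<close>, which contains the support of the
  Laplacian: if \<open>w\<close> were too close to \<open>m\<close> there, it could not satisfy the
  equation tested with \<open>\<phi>\<close>.\<close>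

lemma torsion_solution_laplacian_bound:
  assumes \<Omega>: "open \<Omega>" and fin: "finite_measure (lebesgue_on \<Omega>)" and w: "torsion_solution \<Omega> w"
    and \<phi>: "test_function \<Omega> \<phi>" and A: "A \<in> sets borel" "\<And>x. x \<notin> A \<Longrightarrow> laplacian \<phi> x = 0"
  shows "(LINT x|lebesgue_on \<Omega>. \<phi> x)\<^sup>2
    \<le> sqnorm (lebesgue_on \<Omega>) (\<lambda>x. indicator A x *\<^sub>R (w x - m)) * sqnorm (lebesgue_on \<Omega>) (laplacian \<phi>)"
proof -
  let ?M = "lebesgue_on \<Omega>"
  have wH: "w \<in> H10 \<Omega>" using w by (simp add: torsion_solution_def)
  have sw: "sq_int ?M (\<lambda>x. indicator A x *\<^sub>R (w x - m))"
    by (intro sq_int_indicator A sq_int_diff sq_int_const fin H10_sq_int[OF wH])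
  have sl: "sq_int ?M (laplacian \<phi>)"
    using L2_test_function[OF \<Omega> test_function_laplacian[OF \<phi>]] by (simp add: L2_iff)
  have "(indicator A x *\<^sub>R (w x - m)) \<bullet> laplacian \<phi> x = (w x - m) * laplacian \<phi> x" for x
    using A(2)[of x] by (auto simp: indicator_def)
  then have "(LINT x|?M. (indicator A x *\<^sub>R (w x - m)) \<bullet> laplacian \<phi> x) = (LINT x|?M. (w x - m) * laplacian \<phi> x)"
    by (intro Bochner_Integration.integral_cong refl)
  also have "\<dots> = - (LINT x|?M. \<phi> x)"
    by (rule torsion_solution_laplacian(2)[OF \<Omega> fin w \<phi>])
  finally have "(LINT x|?M. (indicator A x *\<^sub>R (w x - m)) \<bullet> laplacian \<phi> x) = - (LINT x|?M. \<phi> x)" .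
  then show ?thesis
    using Cauchy_Schwarz_sq_int[OF sw sl] by simp
qed

text \<open>A smoothing of the clamped plate profile (r^2 - |x - c|^2)^2. That function has constant
  bilaplacian and vanishes on the sphere together with its gradient, so on the ball it is extremal
  for the ratio of the squared integral of \<open>\<phi>\<close> to the integral of its squared
  Laplacian. The factor exp(-e/t) makes it smooth across the sphere.\<close>

definition radial_bump :: "real \<Rightarrow> real \<Rightarrow> 'a::euclidean_space \<Rightarrow> 'a \<Rightarrow> real" where
  "radial_bump e r c x = flat e 0 (monom 1 2) (r\<^sup>2 - (x - c) \<bullet> (x - c))"

text \<open>The profile h(t) = t^2 exp(-e/t) with h' and h''; the indices 0, 2, 4 are the formal
  powers of t in the denominator, which cancel here.\<close>

lemma flat_square:
  "flat e 0 (monom 1 2) t = (if t > 0 then t\<^sup>2 * exp (- e / t) else 0)"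
  "flat e 2 (flat_deriv_poly e 0 (monom 1 2)) t = (if t > 0 then (2 * t + e) * exp (- e / t) else 0)"
  "flat e 4 (flat_deriv_poly e 2 (flat_deriv_poly e 0 (monom 1 2))) t
    = (if t > 0 then (2 + 2 * (e / t) + (e / t)\<^sup>2) * exp (- e / t) else 0)"
  by (simp_all add: flat_def flat_deriv_poly_def poly_monom pderiv_monom pderiv_add pderiv_mult pderiv_smult pderiv_diff
      field_simps power2_eq_square power3_eq_cube eval_nat_numeral)

text \<open>With u = e/t one has h'(t)/t = (2 + u) exp(-u) and h''(t) = (2 + 2u + u^2) exp(-u). Both
  are at most 2 because 1 + u + u^2/2 <= exp u, so the smoothed profile obeys the bounds of t^2
  uniformly in \<open>e\<close>.\<close>

lemma flat_square_bounds:
  assumes e: "e > 0"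
  shows "0 \<le> flat e 2 (flat_deriv_poly e 0 (monom 1 2)) t"
    and "t > 0 \<Longrightarrow> flat e 2 (flat_deriv_poly e 0 (monom 1 2)) t \<le> 2 * t"
    and "0 \<le> flat e 4 (flat_deriv_poly e 2 (flat_deriv_poly e 0 (monom 1 2))) t"
    and "flat e 4 (flat_deriv_poly e 2 (flat_deriv_poly e 0 (monom 1 2))) t \<le> 2"
proof -
  show "0 \<le> flat e 2 (flat_deriv_poly e 0 (monom 1 2)) t"
    and "0 \<le> flat e 4 (flat_deriv_poly e 2 (flat_deriv_poly e 0 (monom 1 2))) t"
    using e by (auto simp: flat_square intro!: mult_nonneg_nonneg add_nonneg_nonneg)
  have *: "(2 + 2 * u + u\<^sup>2) * exp (- u) \<le> 2" "(2 + u) * exp (- u) \<le> 2" if "u \<ge> 0" for u :: real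
  proof -
    have "1 + u + u\<^sup>2 / 2 \<le> exp u" using exp_lower_Taylor_quadratic[OF that] by simp
    then have "2 + 2 * u + u\<^sup>2 \<le> 2 * exp u" "2 + u \<le> 2 * exp u"
      using that zero_le_power2[of u] by linarith+
    then have "(2 + 2 * u + u\<^sup>2) * exp (- u) \<le> 2 * exp u * exp (- u)" "(2 + u) * exp (- u) \<le> 2 * exp u * exp (- u)"
      by (auto intro: mult_right_mono)
    then show "(2 + 2 * u + u\<^sup>2) * exp (- u) \<le> 2" "(2 + u) * exp (- u) \<le> 2"
      by (simp_all add: mult.assoc flip: exp_add)
  qed
  show "flat e 4 (flat_deriv_poly e 2 (flat_deriv_poly e 0 (monom 1 2))) t \<le> 2"
    using *(1)[of "e / t"] e by (simp add: flat_square)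
  show "flat e 2 (flat_deriv_poly e 0 (monom 1 2)) t \<le> 2 * t" if t: "t > 0"
  proof -
    have "flat e 2 (flat_deriv_poly e 0 (monom 1 2)) t = t * ((2 + e / t) * exp (- (e / t)))"
      using t by (simp add: flat_square field_simps)
    also have "\<dots> \<le> t * 2" using *(2)[of "e / t"] t e by (intro mult_left_mono) auto
    finally show ?thesis by simp
  qed
qed

lemma smooth_inner_self: "smooth (\<lambda>x::'a::euclidean_space. (x - c) \<bullet> (x - c))"
proof -
  have "smooth (\<lambda>x::'a. \<Sum>b\<in>Basis. (x \<bullet> b - c \<bullet> b) * (x \<bullet> b - c \<bullet> b))"
    by (intro smooth_sum smooth_mult smooth_diff smooth_inner smooth_const)
  also have "(\<lambda>x::'a. \<Sum>b\<in>Basis. (x \<bullet> b - c \<bullet> b) * (x \<bullet> b - c \<bullet> b)) = (\<lambda>x. (x - c) \<bullet> (x - c))"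
    by (intro ext, subst euclidean_inner) (simp add: inner_diff_left)
  finally show ?thesis .
qed

lemma smooth_radial_bump: "e > 0 \<Longrightarrow> smooth (radial_bump e r c)"
  unfolding radial_bump_def[abs_def]
  by (intro smooth_flat_compose smooth_diff smooth_const smooth_inner_self)

lemma radial_bump_nonneg: "radial_bump e r c x \<ge> 0"
  by (simp add: radial_bump_def flat_square)

lemma mem_cball_inner:
  assumes "r \<ge> 0"
  shows "x \<in> cball c r \<longleftrightarrow> (x - c) \<bullet> (x - c) \<le> r\<^sup>2"
proof -
  have "x \<in> cball c r \<longleftrightarrow> (norm (x - c))\<^sup>2 \<le> r\<^sup>2"
    using assms by (simp add: dist_norm norm_minus_commute[of c x] flip: abs_le_square_iff)
  then show ?thesis by (simp add: power2_norm_eq_inner)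
qed

lemma radial_bump_outside:
  assumes "r \<ge> 0" "x \<notin> cball c r"
  shows "radial_bump e r c x = 0"
proof -
  have "r\<^sup>2 < (x - c) \<bullet> (x - c)" using mem_cball_inner[OF assms(1), of x c] assms(2) by linarith
  then show ?thesis by (simp add: radial_bump_def flat_square)
qed

lemma test_function_radial_bump:
  assumes "e > 0" "r \<ge> 0" "cball c r \<subseteq> \<Omega>"
  shows "test_function \<Omega> (radial_bump e r c)"
  by (rule test_functionI[OF smooth_radial_bump[OF assms(1)] compact_cball assms(3) radial_bump_outside[OF assms(2)]])

lemma has_derivative_flat_radial:
  assumes e: "e > 0"
  shows "((\<lambda>x. flat e n q (r\<^sup>2 - (x - c) \<bullet> (x - c))) has_derivative
    (\<lambda>v. flat e (n + 2) (flat_deriv_poly e n q) (r\<^sup>2 - (x - c) \<bullet> (x - c)) * (- 2 * ((x - c) \<bullet> v)))) (at x)"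
proof -
  have "((\<lambda>x. r\<^sup>2 - (x - c) \<bullet> (x - c)) has_derivative (\<lambda>v. - 2 * ((x - c) \<bullet> v))) (at x)"
    by (auto intro!: derivative_eq_intros simp: inner_commute)
  from has_derivative_compose[OF this flat_has_real_derivative[OF e, of n q, unfolded has_field_derivative_def]]
  show ?thesis by simp
qed

text \<open>The chain rule h''(\<open>\<rho>\<close>) |grad \<open>\<rho>\<close>|^2 +
  h'(\<open>\<rho>\<close>) Laplacian(\<open>\<rho>\<close>), where \<open>\<rho>\<close> has
  gradient -2(x - c) and Laplacian -2 times the dimension.\<close>

lemma laplacian_radial_bump:
  fixes c x :: "'a::euclidean_space" and r :: real
  assumes e: "e > 0"
  defines "\<rho> \<equiv> (\<lambda>x::'a::euclidean_space. r\<^sup>2 - (x - c) \<bullet> (x - c))"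
  shows "laplacian (radial_bump e r c) x
    = 4 * flat e 4 (flat_deriv_poly e 2 (flat_deriv_poly e 0 (monom 1 2))) (\<rho> x) * ((x - c) \<bullet> (x - c))
      - 2 * DIM('a) * flat e 2 (flat_deriv_poly e 0 (monom 1 2)) (\<rho> x)"
proof -
  let ?h2 = "\<lambda>x. flat e 2 (flat_deriv_poly e 0 (monom 1 2)) (\<rho> x)"
  let ?h3 = "\<lambda>x. flat e 4 (flat_deriv_poly e 2 (flat_deriv_poly e 0 (monom 1 2))) (\<rho> x)"
  have "(radial_bump e r c has_derivative (\<lambda>v. ?h2 y * (- 2 * ((y - c) \<bullet> v)))) (at y)" for y
    using has_derivative_flat_radial[OF e, of 0 "monom 1 2" r c y, unfolded add_0_left]
    by (simp add: radial_bump_def[abs_def] \<rho>_def)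
  then have d1: "frechet_derivative (radial_bump e r c) (at y) b = ?h2 y * (- 2 * ((y - c) \<bullet> b))" for y b
    by (metis frechet_derivative_at)
  have h2: "(?h2 has_derivative (\<lambda>v. ?h3 y * (- 2 * ((y - c) \<bullet> v)))) (at y)" for y
    using has_derivative_flat_radial[OF e, of 2 "flat_deriv_poly e 0 (monom 1 2)" r c y]
    by (simp add: \<rho>_def)
  have l: "((\<lambda>y. - 2 * ((y - c) \<bullet> b)) has_derivative (\<lambda>v. - 2 * (v \<bullet> b))) (at y)" for b y
    by (auto intro!: derivative_eq_intros)
  have d2: "frechet_derivative (\<lambda>y. ?h2 y * (- 2 * ((y - c) \<bullet> b))) (at x) b
      = 4 * ?h3 x * (((x - c) \<bullet> b) * ((x - c) \<bullet> b)) - 2 * ?h2 x" if b: "b \<in> Basis" for b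
  proof -
    have "frechet_derivative (\<lambda>y. ?h2 y * (- 2 * ((y - c) \<bullet> b))) (at x)
       = (\<lambda>v. ?h2 x * (- 2 * (v \<bullet> b)) + ?h3 x * (- 2 * ((x - c) \<bullet> v)) * (- 2 * ((x - c) \<bullet> b)))"
      by (rule frechet_derivative_at[OF has_derivative_mult[OF h2 l], symmetric])
    then show ?thesis using b by (simp add: inner_Basis)
  qed
  have "laplacian (radial_bump e r c) x = (\<Sum>b\<in>Basis. 4 * ?h3 x * (((x - c) \<bullet> b) * ((x - c) \<bullet> b)) - 2 * ?h2 x)"
    unfolding laplacian_def d1 by (rule sum.cong[OF refl d2])
  also have "\<dots> = 4 * ?h3 x * (\<Sum>b\<in>Basis. ((x - c) \<bullet> b) * ((x - c) \<bullet> b)) - 2 * DIM('a) * ?h2 x"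
    by (simp add: sum_subtractf sum_distrib_left)
  also have "(\<Sum>b\<in>Basis. ((x - c) \<bullet> b) * ((x - c) \<bullet> b)) = (x - c) \<bullet> (x - c)"
    by (rule euclidean_inner[symmetric])
  finally show ?thesis .
qed

text \<open>With R = |x - c|^2 the Laplacian is a difference of a term in [0, 8R] and one in
  [0, 8(r^2 - R)], so the larger of the two bounds its absolute value.\<close>

lemma laplacian_radial_bump_bound:
  fixes x c :: "real^2"
  assumes e: "e > 0" and r: "r > 0"
  shows "\<bar>laplacian (radial_bump e r c) x\<bar> \<le> 8 * r\<^sup>2"
    and "x \<notin> cball c r \<Longrightarrow> laplacian (radial_bump e r c) x = 0"
proof -
  define R where "R = (x - c) \<bullet> (x - c)"
  define t where "t = r\<^sup>2 - R"
  define h2 where "h2 = flat e 2 (flat_deriv_poly e 0 (monom 1 2)) t"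
  define h3 where "h3 = flat e 4 (flat_deriv_poly e 2 (flat_deriv_poly e 0 (monom 1 2))) t"
  have L: "laplacian (radial_bump e r c) x = 4 * (h3 * R) - 4 * h2"
    unfolding laplacian_radial_bump[OF e] by (simp add: h2_def h3_def t_def R_def)
  have R: "R \<ge> 0" by (simp add: R_def)
  have 0: "laplacian (radial_bump e r c) x = 0" if "t \<le> 0"
    unfolding L using that by (simp add: h2_def h3_def flat_square)
  have "\<bar>4 * (h3 * R) - 4 * h2\<bar> \<le> 8 * r\<^sup>2" if t: "t > 0"
  proof -
    have "0 \<le> h2" "h2 \<le> 2 * t" "0 \<le> h3" "h3 \<le> 2"
      using flat_square_bounds[OF e, of t] t by (simp_all add: h2_def h3_def)
    moreover have "0 \<le> h3 * R" "h3 * R \<le> 2 * R"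
      using calculation R by (auto intro: mult_right_mono)
    moreover have "\<bar>4 * p - 4 * h\<bar> \<le> 8 * q"
      if "0 \<le> h" "h \<le> 2 * (q - R)" "0 \<le> p" "p \<le> 2 * R" "R \<le> q" "0 \<le> R" for p h q :: real
      using that by (smt (verit))
    ultimately show ?thesis using R t unfolding t_def by simp
  qed
  then show "\<bar>laplacian (radial_bump e r c) x\<bar> \<le> 8 * r\<^sup>2"
    using 0 L by (cases "t > 0") auto
  show "laplacian (radial_bump e r c) x = 0" if "x \<notin> cball c r"
    using mem_cball_inner[of r x c] that r by (intro 0) (simp add: t_def R_def)
qed

text \<open>On the concentric square of side \<open>r\<close> one has t >= r^2/2, hence t^2 >=
  r^4/4, and e = r^2/100 gives exp(-e/t) >= 49/50. The product 1/4 * 49/50 is 49/200, and the square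
  has area r^2.\<close>

lemma integral_radial_bump_ge:
  fixes c :: "real^2"
  assumes \<Omega>: "open \<Omega>" and r: "r > 0" and c: "cball c r \<subseteq> \<Omega>"
  shows "(LINT x|lebesgue_on \<Omega>. radial_bump (r\<^sup>2 / 100) r c x) \<ge> 49/200 * r ^ 6"
proof -
  define e where "e = r\<^sup>2 / 100"
  have e: "e > 0" using r by (simp add: e_def)
  let ?\<phi> = "radial_bump e r c"
  define a where "a = (c + vector [- r/2, - r/2] :: real^2)"
  define b where "b = (c + vector [r/2, r/2] :: real^2)"
  have ab: "a $ 1 = c $ 1 - r/2" "a $ 2 = c $ 2 - r/2" "b $ 1 = c $ 1 + r/2" "b $ 2 = c $ 2 + r/2"
    by (simp_all add: a_def b_def)
  have m: "measure lborel (cbox a b) = r\<^sup>2"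
    using measure_cbox_vec2(1)[of a b] r by (simp add: ab power2_eq_square)
  have lower: "?\<phi> x \<ge> 49/200 * r ^ 4" if x: "x \<in> cbox a b" for x
  proof -
    define R where "R = (x - c) \<bullet> (x - c)"
    define t where "t = r\<^sup>2 - R"
    have "\<bar>x $ 1 - c $ 1\<bar> \<le> r/2" "\<bar>x $ 2 - c $ 2\<bar> \<le> r/2"
      using x unfolding mem_cbox_vec2 ab by linarith+
    from power_mono[OF this(1), of 2] power_mono[OF this(2), of 2]
    have "(x $ 1 - c $ 1)\<^sup>2 \<le> r\<^sup>2 / 4" "(x $ 2 - c $ 2)\<^sup>2 \<le> r\<^sup>2 / 4"
      by (simp_all add: power_divide)
    moreover have "R = (x $ 1 - c $ 1)\<^sup>2 + (x $ 2 - c $ 2)\<^sup>2"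
      by (simp add: R_def inner_vec_def sum_2 power2_eq_square)
    ultimately have t: "t \<ge> r\<^sup>2 / 2" unfolding t_def by linarith
    then have t0: "t > 0" using r by (smt (verit) zero_less_power half_gt_zero)
    have "e / t \<le> 1 / 50" using t t0 unfolding e_def by (simp add: field_simps)
    then have "exp (- e / t) \<ge> 49 / 50"
      using exp_ge_add_one_self[of "- e / t"] by simp
    moreover have "t\<^sup>2 \<ge> (r\<^sup>2 / 2)\<^sup>2" using t by (intro power_mono) auto
    ultimately have "(r\<^sup>2 / 2)\<^sup>2 * (49 / 50) \<le> t\<^sup>2 * exp (- e / t)"
      by (intro mult_mono) auto
    moreover have "(r\<^sup>2 / 2)\<^sup>2 = r ^ 4 / 4" by (simp add: power_divide flip: power_mult)
    ultimately show ?thesis using t0 by (simp add: radial_bump_def flat_square t_def R_def)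
  qed
  have sm: "smooth ?\<phi>" by (rule smooth_radial_bump[OF e])
  have i: "integrable lborel ?\<phi>"
    by (rule integrable_compact_support[OF smooth_continuous_on[OF sm] compact_cball])
       (rule radial_bump_outside, use r in auto)
  have "49/200 * r ^ 6 = (LINT x|lborel. indicator (cbox a b) x * (49/200 * r ^ 4))"
    by (simp add: m flip: power_add)
  also have "\<dots> \<le> (LINT x|lborel. ?\<phi> x)"
  proof (rule integral_mono[OF _ i])
    show "integrable lborel (\<lambda>x. indicator (cbox a b) x * (49/200 * r ^ 4))"
      using emeasure_lborel_cbox_finite[of a b] by (intro integrable_mult_left integrable_real_indicator) auto
    show "indicator (cbox a b) x * (49/200 * r ^ 4) \<le> ?\<phi> x" for x
      using lower[of x] radial_bump_nonneg[of e r c x] by (auto simp: indicator_def)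
  qed
  also have "\<dots> = (LINT x|lebesgue_on \<Omega>. ?\<phi> x)"
    by (rule integral_lebesgue_on_support[symmetric, OF \<Omega> smooth_continuous_on[OF sm]])
       (rule radial_bump_outside, use r c in auto)
  finally show ?thesis by (simp add: e_def)
qed

text \<open>The squared bound (8 r^2)^2 times the area 4 r^2 of the circumscribed square.\<close>

lemma sqnorm_laplacian_radial_bump:
  fixes c :: "real^2"
  assumes \<Omega>: "open \<Omega>" and r: "r > 0" and c: "cball c r \<subseteq> \<Omega>" and e: "e > 0"
  shows "sqnorm (lebesgue_on \<Omega>) (laplacian (radial_bump e r c)) \<le> 256 * r ^ 6"
proof -
  let ?l = "laplacian (radial_bump e r c)"
  define a where "a = (c + vector [- r, - r] :: real^2)"
  define b where "b = (c + vector [r, r] :: real^2)"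
  have ab: "a $ 1 = c $ 1 - r" "a $ 2 = c $ 2 - r" "b $ 1 = c $ 1 + r" "b $ 2 = c $ 2 + r"
    by (simp_all add: a_def b_def)
  have m: "measure lborel (cbox a b) = 4 * r\<^sup>2"
    using measure_cbox_vec2(1)[of a b] r by (simp add: ab power2_eq_square)
  have sub: "cball c r \<subseteq> cbox a b"
  proof
    fix x assume "x \<in> cball c r"
    then have "\<bar>x $ i - c $ i\<bar> \<le> r" for i
      using component_le_norm_cart[of "x - c" i] by (simp add: dist_norm norm_minus_commute)
    from this[of 1] this[of 2] show "x \<in> cbox a b" unfolding mem_cbox_vec2 ab by linarith
  qed
  have tl: "test_function \<Omega> ?l"
    by (intro test_function_laplacian test_function_radial_bump e c) (use r in simp)
  have sl: "sq_int (lebesgue_on \<Omega>) ?l"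
    using L2_test_function[OF \<Omega> tl] by (simp add: L2_iff)
  have "ennreal (sqnorm (lebesgue_on \<Omega>) ?l) = (\<integral>\<^sup>+x. ennreal ((norm (?l x))\<^sup>2) \<partial>lborel)"
    by (rule ennreal_sqnorm[OF \<Omega> sl test_function_outside[OF tl]])
  also have "\<dots> \<le> (\<integral>\<^sup>+x. ennreal (64 * r ^ 4) * indicator (cbox a b) x \<partial>lborel)"
  proof (rule nn_integral_mono)
    fix x
    show "ennreal ((norm (?l x))\<^sup>2) \<le> ennreal (64 * r ^ 4) * indicator (cbox a b) x"
    proof (cases "x \<in> cbox a b")
      case True
      have "(norm (?l x))\<^sup>2 \<le> (8 * r\<^sup>2)\<^sup>2"
        using laplacian_radial_bump_bound(1)[OF e r, of c x] by (intro power_mono) auto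
      also have "\<dots> = 64 * r ^ 4" by (simp add: power_mult_distrib flip: power_mult)
      finally show ?thesis using True by (simp add: ennreal_leI)
    next
      case False
      then have "x \<notin> cball c r" using sub by blast
      then have "?l x = 0" by (rule laplacian_radial_bump_bound(2)[OF e r])
      then show ?thesis by simp
    qed
  qed
  also have "\<dots> = ennreal (64 * r ^ 4) * emeasure lborel (cbox a b)"
    by (rule nn_integral_cmult_indicator) simp
  also have "emeasure lborel (cbox a b) = ennreal (4 * r\<^sup>2)"
    using emeasure_eq_ennreal_measure[of lborel "cbox a b"] emeasure_lborel_cbox_finite[of a b] m by simp
  also have "ennreal (64 * r ^ 4) * ennreal (4 * r\<^sup>2) = ennreal (256 * r ^ 6)"
    by (subst ennreal_mult[symmetric]) (auto simp flip: power_add)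
  finally show ?thesis using r by (subst (asm) ennreal_le_iff) auto
qed

text \<open>The radial bump in the localised Cauchy-Schwarz bound gives (49/200)^2 r^12 <= S * 256
  r^6; the quotient (49/200)^2 / 256, about 0.000234, is rounded down.\<close>

lemma torsion_solution_ball_oscillation:
  fixes c :: "real^2"
  assumes \<Omega>: "open \<Omega>" and fin: "finite_measure (lebesgue_on \<Omega>)" and w: "torsion_solution \<Omega> w"
    and r: "r > 0" and c: "cball c r \<subseteq> \<Omega>" and A: "A \<in> sets borel" "cball c r \<subseteq> A"
  shows "sqnorm (lebesgue_on \<Omega>) (\<lambda>x. indicator A x *\<^sub>R (w x - m)) \<ge> 23/100000 * r ^ 6"
proof -
  define e where "e = r\<^sup>2 / 100"
  have e: "e > 0" using r by (simp add: e_def)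
  let ?\<phi> = "radial_bump e r c"
  define S where "S = sqnorm (lebesgue_on \<Omega>) (\<lambda>x. indicator A x *\<^sub>R (w x - m))"
  have S: "S \<ge> 0" by (simp add: S_def sqnorm_nonneg)
  have \<phi>: "test_function \<Omega> ?\<phi>" by (rule test_function_radial_bump[OF e less_imp_le[OF r] c])
  have "(49/200 * r ^ 6)\<^sup>2 \<le> (LINT x|lebesgue_on \<Omega>. ?\<phi> x)\<^sup>2"
    using integral_radial_bump_ge[OF \<Omega> r c] r by (intro power_mono) (auto simp: e_def)
  also have "\<dots> \<le> S * sqnorm (lebesgue_on \<Omega>) (laplacian ?\<phi>)"
    unfolding S_def
    by (rule torsion_solution_laplacian_bound[OF \<Omega> fin w \<phi> A(1)])
       (rule laplacian_radial_bump_bound(2)[OF e r], use A(2) in auto)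
  also have "\<dots> \<le> S * (256 * r ^ 6)"
    by (rule mult_left_mono[OF sqnorm_laplacian_radial_bump[OF \<Omega> r c e] S])
  finally have "((49/200)\<^sup>2 * r ^ 6) * r ^ 6 \<le> (S * 256) * r ^ 6"
    by (simp add: power_mult_distrib power2_eq_square mult_ac)
  then have "(49/200)\<^sup>2 * r ^ 6 \<le> S * 256"
    using r by (subst (asm) mult_le_cancel_right_pos) auto
  then have "2401/40000 * r ^ 6 \<le> S * 256" by (simp add: power2_eq_square)
  moreover have "r ^ 6 \<ge> 0" using r by simp
  ultimately show ?thesis unfolding S_def[symmetric] by linarith
qed

section \<open>The variance of the torsion function\<close>

lemma sqnorm_indicator_const:
  assumes fin: "finite_measure (lebesgue_on \<Omega>)" and A: "A \<in> sets borel"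
  shows "sqnorm (lebesgue_on \<Omega>) (\<lambda>x. indicator A x *\<^sub>R (c::real)) = c\<^sup>2 * measure (lebesgue_on \<Omega>) (A \<inter> \<Omega>)"
proof -
  have "sqnorm (lebesgue_on \<Omega>) (\<lambda>x. indicator A x *\<^sub>R c) = (LINT x|lebesgue_on \<Omega>. c\<^sup>2 * indicator A x)"
    unfolding sqnorm_def by (intro Bochner_Integration.integral_cong) (auto simp: indicator_def)
  also have "\<dots> = c\<^sup>2 * measure (lebesgue_on \<Omega>) (A \<inter> \<Omega>)" by simp
  finally show ?thesis .
qed

text \<open>A radius slightly below s/2 keeps the closed disc inside the half-open cell.\<close>

lemma cball_subset_grid_cell:
  assumes s: "s > 0"
  shows "cball (grid_point s (real_of_int (fst k) + 1/2) (real_of_int (snd k) + 1/2)) (49/100 * s) \<subseteq> grid_cell s k"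
proof
  fix x assume x: "x \<in> cball (grid_point s (real_of_int (fst k) + 1/2) (real_of_int (snd k) + 1/2)) (49/100 * s)"
  let ?c = "grid_point s (real_of_int (fst k) + 1/2) (real_of_int (snd k) + 1/2)"
  have "\<bar>x $ i - ?c $ i\<bar> \<le> 49/100 * s" for i
    using component_le_norm_cart[of "x - ?c" i] x by (simp add: dist_norm norm_minus_commute)
  from this[of 1] this[of 2]
  have "\<bar>x $ 1 - (s * fst k + s / 2)\<bar> \<le> 49/100 * s" "\<bar>x $ 2 - (s * snd k + s / 2)\<bar> \<le> 49/100 * s"
    by (simp_all add: distrib_left)
  then show "x \<in> grid_cell s k"
    unfolding mem_grid_cell[OF s] of_int_add of_int_1 distrib_left mult_1_right
    using s by (intro conjI; linarith)
qed

lemma sum_sqnorm_grid_cells_le: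
  assumes f: "sq_int (lebesgue_on \<Omega>) f" and G: "finite G" and s: "s > 0"
  shows "(\<Sum>k\<in>G. sqnorm (lebesgue_on \<Omega>) (\<lambda>x. indicator (grid_cell s k) x *\<^sub>R f x)) \<le> sqnorm (lebesgue_on \<Omega>) f"
proof -
  let ?M = "lebesgue_on \<Omega>"
  have i: "integrable ?M (\<lambda>x. (norm (indicator (grid_cell s k) x *\<^sub>R f x))\<^sup>2)" for k
    by (rule sq_int_integrable[OF sq_int_indicator(1)[OF f grid_cell_borel[OF s]]])
  have "(\<Sum>k\<in>G. sqnorm ?M (\<lambda>x. indicator (grid_cell s k) x *\<^sub>R f x))
      = (LINT x|?M. (\<Sum>k\<in>G. (norm (indicator (grid_cell s k) x *\<^sub>R f x))\<^sup>2))"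
    unfolding sqnorm_def by (rule Bochner_Integration.integral_sum[symmetric]) (rule i)
  also have "\<dots> \<le> sqnorm ?M f"
    unfolding sqnorm_def
  proof (rule integral_mono)
    show "integrable ?M (\<lambda>x. \<Sum>k\<in>G. (norm (indicator (grid_cell s k) x *\<^sub>R f x))\<^sup>2)"
      by (rule Bochner_Integration.integrable_sum) (rule i)
    show "integrable ?M (\<lambda>x. (norm (f x))\<^sup>2)" by (rule sq_int_integrable[OF f])
    fix x
    have "(norm (indicator (grid_cell s k) x *\<^sub>R f x))\<^sup>2 = (if k = grid_index s x then (norm (f x))\<^sup>2 else 0)" for k
      by (auto simp: grid_cell_def)
    then show "(\<Sum>k\<in>G. (norm (indicator (grid_cell s k) x *\<^sub>R f x))\<^sup>2) \<le> (norm (f x))\<^sup>2"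
      using G by simp
  qed
  finally show ?thesis .
qed

text \<open>Disjoint cells of equal positive area inside a set of finite measure are finite in
  number, and what they leave of \<open>\<Omega>\<close> is its part in the boundary cells.\<close>

lemma interior_grid_cells:
  assumes \<Omega>: "open \<Omega>" and fin: "emeasure lebesgue \<Omega> < \<infinity>" and s: "s > 0"
  defines "G \<equiv> {k. grid_cell s k \<subseteq> \<Omega>}"
  shows "finite G"
    and "measure (lebesgue_on \<Omega>) (boundary_cells s \<Omega> \<inter> \<Omega>) + real (card G) * s\<^sup>2 = measure lebesgue \<Omega>"
proof -
  have em: "emeasure lborel (\<Union>k\<in>F. grid_cell s k) = ennreal (real (card F) * s\<^sup>2)" if "finite F" for F
  proof -
    have "emeasure lborel (\<Union>k\<in>F. grid_cell s k) = (\<Sum>k\<in>F. emeasure lborel (grid_cell s k))"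
      by (rule sum_emeasure[symmetric])
         (use that grid_cell_borel[OF s] in \<open>auto simp: disjoint_family_on_def grid_cell_def\<close>)
    also have "\<dots> = ennreal (\<Sum>k\<in>F. s\<^sup>2)"
      unfolding emeasure_grid_cell[OF s] by (rule sum_ennreal) simp
    finally show ?thesis by simp
  qed
  have lO: "emeasure lborel \<Omega> = ennreal (measure lborel \<Omega>)"
    using fin \<Omega> by (intro emeasure_eq_ennreal_measure) auto
  have card: "real (card F) * s\<^sup>2 \<le> measure lborel \<Omega>" if F: "finite F" "F \<subseteq> G" for F
  proof -
    have "emeasure lborel (\<Union>k\<in>F. grid_cell s k) \<le> emeasure lborel \<Omega>"
      using F(2) \<Omega> by (intro emeasure_mono) (auto simp: G_def)
    then show ?thesis unfolding em[OF F(1)] lO by (simp add: ennreal_le_iff)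
  qed
  show G: "finite G"
  proof (rule conjunct1[OF finite_if_finite_subsets_card_bdd])
    fix F assume F: "F \<subseteq> G" "finite F"
    have "real (card F) \<le> measure lborel \<Omega> / s\<^sup>2"
      using card[OF F(2,1)] s by (simp add: field_simps)
    then have "real (card F) \<le> real (nat \<lceil>measure lborel \<Omega> / s\<^sup>2\<rceil>)"
      using real_nat_ceiling_ge order_trans by blast
    then show "card F \<le> nat \<lceil>measure lborel \<Omega> / s\<^sup>2\<rceil>" by simp
  qed
  define U where "U = (\<Union>k\<in>G. grid_cell s k)"
  have U: "U \<subseteq> \<Omega>" "U \<in> sets borel"
    using grid_cell_borel[OF s] G by (auto simp: U_def G_def)
  have BU: "boundary_cells s \<Omega> \<inter> \<Omega> = \<Omega> - U"
    by (auto simp: U_def G_def boundary_cells_def grid_cell_def)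
  have mU: "measure lebesgue U = real (card G) * s\<^sup>2"
    using em[OF G] U(2) by (simp add: U_def[symmetric] measure_def)
  have "measure (lebesgue_on \<Omega>) (\<Omega> - U) = measure lebesgue (\<Omega> - U)"
    by (rule measure_restrict_space) (use \<Omega> U in auto)
  also have "\<dots> = measure lebesgue \<Omega> - measure lebesgue U"
  proof (rule measure_Diff)
    show "emeasure lebesgue \<Omega> \<noteq> \<infinity>" using fin by simp
    show "\<Omega> \<in> sets lebesgue" "U \<in> sets lebesgue" using \<Omega> U by auto
  qed (rule U)
  finally show "measure (lebesgue_on \<Omega>) (boundary_cells s \<Omega> \<inter> \<Omega>) + real (card G) * s\<^sup>2 = measure lebesgue \<Omega>"
    by (simp add: BU mU)
qed

text \<open>The equation tested with \<open>w\<close> itself.\<close>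

lemma torsion_solution_energy:
  assumes "torsion_solution \<Omega> w"
  shows "sqnorm (lebesgue_on \<Omega>) (weak_grad \<Omega> w) = (LINT x|lebesgue_on \<Omega>. w x)"
  using assms by (simp add: torsion_solution_def sqnorm_eq_inner)

text \<open>The integral equals the Dirichlet energy. If that were zero, testing with a bump of
  positive integral would be contradictory.\<close>

lemma torsion_solution_integral_pos:
  fixes \<Omega> :: "(real^2) set"
  assumes \<Omega>: "open \<Omega>" "\<Omega> \<noteq> {}" and fin: "finite_measure (lebesgue_on \<Omega>)" and w: "torsion_solution \<Omega> w"
  shows "(LINT x|lebesgue_on \<Omega>. w x) > 0"
proof -
  let ?M = "lebesgue_on \<Omega>"
  obtain c where "c \<in> \<Omega>" using \<Omega>(2) by blast
  then obtain r where r: "r > 0" "cball c r \<subseteq> \<Omega>" using \<Omega>(1) open_contains_cball by blast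
  define \<phi> where "\<phi> = radial_bump (r\<^sup>2 / 100) r c"
  have \<phi>: "test_function \<Omega> \<phi>" unfolding \<phi>_def by (rule test_function_radial_bump) (use r in auto)
  have "(LINT x|?M. \<phi> x) > 0"
  proof -
    have "49/200 * r ^ 6 > 0" using r by simp
    then show ?thesis using integral_radial_bump_ge[OF \<Omega>(1) r] unfolding \<phi>_def by linarith
  qed
  then have "0 < (LINT x|?M. weak_grad \<Omega> w x \<bullet> grad \<phi> x)\<^sup>2"
    using torsion_solution_laplacian(1)[OF \<Omega>(1) fin w \<phi>] by simp
  also have "\<dots> \<le> sqnorm ?M (weak_grad \<Omega> w) * sqnorm ?M (grad \<phi>)"
  proof (rule Cauchy_Schwarz_sq_int)
    show "sq_int ?M (weak_grad \<Omega> w)" using w H10_sq_int by (auto simp: torsion_solution_def)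
    show "sq_int ?M (grad \<phi>)" using L2_test_function[OF \<Omega>(1) \<phi>] by (simp add: L2_iff)
  qed
  finally have "sqnorm ?M (weak_grad \<Omega> w) \<noteq> 0" by auto
  then show ?thesis
    using sqnorm_nonneg[of ?M "weak_grad \<Omega> w"] torsion_solution_energy[OF w] by simp
qed

lemma torsion_solution_variance:
  fixes \<Omega> :: "(real^2) set"
  assumes \<Omega>: "open \<Omega>" and sc: "simply_connected \<Omega>" and fin: "emeasure lebesgue \<Omega> < \<infinity>"
    and fm: "finite_measure (lebesgue_on \<Omega>)" and w: "torsion_solution \<Omega> w"
    and m: "m > 0" "(LINT x|lebesgue_on \<Omega>. w x) = m * measure lebesgue \<Omega>"
  shows "sqnorm (lebesgue_on \<Omega>) (\<lambda>x. w x - m) \<ge> 9 / 10 ^ 13 * (m\<^sup>2 * measure lebesgue \<Omega>)"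
proof -
  let ?M = "lebesgue_on \<Omega>"
  define N where "N = measure lebesgue \<Omega>"
  define V where "V = sqnorm ?M (\<lambda>x. w x - m)"
  \<comment> \<open>Then 625/2 * s^2 = m/4, and with the energy equal to m * N the boundary estimate
    becomes exactly m^2 * N / 4.\<close>
  define s where "s = sqrt (m / 1250)"
  have s: "s > 0" "s\<^sup>2 = m / 1250" using m by (simp_all add: s_def)
  have N: "N \<ge> 0" by (simp add: N_def)
  have V: "V \<ge> 0" by (simp add: V_def sqnorm_nonneg)
  have wH: "w \<in> H10 \<Omega>" using w by (simp add: torsion_solution_def)
  have sw: "sq_int ?M w" by (rule H10_sq_int[OF wH])
  have sd: "sq_int ?M (\<lambda>x. w x - m)" by (intro sq_int_diff sw sq_int_const fm)
  define B where "B = boundary_cells s \<Omega>"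
  have B: "B \<in> sets borel" unfolding B_def by (rule boundary_cells_borel[OF s(1)])
  define b where "b = measure ?M (B \<inter> \<Omega>)"
  define G where "G = {k. grid_cell s k \<subseteq> \<Omega>}"
  have G: "finite G" and bG: "b + real (card G) * s\<^sup>2 = N"
    using interior_grid_cells[OF \<Omega> fin s(1)] by (simp_all add: G_def b_def B_def N_def)
  have "sqnorm ?M (\<lambda>x. indicator B x *\<^sub>R w x) \<le> 625/2 * s\<^sup>2 * sqnorm ?M (weak_grad \<Omega> w)"
    unfolding B_def by (rule poincare_boundary_cells_H10[OF \<Omega> sc wH s(1)])
  also have "\<dots> = m\<^sup>2 * N / 4"
    unfolding s(2) torsion_solution_energy[OF w] m(2) N_def by (simp add: power2_eq_square)
  finally have Bw: "sqnorm ?M (\<lambda>x. indicator B x *\<^sub>R w x) \<le> m\<^sup>2 * N / 4" .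
  have "m\<^sup>2 * b \<le> 2 * sqnorm ?M (\<lambda>x. indicator B x *\<^sub>R w x) + 2 * V"
  proof -
    have iw: "integrable ?M (\<lambda>x. (norm (indicator B x *\<^sub>R w x))\<^sup>2)"
      by (rule sq_int_integrable[OF sq_int_indicator(1)[OF sw B]])
    have id: "integrable ?M (\<lambda>x. (norm (w x - m))\<^sup>2)" by (rule sq_int_integrable[OF sd])
    have "m\<^sup>2 * b = sqnorm ?M (\<lambda>x. indicator B x *\<^sub>R m)"
      unfolding b_def by (rule sqnorm_indicator_const[OF fm B, symmetric])
    also have "\<dots> \<le> (LINT x|?M. 2 * (norm (indicator B x *\<^sub>R w x))\<^sup>2 + 2 * (norm (w x - m))\<^sup>2)"
      unfolding sqnorm_def
    proof (rule integral_mono)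
      show "integrable ?M (\<lambda>x. (norm (indicator B x *\<^sub>R m))\<^sup>2)"
        by (rule sq_int_integrable[OF sq_int_indicator(1)[OF sq_int_const[OF fm] B]])
      show "integrable ?M (\<lambda>x. 2 * (norm (indicator B x *\<^sub>R w x))\<^sup>2 + 2 * (norm (w x - m))\<^sup>2)"
        using iw id by simp
      fix x
      have "m\<^sup>2 \<le> 2 * (w x)\<^sup>2 + 2 * (w x - m)\<^sup>2"
        using zero_le_power2[of "2 * w x - m"] by (simp add: power2_eq_square algebra_simps)
      then show "(norm (indicator B x *\<^sub>R m))\<^sup>2 \<le> 2 * (norm (indicator B x *\<^sub>R w x))\<^sup>2 + 2 * (norm (w x - m))\<^sup>2"
        by (cases "x \<in> B") auto
    qed
    also have "\<dots> = 2 * sqnorm ?M (\<lambda>x. indicator B x *\<^sub>R w x) + 2 * V"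
      unfolding sqnorm_def V_def using iw id by simp
    finally show ?thesis .
  qed
  then have mb: "m\<^sup>2 * b \<le> m\<^sup>2 * N / 2 + 2 * V" using Bw by linarith
  have cells: "real (card G) * (23/100000 * (49/100 * s) ^ 6) \<le> V"
  proof -
    have "real (card G) * (23/100000 * (49/100 * s) ^ 6) = (\<Sum>k\<in>G. 23/100000 * (49/100 * s) ^ 6)" by simp
    also have "\<dots> \<le> (\<Sum>k\<in>G. sqnorm ?M (\<lambda>x. indicator (grid_cell s k) x *\<^sub>R (w x - m)))"
    proof (rule sum_mono)
      fix k assume "k \<in> G"
      then have "cball (grid_point s (real_of_int (fst k) + 1/2) (real_of_int (snd k) + 1/2)) (49/100 * s) \<subseteq> \<Omega>"
        using cball_subset_grid_cell[OF s(1), of k] by (auto simp: G_def)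
      then show "23/100000 * (49/100 * s) ^ 6 \<le> sqnorm ?M (\<lambda>x. indicator (grid_cell s k) x *\<^sub>R (w x - m))"
        by (rule torsion_solution_ball_oscillation[OF \<Omega> fm w _ _ grid_cell_borel[OF s(1)] cball_subset_grid_cell[OF s(1)], rotated])
           (use s(1) in simp)
    qed
    also have "\<dots> \<le> V" unfolding V_def by (rule sum_sqnorm_grid_cells_le[OF sd G s(1)])
    finally show ?thesis .
  qed
  have m2: "m\<^sup>2 > 0" using m by simp
  have "V \<ge> 9 / 10 ^ 13 * (m\<^sup>2 * N)"
  \<comment> \<open>A variance of at least one percent is far more than needed. Otherwise 2 * V adds
    at most 2/100 to the half in \<open>mb\<close>, so the boundary cells cover at most 52 percent
    of \<open>\<Omega>\<close> and the interior cells at least 48 percent.\<close>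
  proof (cases "V \<ge> m\<^sup>2 * N / 100")
    case True
    moreover have "m\<^sup>2 * N \<ge> 0" using N by simp
    ultimately show ?thesis by simp
  next
    case False
    then have "m\<^sup>2 * b \<le> m\<^sup>2 * (52/100 * N)" using mb by simp
    then have "b \<le> 52/100 * N" using m2 by simp
    then have g: "real (card G) * s\<^sup>2 \<ge> 48/100 * N" using bG by simp
    \<comment> \<open>One factor s^2 is the area of a cell and sums to the covered area; the
      remaining s^4 is m^2 / 1250^2.\<close>
    have "s ^ 6 = s\<^sup>2 * (s\<^sup>2)\<^sup>2" by (simp flip: power_mult power_add)
    also have "\<dots> = s\<^sup>2 * (m\<^sup>2 / 1562500)" unfolding s(2) by (simp add: power_divide)
    finally have s6: "s ^ 6 = s\<^sup>2 * (m\<^sup>2 / 1562500)" .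
    have "9 / 10 ^ 13 * (m\<^sup>2 * N) \<le> (23/100000 * (49/100) ^ 6 / 1562500 * m\<^sup>2) * (48/100 * N)"
    proof -
      \<comment> \<open>The right-hand side is about 9.78 / 10^13.\<close>
      have "9 / 10 ^ 13 \<le> (23/100000 * (49/100) ^ 6 / 1562500 * (48/100) :: real)" by (simp add: power_divide)
      from mult_right_mono[OF this, of "m\<^sup>2 * N"] show ?thesis using N by (simp add: mult_ac)
    qed
    also have "\<dots> \<le> (23/100000 * (49/100) ^ 6 / 1562500 * m\<^sup>2) * (real (card G) * s\<^sup>2)"
      by (rule mult_left_mono[OF g]) simp
    also have "\<dots> = real (card G) * (23/100000 * (49/100 * s) ^ 6)"
      unfolding power_mult_distrib s6 by simp
    also have "\<dots> \<le> V" by (rule cells)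
    finally show ?thesis .
  qed
  then show ?thesis by (simp add: V_def N_def)
qed

text \<open>The bound pi > 3 alone gives 1 + 12/16 = 7/4 for the bracket, and with 7/4 in its place
  the fraction is about 3.14 / 10^13.\<close>

lemma polya_constant_bound:
  "3 ^ 4 / (12801 * 2 ^ 31 * (1 + (pi + pi\<^sup>2) / 16) ^ 4) < (4 / 10 ^ 13 :: real)"
proof -
  have "pi + pi\<^sup>2 \<ge> 3 + 3\<^sup>2" using pi_gt3 by (intro add_mono power_mono) auto
  then have ge: "1 + (pi + pi\<^sup>2) / 16 \<ge> 7 / 4" by simp
  then have "1 + (pi + pi\<^sup>2) / 16 > 0" by linarith
  from ge have "(1 + (pi + pi\<^sup>2) / 16) ^ 4 \<ge> (7 / 4) ^ 4" by (rule power_mono) simp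
  then have "3 ^ 4 / (12801 * 2 ^ 31 * (1 + (pi + pi\<^sup>2) / 16) ^ 4) \<le> 3 ^ 4 / (12801 * 2 ^ 31 * (7 / 4) ^ 4 :: real)"
    using \<open>1 + (pi + pi\<^sup>2) / 16 > 0\<close>
    by (intro divide_left_mono mult_left_mono mult_pos_pos zero_less_power) simp_all
  also have "\<dots> < 4 / 10 ^ 13" by (simp add: power_divide)
  finally show ?thesis .
qed

lemma first_eigenvalue_le:
  assumes "u \<in> H10 \<Omega>" "\<not> (AE x in lebesgue_on \<Omega>. u x = 0)"
  shows "first_eigenvalue \<Omega> \<le> sqnorm (lebesgue_on \<Omega>) (weak_grad \<Omega> u) / sqnorm (lebesgue_on \<Omega>) u"
  unfolding first_eigenvalue_def
proof (rule cInf_lower)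
  show "bdd_below {(LINT x|lebesgue_on \<Omega>. (norm (weak_grad \<Omega> u x))\<^sup>2) / (LINT x|lebesgue_on \<Omega>. (u x)\<^sup>2) | u.
           u \<in> H10 \<Omega> \<and> \<not> (AE x in lebesgue_on \<Omega>. u x = 0)}"
    by (rule bdd_belowI[of _ 0]) auto
qed (use assms in \<open>auto simp: sqnorm_def\<close>)

theorem theorem3:
  fixes \<Omega> :: "(real^2) set"
  assumes "\<Omega> \<noteq> {}" and "open \<Omega>" and "simply_connected \<Omega>" and "emeasure lebesgue \<Omega> < \<infinity>"
  shows "polya_functional \<Omega> < 1 - 3 ^ 4 / (12801 * 2 ^ 31 * (1 + (pi + pi\<^sup>2) / 16) ^ 4)"
proof -
  let ?M = "lebesgue_on \<Omega>"
  note \<Omega> = assms(2) and sc = assms(3) and fin = assms(4)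
  have fm: "finite_measure ?M"
    by (rule finite_measureI) (use \<Omega> fin in \<open>simp add: emeasure_restrict_space\<close>)
  define w where "w = torsion_function \<Omega>"
  define N where "N = measure lebesgue \<Omega>"
  define T where "T = (LINT x|?M. w x)"
  obtain C where "C \<ge> 0" "\<And>\<psi>. test_function \<Omega> \<psi> \<Longrightarrow> sqnorm ?M \<psi> \<le> C * sqnorm ?M (grad \<psi>)"
    using poincare_finite_measure[OF \<Omega> sc fin] by blast
  then have "\<exists>w. torsion_solution \<Omega> w" using torsion_solution_exists[OF \<Omega> fm] by blast
  \<comment> \<open>Existence turns the \<open>SOME\<close> in \<open>torsion_function\<close> into
    an actual solution.\<close>
  then have w: "torsion_solution \<Omega> w"
    unfolding w_def torsion_function_def by (rule someI_ex)
  have T: "T > 0" unfolding T_def by (rule torsion_solution_integral_pos[OF \<Omega> assms(1) fm w])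
  have "N \<noteq> 0"
  proof
    assume "N = 0"
    then have "emeasure lebesgue \<Omega> = 0"
      using fin emeasure_eq_ennreal_measure[of lebesgue \<Omega>] by (auto simp: N_def)
    then have "negligible \<Omega>" using \<Omega> by (auto simp: negligible_iff_null_sets)
    then show False using open_not_negligible[OF \<Omega> assms(1)] by blast
  qed
  then have N: "N > 0" using measure_nonneg[of lebesgue \<Omega>] unfolding N_def by linarith
  define m where "m = T / N"
  have m: "m > 0" "T = m * N" using T N by (simp_all add: m_def)
  have wH: "w \<in> H10 \<Omega>" using w by (simp add: torsion_solution_def)
  have sw: "sq_int ?M w" by (rule H10_sq_int[OF wH])
  have nz: "\<not> (AE x in ?M. w x = 0)"
  proof
    assume "AE x in ?M. w x = 0"
    then have "T = 0" unfolding T_def by (rule integral_eq_zero_AE)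
    then show False using T by simp
  qed
  define V where "V = sqnorm ?M (\<lambda>x. w x - m)"
  have V: "V \<ge> 9 / 10 ^ 13 * (m\<^sup>2 * N)"
    unfolding V_def N_def
    by (rule torsion_solution_variance[OF \<Omega> sc fin fm w m(1)]) (use m(2) in \<open>simp add: T_def N_def\<close>)
  \<comment> \<open>Since \<open>m\<close> is the mean of \<open>w\<close>, the expansion reduces to
    the variance identity: the squared norm of \<open>w\<close> is \<open>V + m\<^sup>2 * N\<close>.
    The Rayleigh quotient of \<open>w\<close> then bounds the functional by Q / (V + Q) with Q = m^2
    * N.\<close>
  have "sqnorm ?M (\<lambda>x. w x + (- m) *\<^sub>R 1) = sqnorm ?M w + 2 * (- m) * (LINT x|?M. w x \<bullet> 1) + (- m)\<^sup>2 * sqnorm ?M (\<lambda>x. 1::real)"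
    by (rule sqnorm_expand[OF sw sq_int_const[OF fm]])
  moreover have "sqnorm ?M (\<lambda>x. 1::real) = N"
    using \<Omega> by (simp add: sqnorm_def N_def measure_restrict_space)
  ultimately have "V = sqnorm ?M w - 2 * m * T + m\<^sup>2 * N" by (simp add: V_def T_def)
  then have sqw: "sqnorm ?M w = V + m\<^sup>2 * N" using m(2) by (simp add: power2_eq_square)
  define Q where "Q = m\<^sup>2 * N"
  have Q: "Q > 0" using m N by (simp add: Q_def)
  have lam: "first_eigenvalue \<Omega> \<le> T / sqnorm ?M w"
    using first_eigenvalue_le[OF wH nz] torsion_solution_energy[OF w] by (simp add: T_def)
  have "polya_functional \<Omega> = T * first_eigenvalue \<Omega> / N"
    by (simp add: polya_functional_def torsional_rigidity_def T_def N_def w_def)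
  also have "\<dots> \<le> T * (T / sqnorm ?M w) / N"
    using T N lam by (intro divide_right_mono mult_left_mono) auto
  also have "\<dots> = Q / (V + Q)"
    unfolding sqw using N by (simp add: m(2) Q_def power2_eq_square)
  also have "\<dots> \<le> Q / (9 / 10 ^ 13 * Q + Q)"
    using V Q by (intro divide_left_mono mult_pos_pos) (auto simp: Q_def[symmetric])
  also have "\<dots> = 1 / (9 / 10 ^ 13 + 1)"
  proof -
    have "9 / 10 ^ 13 * Q + Q = (9 / 10 ^ 13 + 1) * Q" by (simp only: distrib_right mult_1)
    then show ?thesis using Q by simp
  qed
  \<comment> \<open>To first order the value is 1 - 9/10^13, which leaves ample room above the
    stated constant.\<close>
  also have "\<dots> < 1 - 4 / 10 ^ 13" by simp
  finally show ?thesis using polya_constant_bound by linarith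
qed

end
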